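(* The value function $v$ of the optimal information acquisition problem is the unique solution, within the set $\mathbb{V}$ of candidate value functions, of the recursive (Bellman) equation \[ v(p) = \sup_{\tau \geq 0} \Biggl[ \int_0^\tau e^{-rt} u(p_t)\, dt + e^{-r \tau} \Biggl( \sup_{F \in \mathcal{B}(p_\tau)} \int_{\Delta(\Theta)} v\, dF - C(F) - \kappa \Biggr) \Biggr], \] where $p_t = e^{-\lambda t}p + (1-e^{-\lambda t})\pi$ is the deterministic belief path starting from $p_0=p$.
   Context: A decision maker (DM) takes an action at every instant $t\ge 0$; the unobserved state $\theta_t\in\Theta=\{0,1\}$ follows a Markov chain jumping $0\to1$ at rate $\lambda_0>0$ and $1\to0$ at rate $\lambda_1>0$; let $\lambda=\lambda_0+\lambda_1$ and $\pi=\lambda_0/(\lambda_0+\lambda_1)$. Beliefs are identified with $p\in[0,1]$ (probability that $\theta=1$). The indirect flow utility $u:\Delta(\Theta)\to\mathbb{R}$, $u(p)=\max_{a\in A}\mathbb{E}_{\theta\sim p}[\tilde u(a,\theta)]$, is continuous. The DM chooses an information acquisition policy $\{\tau_i,F_i\}_{i\in\mathbb{N}}$: increasing (random) acquisition times $\tau_i$ with $\tau_0=0$, and distributions over posteriors $F_i$ that are Bayes plausible with respect to the current belief, i.e. $F_i\in\mathcal{B}(P_{\tau_i^-})$ where $\mathcal{B}(p):=\{F\in\Delta\Delta(\Theta): \int q\,dF(q)=p\}$; between acquisition times beliefs drift deterministically, $dp_t=\lambda(\pi-p_t)dt$, and at $\tau_i$ a new belief is drawn from $F_i$. Each acquisition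 costs $C(F_i)+\kappa$ with fixed cost $\kappa>0$ and uniformly posterior separable variable cost $C(F)=\int (c(q)-c(p))\,dF(q)$, $p=\int q\,dF(q)$, for a convex $c:\Delta(\Theta)\to\overline{\mathbb{R}}_+$ that is finite and continuously differentiable on the interior. With discount rate $r>0$, the value function is $v(p):=\sup_{\{\tau_i,F_i\},\,F_0\in\mathcal{B}(p)}\mathbb{E}\bigl[\int_0^\infty e^{-rt}u(P_t)\,dt-\sum_{i\ge0}e^{-r\tau_i}(C(F_i)+\kappa)\bigr]$. Define $\overline v(p):=\int_0^\infty e^{-rt}\mathbb{E}_{\theta\sim p_t}[\max_a \tilde u(a,\theta)]\,dt$ (value under perfect costless observation of the state) and $\underline v(p):=\int_0^\infty e^{-rt}u(p_t)\,dt$ (value with no information). The set $\mathbb{V}$ of candidate value functions is the set of real-valued bounded measurable functions on $\Delta(\Theta)$ lying pointwise between $\underline v$ and $\overline v$.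
   Formalization: The first acquisition time is any τ_0 ≥ 0 instead of τ_0 = 0: a forced acquisition at time 0 costing κ would put v below the no-information value, hence outside 𝕍. Times increase strictly to infinity, and C(F) = 0 where c(p) = ∞. *)

theory Defs
  imports "HOL-Probability.Probability"
begin

text \<open>Beliefs p in [0,1] = probability that theta = 1. State 1 is encoded as True.
  lam0, lam1 are the jump rates; lambda = lam0 + lam1 and the invariant belief is
  lam0 / (lam0 + lam1).\<close>

definition drift :: "real \<Rightarrow> real \<Rightarrow> real \<Rightarrow> real \<Rightarrow> real" where
  "drift lam0 lam1 p t =
     exp (- (lam0 + lam1) * t) * p + (1 - exp (- (lam0 + lam1) * t)) * (lam0 / (lam0 + lam1))"

definition PostM :: "real measure" where
  "PostM = restrict_space borel {0..1}"

definition bayes_plausible :: "real \<Rightarrow> real measure set" where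
  "bayes_plausible p = {F. prob_space F \<and> sets F = sets PostM \<and> (\<integral>q. q \<partial>F) = p}"

text \<open>Uniformly posterior separable cost C(F) = integral of (c q - c p) dF(q), for an
  extended-real valued c >= 0; convention: when c p = infinity (then F = point mass at p)
  the cost is 0.\<close>
definition ups_cost :: "(real \<Rightarrow> ereal) \<Rightarrow> real measure \<Rightarrow> real \<Rightarrow> ereal" where
  "ups_cost c F p = (if c p = \<infinity> then 0
      else enn2ereal (\<integral>\<^sup>+ q. e2ennreal (c q) \<partial>F) - c p)"

definition convex_ext :: "(real \<Rightarrow> ereal) \<Rightarrow> bool" where
  "convex_ext c \<longleftrightarrow> (\<forall>x\<in>{0..1}. \<forall>y\<in>{0..1}. \<forall>t\<in>{0..1::real}.
      c ((1 - t) * x + t * y) \<le> ereal (1 - t) * c x + ereal t * c y)"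

definition admissible_c :: "(real \<Rightarrow> ereal) \<Rightarrow> bool" where
  "admissible_c c \<longleftrightarrow> (\<forall>p\<in>{0..1}. 0 \<le> c p) \<and> convex_ext c \<and>
      (\<forall>p\<in>{0<..<1}. c p \<noteq> \<infinity>) \<and>
      (\<lambda>p. real_of_ereal (c p)) C1_differentiable_on {0<..<1}"

definition exp_util :: "('a \<Rightarrow> bool \<Rightarrow> real) \<Rightarrow> 'a \<Rightarrow> real \<Rightarrow> real" where
  "exp_util ut a p = (1 - p) * ut a False + p * ut a True"

definition indirect_u :: "'a set \<Rightarrow> ('a \<Rightarrow> bool \<Rightarrow> real) \<Rightarrow> real \<Rightarrow> real" where
  "indirect_u A ut p = (SUP a\<in>A. exp_util ut a p)"

definition perfect_u :: "'a set \<Rightarrow> ('a \<Rightarrow> bool \<Rightarrow> real) \<Rightarrow> real \<Rightarrow> real" where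
  "perfect_u A ut p = (1 - p) * (SUP a\<in>A. ut a False) + p * (SUP a\<in>A. ut a True)"

definition v_low :: "'a set \<Rightarrow> ('a \<Rightarrow> bool \<Rightarrow> real) \<Rightarrow> real \<Rightarrow> real \<Rightarrow> real \<Rightarrow> real \<Rightarrow> real" where
  "v_low A ut r lam0 lam1 p =
     (LINT t:{0..}|lborel. exp (- r * t) * indirect_u A ut (drift lam0 lam1 p t))"

definition v_high :: "'a set \<Rightarrow> ('a \<Rightarrow> bool \<Rightarrow> real) \<Rightarrow> real \<Rightarrow> real \<Rightarrow> real \<Rightarrow> real \<Rightarrow> real" where
  "v_high A ut r lam0 lam1 p =
     (LINT t:{0..}|lborel. exp (- r * t) * perfect_u A ut (drift lam0 lam1 p t))"

definition CandV :: "'a set \<Rightarrow> ('a \<Rightarrow> bool \<Rightarrow> real) \<Rightarrow> real \<Rightarrow> real \<Rightarrow> real \<Rightarrow> (real \<Rightarrow> real) set" where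
  "CandV A ut r lam0 lam1 = {w. w \<in> borel_measurable PostM \<and> bounded (w ` {0..1}) \<and>
      (\<forall>p\<in>{0..1}. v_low A ut r lam0 lam1 p \<le> w p \<and> w p \<le> v_high A ut r lam0 lam1 p)}"

text \<open>Outcome omega i = (tau_i, q_i): i-th acquisition time and realized posterior
  (acquisitions indexed from 0; the first one may happen at time 0).\<close>
type_synonym outcome = "nat \<Rightarrow> real \<times> real"

definition Omega :: "outcome measure" where
  "Omega = PiM UNIV (\<lambda>_. borel)"

definition T :: "nat \<Rightarrow> outcome \<Rightarrow> real" where "T i \<omega> = fst (\<omega> i)"
definition Q :: "nat \<Rightarrow> outcome \<Rightarrow> real" where "Q i \<omega> = snd (\<omega> i)"

definition pre_belief :: "real \<Rightarrow> real \<Rightarrow> real \<Rightarrow> nat \<Rightarrow> outcome \<Rightarrow> real" where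
  "pre_belief lam0 lam1 p i \<omega> = (case i of
      0 \<Rightarrow> drift lam0 lam1 p (T 0 \<omega>)
    | Suc j \<Rightarrow> drift lam0 lam1 (Q j \<omega>) (T (Suc j) \<omega> - T j \<omega>))"

definition belief_path :: "real \<Rightarrow> real \<Rightarrow> real \<Rightarrow> outcome \<Rightarrow> real \<Rightarrow> real" where
  "belief_path lam0 lam1 p \<omega> t = (if t < T 0 \<omega> then drift lam0 lam1 p t
      else (let i = Max {i. T i \<omega> \<le> t} in drift lam0 lam1 (Q i \<omega>) (t - T i \<omega>)))"

definition info_alg :: "nat \<Rightarrow> outcome measure" where
  "info_alg i = vimage_algebra (space Omega) (\<lambda>\<omega>. (restrict \<omega> {..<i}, T i \<omega>))
      (PiM {..<i} (\<lambda>_. borel) \<Otimes>\<^sub>M borel)"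

text \<open>A policy starting at prior p: the joint law M of (tau_i, q_i)_i together with the
  chosen distributions over posteriors F_i (adapted to the DM's information), which are
  Bayes plausible w.r.t. P_{tau_i^-} and are the conditional laws of q_i.\<close>
definition policy :: "real \<Rightarrow> real \<Rightarrow> real \<Rightarrow> outcome measure \<Rightarrow> (nat \<Rightarrow> outcome \<Rightarrow> real measure) \<Rightarrow> bool" where
  "policy lam0 lam1 p M F \<longleftrightarrow> prob_space M \<and> sets M = sets Omega \<and>
     (AE \<omega> in M. 0 \<le> T 0 \<omega> \<and> (\<forall>i. T i \<omega> < T (Suc i) \<omega>) \<and>
         filterlim (\<lambda>i. T i \<omega>) at_top sequentially \<and> (\<forall>i. Q i \<omega> \<in> {0..1})) \<and>
     (\<forall>i. F i \<in> measurable (info_alg i) (subprob_algebra PostM)) \<and>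
     (AE \<omega> in M. \<forall>i. F i \<omega> \<in> bayes_plausible (pre_belief lam0 lam1 p i \<omega>)) \<and>
     (\<forall>i. \<forall>A\<in>sets (info_alg i). \<forall>B\<in>sets PostM.
         measure M (A \<inter> {\<omega>\<in>space M. Q i \<omega> \<in> B}) = (\<integral>\<omega>. indicator A \<omega> * measure (F i \<omega>) B \<partial>M))"

definition flow_payoff :: "(real \<Rightarrow> real) \<Rightarrow> real \<Rightarrow> real \<Rightarrow> real \<Rightarrow> real \<Rightarrow> outcome \<Rightarrow> real" where
  "flow_payoff u r lam0 lam1 p \<omega> =
     (LINT t:{0..}|lborel. exp (- r * t) * u (belief_path lam0 lam1 p \<omega> t))"

text \<open>Expected total discounted acquisition cost: sum over i of E[e^{-r tau_i}(C(F_i)+kappa)]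
  (equal to the expectation of the sum, all terms being nonnegative).\<close>
definition total_cost :: "(real \<Rightarrow> ereal) \<Rightarrow> real \<Rightarrow> real \<Rightarrow> real \<Rightarrow> real \<Rightarrow> real \<Rightarrow>
    outcome measure \<Rightarrow> (nat \<Rightarrow> outcome \<Rightarrow> real measure) \<Rightarrow> ennreal" where
  "total_cost c \<kappa> r lam0 lam1 p M F = (\<Sum>i. \<integral>\<^sup>+ \<omega>. ennreal (exp (- r * T i \<omega>)) *
      e2ennreal (ups_cost c (F i \<omega>) (pre_belief lam0 lam1 p i \<omega>) + ereal \<kappa>) \<partial>M)"

definition payoff :: "(real \<Rightarrow> real) \<Rightarrow> (real \<Rightarrow> ereal) \<Rightarrow> real \<Rightarrow> real \<Rightarrow> real \<Rightarrow> real \<Rightarrow> real \<Rightarrow>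
    outcome measure \<Rightarrow> (nat \<Rightarrow> outcome \<Rightarrow> real measure) \<Rightarrow> ereal" where
  "payoff u c \<kappa> r lam0 lam1 p M F =
     ereal (\<integral>\<omega>. flow_payoff u r lam0 lam1 p \<omega> \<partial>M) - enn2ereal (total_cost c \<kappa> r lam0 lam1 p M F)"

definition value_fn :: "(real \<Rightarrow> real) \<Rightarrow> (real \<Rightarrow> ereal) \<Rightarrow> real \<Rightarrow> real \<Rightarrow> real \<Rightarrow> real \<Rightarrow> real \<Rightarrow> ereal" where
  "value_fn u c \<kappa> r lam0 lam1 p =
     (SUP MF\<in>{(M, F). policy lam0 lam1 p M F}. payoff u c \<kappa> r lam0 lam1 p (fst MF) (snd MF))"

definition bellman_rhs :: "(real \<Rightarrow> real) \<Rightarrow> (real \<Rightarrow> ereal) \<Rightarrow> real \<Rightarrow> real \<Rightarrow> real \<Rightarrow> real \<Rightarrow>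
    (real \<Rightarrow> real) \<Rightarrow> real \<Rightarrow> ereal" where
  "bellman_rhs u c \<kappa> r lam0 lam1 w p =
     (SUP \<tau>\<in>{0..}. ereal (LINT t:{0..\<tau>}|lborel. exp (- r * t) * u (drift lam0 lam1 p t))
        + ereal (exp (- r * \<tau>)) *
          (SUP F\<in>bayes_plausible (drift lam0 lam1 p \<tau>).
              ereal (\<integral>q. w q \<partial>F) - ups_cost c F (drift lam0 lam1 p \<tau>) - ereal \<kappa>))"

end

theory Submission
  imports Defs
begin

text \<open>
  In one dimension every Bayes plausible experiment is dominated by one with at most two posteriors,
  because the binary splittings around a belief determine a supporting line of the concave envelope
  of \<open>w - c\<close>. This envelope is continuous on the open interval, so the Bellman operator maps arbitrary
  bounded functions to measurable ones, and its least supersolution \<open>w\<close> between the two bounds is a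
  measurable solution of the Bellman equation.

  Every supersolution dominates the payoff of every policy, by telescoping discounted continuation
  values along the acquisition times. Conversely, policies can be concatenated after a binary
  splitting, which makes the supremum over finitely supported policies a supersolution; hence this
  supremum dominates \<open>w\<close>, and \<open>w\<close> is the value function.

  The operator is no contraction, since waiting times may vanish. Uniqueness holds because it is
  monotone and convex, and the full information value raised by \<open>\<kappa>\<close> is a supersolution with slack \<open>\<kappa>\<close>.
\<close>

section \<open>Discounted integrals and belief drift\<close>

text \<open>The obstacle is measurability. Nothing makes the value function measurable beforehand,
  and continuing near-optimally after an arbitrary posterior distribution would call for a
  measurable selection of policies. Two-point experiments remove both difficulties: the binary
  operator contains no integral, so it can be applied to \<open>v_fin\<close>, the supremum over
  finitely supported policies, whose measurability is unknown; and a concatenation has to select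
  only two continuation policies. This is why supersolutions are arbitrary functions here, and
  measurability enters only through the fixed point property of the least one. Never acquiring
  information is another mismatch: every policy has infinitely many acquisitions and every \<tau> in
  the equation is finite. Hence the lower bound \<open>vl\<close> is reached only in limits, once
  for the operator and once for policies.\<close>

locale info_acquisition =
  fixes lam0 lam1 r \<kappa> a b :: real and u :: "real \<Rightarrow> real" and c :: "real \<Rightarrow> ereal"
  assumes lam: "lam0 > 0" "lam1 > 0" and r: "r > 0" and kappa: "\<kappa> > 0"
    and u_cont: "continuous_on {0..1} u" and u_meas[measurable]: "u \<in> borel_measurable borel"
    and u_le: "\<And>q. q \<in> {0..1} \<Longrightarrow> u q \<le> a + b * q"
    and adm: "admissible_c c"
begin

abbreviation "dr \<equiv> drift lam0 lam1"

lemma drift_0 [simp]: "dr p 0 = p"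
  by (simp add: drift_def)

lemma drift_add: "dr (dr p s) t = dr p (s + t)"
  unfolding drift_def by (simp add: algebra_simps flip: exp_add)

lemma drift_measurable [measurable]: "(\<lambda>(p, t). dr p t) \<in> borel_measurable (borel \<Otimes>\<^sub>M borel)"
  unfolding drift_def by measurable

lemma drift_measurable' [measurable (raw)]:
  assumes [measurable]: "f \<in> borel_measurable M" "g \<in> borel_measurable M"
  shows "(\<lambda>x. dr (f x) (g x)) \<in> borel_measurable M"
  unfolding drift_def by measurable

lemma drift_convex:
  assumes "0 \<le> t"
  obtains \<theta> \<rho> where "0 < \<theta>" "\<theta> \<le> 1" "0 < \<rho>" "\<rho> < 1" "t > 0 \<Longrightarrow> \<theta> < 1" "\<And>p. dr p t = \<theta> * p + (1 - \<theta>) * \<rho>"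
proof (rule that)
  show "0 < exp (- (lam0 + lam1) * t)" "0 < lam0 / (lam0 + lam1)" "lam0 / (lam0 + lam1) < 1"
    using lam by auto
  show "exp (- (lam0 + lam1) * t) \<le> 1" using lam assms
    by (simp add: mult_nonpos_nonneg)
  show "exp (- (lam0 + lam1) * t) < 1" if "t > 0" using lam that
    by (simp add: add_pos_pos mult_neg_pos)
qed (simp add: drift_def)

lemma drift_in: "p \<in> {0..1} \<Longrightarrow> 0 \<le> t \<Longrightarrow> dr p t \<in> {0..1}"
proof -
  assume *: "p \<in> {0..1}" "0 \<le> t"
  obtain \<theta> \<rho> where t: "0 < \<theta>" "\<theta> \<le> 1" "0 < \<rho>" "\<rho> < 1" "dr p t = \<theta> * p + (1 - \<theta>) * \<rho>"
    using drift_convex[OF *(2)] by metis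
  have "\<theta> * p + (1 - \<theta>) * \<rho> \<le> \<theta> * 1 + (1 - \<theta>) * 1"
    using t * by (intro add_mono mult_left_mono) auto
  then show ?thesis using t * by auto
qed

lemma drift_interior: 
  assumes "p \<in> {0..1}" "0 \<le> t" "t > 0 \<or> p \<in> {0<..<1}" shows "dr p t \<in> {0<..<1}"
proof -
  obtain \<theta> \<rho> where t: "0 < \<theta>" "\<theta> \<le> 1" "0 < \<rho>" "\<rho> < 1" "dr p t = \<theta> * p + (1 - \<theta>) * \<rho>" "t > 0 \<Longrightarrow> \<theta> < 1"
    using drift_convex[OF assms(2)] by metis
  show ?thesis
  proof (cases "t = 0")
    case False
    then have "\<theta> < 1" using assms t by auto
    have "\<theta> * p + (1 - \<theta>) * \<rho> < \<theta> * 1 + (1 - \<theta>) * 1" (is "_ < ?one")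
      using t assms \<open>\<theta> < 1\<close> by (intro add_le_less_mono mult_left_mono mult_strict_left_mono) auto
    moreover have "0 < (1 - \<theta>) * \<rho>" "0 \<le> \<theta> * p" using t assms \<open>\<theta> < 1\<close> by auto
    moreover have "?one = 1" by simp
    ultimately show ?thesis unfolding t greaterThanLessThan_iff by (intro conjI) linarith+
  qed (use assms in auto)
qed

lemma continuous_drift: "continuous_on UNIV (\<lambda>p. dr p t)"
  unfolding drift_def by (intro continuous_intros)

definition disc :: "(real \<Rightarrow> real) \<Rightarrow> real" where
  "disc f = (LINT t:{0..}|lborel. exp (- r * t) * f t)"

lemma exp_integrable: "set_integrable lborel {0..} (\<lambda>t. exp (- r * t))"
proof -
  have "set_integrable lborel {0<..} (\<lambda>t. exp (-(t * r)))"
    by (rule integrable_I0i_exp_mscale[OF r])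
  \<comment> \<open>The known integral is over the open half line; the endpoint 0 is a null
    set.\<close>
  then show ?thesis
    unfolding set_integrable_def
    by (rule integrable_cong_AE_imp)
       (auto intro!: AE_I'[of "{0}"] simp: indicator_def mult.commute split: if_splits)
qed

lemma disc_integrable:
  assumes [measurable]: "f \<in> borel_measurable borel" and "\<And>t. t \<ge> 0 \<Longrightarrow> \<bar>f t\<bar> \<le> K"
  shows "set_integrable lborel {0..} (\<lambda>t. exp (- r * t) * f t)"
proof (rule set_integrable_bound)
  show "set_integrable lborel {0..} (\<lambda>t. exp (- r * t) * K)"
    using exp_integrable by (rule set_integrable_mult_left)
  show "set_borel_measurable lborel {0..} (\<lambda>t. exp (- r * t) * f t)"
    unfolding set_borel_measurable_def by measurable
  show "AE t in lborel. t \<in> {0..} \<longrightarrow> norm (exp (- r * t) * f t) \<le> norm (exp (- r * t) * K)"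
    using assms(2) by (auto simp: abs_mult intro!: mult_left_mono order_trans[OF assms(2)])
qed

lemma disc_1_nonneg: "0 \<le> disc (\<lambda>_. 1)"
  unfolding disc_def set_lebesgue_integral_def by (intro integral_nonneg_AE) auto

lemma disc_mono:
  assumes "f \<in> borel_measurable borel" and "\<And>t. t \<ge> 0 \<Longrightarrow> \<bar>f t\<bar> \<le> K"
    and "g \<in> borel_measurable borel" and "\<And>t. t \<ge> 0 \<Longrightarrow> \<bar>g t\<bar> \<le> L"
    and "\<And>t. t \<ge> 0 \<Longrightarrow> f t \<le> g t"
  shows "disc f \<le> disc g"
  unfolding disc_def
  by (intro set_integral_mono disc_integrable[OF assms(1)] disc_integrable[OF assms(3)])
     (use assms in auto)

lemma disc_bound:
  assumes "f \<in> borel_measurable borel" and "\<And>t. t \<ge> 0 \<Longrightarrow> \<bar>f t\<bar> \<le> K"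
  shows "\<bar>disc f\<bar> \<le> K * disc (\<lambda>_. 1)"
proof -
  have K: "disc (\<lambda>_. k) = k * disc (\<lambda>_. 1)" for k by (simp add: disc_def)
  have "disc f \<le> disc (\<lambda>_. K)" "disc (\<lambda>_. - K) \<le> disc f"
     apply (rule disc_mono[where K=K and L="\<bar>K\<bar>"]; use assms in \<open>force simp: abs_le_iff\<close>)
    apply (rule disc_mono[where K="\<bar>K\<bar>" and L=K]; use assms in \<open>force simp: abs_le_iff\<close>)
    done
  then show ?thesis using K[of K] K[of "- K"] by auto
qed

lemma disc_split:
  assumes [measurable]: "f \<in> borel_measurable borel" and "\<And>t. t \<ge> 0 \<Longrightarrow> \<bar>f t\<bar> \<le> K" and "\<tau> \<ge> 0"
  shows "disc f = (LINT t:{0..\<tau>}|lborel. exp (- r * t) * f t) + exp (- r * \<tau>) * disc (\<lambda>t. f (\<tau> + t))"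
proof -
  note int = disc_integrable[OF assms(1,2)]
  have "{0..} = {0..\<tau>} \<union> {\<tau><..}" using assms by auto
  then have "disc f = (LINT t:{0..\<tau>}|lborel. exp (- r * t) * f t) + (LINT t:{\<tau><..}|lborel. exp (- r * t) * f t)"
    unfolding disc_def using assms
    by (simp, intro set_integral_Un) (auto intro!: set_integrable_subset[OF int[simplified]])
  also have "(LINT t:{\<tau><..}|lborel. exp (- r * t) * f t) 
     = (LINT t|lborel. indicator {\<tau><..} (\<tau> + t) *\<^sub>R (exp (- r * (\<tau> + t)) * f (\<tau> + t)))"
    unfolding set_lebesgue_integral_def
    using lborel_integral_real_affine[of 1 "\<lambda>t. indicator {\<tau><..} t *\<^sub>R (exp (- r * t) * f t)" \<tau>] by simp
  also have "\<dots> = (LINT t|lborel. exp (- r * \<tau>) * (indicator {0..} t *\<^sub>R (exp (- r * t) * f (\<tau> + t))))"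
  proof (rule integral_cong_AE)
    \<comment> \<open>The translation turns \<open>{\<tau><..}\<close> into the open half line,
      which differs from \<open>{0..}\<close> only in the point 0.\<close>
    have "AE t in lborel. t \<noteq> (0::real)" by (rule AE_lborel_singleton)
    then show "AE t in lborel. indicator {\<tau><..} (\<tau> + t) *\<^sub>R (exp (- r * (\<tau> + t)) * f (\<tau> + t))
       = exp (- r * \<tau>) * (indicator {0..} t *\<^sub>R (exp (- r * t) * f (\<tau> + t)))"
    proof (eventually_elim)
      fix t :: real assume "t \<noteq> 0"
      then have "indicator {\<tau><..} (\<tau> + t) = (indicator {0..} t :: real)" by (auto simp: indicator_def)
      moreover have "exp (- r * (\<tau> + t)) = exp (- r * \<tau>) * exp (- r * t)"
        by (simp only: distrib_left exp_add)
      ultimately show "indicator {\<tau><..} (\<tau> + t) *\<^sub>R (exp (- r * (\<tau> + t)) * f (\<tau> + t))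
       = exp (- r * \<tau>) * (indicator {0..} t *\<^sub>R (exp (- r * t) * f (\<tau> + t)))" by simp
    qed
  qed measurable
  also have "\<dots> = exp (- r * \<tau>) * disc (\<lambda>t. f (\<tau> + t))"
    unfolding disc_def set_lebesgue_integral_def by (rule integral_mult_right_zero)
  finally show ?thesis .
qed

section \<open>Values without information and with full information\<close>

definition "vl p = disc (\<lambda>t. u (dr p t))"
text \<open>In the application \<open>a + b * q\<close> is the expected payoff of a DM who knows the
  state, so \<open>vl\<close> and \<open>vh\<close> become the two bounds of the candidate
  set.\<close>

definition "vh p = disc (\<lambda>t. a + b * dr p t)"
definition "flow_until p \<tau> = (LINT t:{0..\<tau>}|lborel. exp (- r * t) * u (dr p t))"

lemma u_bound: obtains K where "K > 0" "\<And>q. q \<in> {0..1} \<Longrightarrow> \<bar>u q\<bar> \<le> K"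
proof -
  have "bounded (u ` {0..1})"
    using u_cont by (intro compact_imp_bounded compact_continuous_image) auto
  then show ?thesis using that unfolding bounded_pos by auto
qed

text \<open>Expresses a flow over a finite horizon through discounted values of \<open>vl\<close>.
  Bounds and continuity of \<open>flow_until\<close> are inherited from \<open>vl\<close> this way,
  and flows over successive waiting periods can be added up.\<close>

lemma flow_until_eq: "p \<in> {0..1} \<Longrightarrow> 0 \<le> \<tau> \<Longrightarrow> flow_until p \<tau> = vl p - exp (- r * \<tau>) * vl (dr p \<tau>)"
proof -
  assume *: "p \<in> {0..1}" "0 \<le> \<tau>"
  obtain K where K: "K > 0" "\<And>q. q \<in> {0..1} \<Longrightarrow> \<bar>u q\<bar> \<le> K" using u_bound by auto
  show ?thesis
    using disc_split[of "\<lambda>t. u (dr p t)" K \<tau>] K * drift_in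
    by (simp add: vl_def flow_until_def drift_add del: atLeastAtMost_iff)
qed

lemma vl_bound: obtains K where "K > 0" "\<And>q. q \<in> {0..1} \<Longrightarrow> \<bar>vl q\<bar> \<le> K"
proof -
  obtain K where K: "K > 0" "\<And>q. q \<in> {0..1} \<Longrightarrow> \<bar>u q\<bar> \<le> K" using u_bound by auto
  have "\<bar>vl q\<bar> \<le> K * disc (\<lambda>_. 1)" if "q \<in> {0..1}" for q
    unfolding vl_def by (rule disc_bound) (use K that drift_in in auto)
  then show ?thesis using that[of "K * disc (\<lambda>_. 1) + 1"] K disc_1_nonneg by force
qed

lemma abs_affine_le: "q \<in> {0..1} \<Longrightarrow> \<bar>a + b * q\<bar> \<le> \<bar>a\<bar> + \<bar>b\<bar>"
  using abs_triangle_ineq[of a "b * q"] mult_left_le[of "\<bar>q\<bar>" "\<bar>b\<bar>"] by (auto simp: abs_mult)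

text \<open>The drift is affine in the initial belief, and so is the flow. An affine function
  integrates to its value at the mean under every Bayes plausible distribution: information is
  worthless to a DM who knows the state already.\<close>

lemma vh_affine: obtains A B where "\<And>p. vh p = A + B * p"
proof -
  have 1: "set_integrable lborel {0..} (\<lambda>t. exp (- r * t) * (a + b * dr 0 t))"
    by (rule disc_integrable[OF _ abs_affine_le[OF drift_in]]) auto
  have 2: "set_integrable lborel {0..} (\<lambda>t. exp (- r * t) * (b * exp (- (lam0 + lam1) * t)))"
    using lam by (intro disc_integrable[where K="\<bar>b\<bar>"]) (auto simp: abs_mult mult_nonpos_nonneg intro!: mult_left_le)
  have "vh p = vh 0 + disc (\<lambda>t. b * exp (- (lam0 + lam1) * t)) * p" for p
  proof -
    have "vh p = (LINT t:{0..}|lborel. exp (- r * t) * (a + b * dr 0 t) + exp (- r * t) * (b * exp (- (lam0 + lam1) * t)) * p)"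
    proof -
      have "dr p t = dr 0 t + exp (- (lam0 + lam1) * t) * p" for t
        by (simp add: drift_def)
      then have "exp (- r * t) * (a + b * dr p t) 
        = exp (- r * t) * (a + b * dr 0 t) + exp (- r * t) * (b * exp (- (lam0 + lam1) * t)) * p" for t
        by (metis (no_types, lifting) add.assoc distrib_left mult.assoc)
      then show ?thesis unfolding vh_def disc_def by presburger
    qed
    also have "\<dots> = vh 0 + disc (\<lambda>t. b * exp (- (lam0 + lam1) * t)) * p"
      unfolding vh_def disc_def 
      by (subst set_integral_add(2)[OF 1 set_integrable_mult_left[OF 2]], subst set_integral_mult_left) (rule refl)
    finally show ?thesis .
  qed
  then show ?thesis by (rule that)
qed

lemma vh_split:
  assumes "p \<in> {0..1}" "0 \<le> \<tau>"
  shows "flow_until p \<tau> + exp (- r * \<tau>) * vh (dr p \<tau>) \<le> vh p"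
proof -
  obtain K where K: "K > 0" "\<And>q. q \<in> {0..1} \<Longrightarrow> \<bar>u q\<bar> \<le> K" using u_bound by auto
  let ?f = "\<lambda>t. a + b * dr p t"
  have bd: "\<bar>?f t\<bar> \<le> \<bar>a\<bar> + \<bar>b\<bar>" if "t \<ge> 0" for t
    using drift_in[OF assms(1) that] by (rule abs_affine_le)
  have "flow_until p \<tau> \<le> (LINT t:{0..\<tau>}|lborel. exp (- r * t) * ?f t)"
    unfolding flow_until_def
  proof (rule set_integral_mono)
    show "set_integrable lborel {0..\<tau>} (\<lambda>t. exp (- r * t) * u (dr p t))"
      using drift_in[OF assms(1)] K(2) 
      by (intro set_integrable_subset[OF disc_integrable[where K=K], of "\<lambda>t. u (dr p t)"]) auto
    show "set_integrable lborel {0..\<tau>} (\<lambda>t. exp (- r * t) * ?f t)"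
      using bd by (intro set_integrable_subset[OF disc_integrable, of ?f]) auto
  qed (use u_le drift_in[OF assms(1)] in auto)
  then show ?thesis
    using disc_split[of ?f, OF _ bd assms(2)] by (simp add: vh_def drift_add)
qed

lemma vl_continuous: "continuous_on {0..1} vl"
proof -
  obtain K where K: "K > 0" "\<And>q. q \<in> {0..1} \<Longrightarrow> \<bar>u q\<bar> \<le> K" using u_bound by auto
  show ?thesis unfolding continuous_on_sequentially comp_def
  proof (intro allI ballI impI, elim conjE)
    fix X :: "nat \<Rightarrow> real" and p assume p: "p \<in> {0..1}" and X: "\<forall>n. X n \<in> {0..1}" "X \<longlonglongrightarrow> p"
    show "(\<lambda>n. vl (X n)) \<longlonglongrightarrow> vl p"
      unfolding vl_def disc_def set_lebesgue_integral_def
    proof (rule integral_dominated_convergence[where w="\<lambda>t. indicator {0..} t *\<^sub>R (exp (- r * t) * K)"])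
      show "integrable lborel (\<lambda>t. indicator {0..} t *\<^sub>R (exp (- r * t) * K))"
        using set_integrable_mult_left[OF exp_integrable, of K] unfolding set_integrable_def by simp
      show "AE t in lborel. (\<lambda>n. indicator {0..} t *\<^sub>R (exp (- r * t) * u (dr (X n) t)))
         \<longlonglongrightarrow> indicator {0..} t *\<^sub>R (exp (- r * t) * u (dr p t))"
      proof (rule AE_I2)
        fix t show "(\<lambda>n. indicator {0..} t *\<^sub>R (exp (- r * t) * u (dr (X n) t)))
         \<longlonglongrightarrow> indicator {0..} t *\<^sub>R (exp (- r * t) * u (dr p t))"
        proof (cases "t \<ge> 0")
          case True
          have "(\<lambda>n. dr (X n) t) \<longlonglongrightarrow> dr p t"
            using X(2) unfolding drift_def by (intro tendsto_intros)
          then have "(\<lambda>n. u (dr (X n) t)) \<longlonglongrightarrow> u (dr p t)"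
            using X(1) p drift_in[OF _ True]
            by (intro continuous_on_tendsto_compose[OF u_cont]) auto
          then show ?thesis by (intro tendsto_intros)
        qed simp
      qed
      show "AE t in lborel. norm (indicator {0..} t *\<^sub>R (exp (- r * t) * u (dr (X n) t)))
          \<le> indicator {0..} t *\<^sub>R (exp (- r * t) * K)" for n
        using K(2)[OF drift_in[OF X(1)[rule_format]]]
        by (intro AE_I2) (simp add: abs_mult indicator_def)
    qed measurable
  qed
qed

section \<open>Posterior separable costs and binary experiments\<close>

text \<open>Only the endpoints 0 and 1 can have infinite \<open>c\<close>. There \<open>cr\<close>
  takes the default value 0, which is why statements about \<open>cr\<close> are restricted to
  \<open>dom_c\<close> or to the open interval.\<close>

definition "cr q = real_of_ereal (c q)"
definition "dom_c = {q \<in> {0..1}. c q \<noteq> \<infinity>}"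

lemma c_nonneg: "q \<in> {0..1} \<Longrightarrow> 0 \<le> c q"
  using adm unfolding admissible_c_def by auto

lemma c_eq: "q \<in> dom_c \<Longrightarrow> c q = ereal (cr q)"
  unfolding cr_def dom_c_def using c_nonneg[of q] by (cases "c q") auto

lemma cr_nonneg: "q \<in> dom_c \<Longrightarrow> 0 \<le> cr q"
  unfolding cr_def dom_c_def using c_nonneg[of q] by (cases "c q") auto

lemma dom_c_unit: "q \<in> dom_c \<Longrightarrow> q \<in> {0..1}"
  by (simp add: dom_c_def)

lemma interior_dom_c: "q \<in> {0<..<1} \<Longrightarrow> q \<in> dom_c"
  using adm unfolding admissible_c_def dom_c_def by auto

lemma cr_continuous: "continuous_on {0<..<1} cr"
  using adm unfolding admissible_c_def cr_def[abs_def]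
  by (auto intro: C1_differentiable_imp_continuous_on)

section \<open>Binary splittings and the concave envelope\<close>

lemma split_eq: "x < p \<Longrightarrow> p < y \<Longrightarrow> (y - p) / (y - x) * x + (1 - (y - p) / (y - x)) * y = p" for x :: real
proof -
  assume "x < p" "p < y"
  then have "1 - (y - p) / (y - x) = (p - x) / (y - x)" by (simp add: diff_divide_eq_iff)
  moreover have "(y - p) / (y - x) * x + (p - x) / (y - x) * y = ((y - p) * x + (p - x) * y) / (y - x)"
    by (simp add: add_divide_distrib)
  moreover have "(y - p) * x + (p - x) * y = p * (y - x)" by (simp add: algebra_simps)
  ultimately show ?thesis using \<open>x < p\<close> \<open>p < y\<close> by simp
qed

lemma cr_convex:
  assumes "x \<in> dom_c" "y \<in> dom_c" "x < p" "p < y"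
  shows "cr p \<le> (y - p) / (y - x) * cr x + (1 - (y - p) / (y - x)) * cr y" "p \<in> dom_c"
proof -
  let ?t = "1 - (y - p) / (y - x)"
  show p: "p \<in> dom_c"
    using assms dom_c_unit[OF assms(1)] dom_c_unit[OF assms(2)] by (auto intro!: interior_dom_c)
  have t: "?t \<in> {0..1}" using assms by (auto simp: field_simps)
  have conv: "convex_ext c" using adm by (auto simp: admissible_c_def)
  have "c ((1 - ?t) * x + ?t * y) \<le> ereal (1 - ?t) * c x + ereal ?t * c y"
    using t dom_c_unit[OF assms(1)] dom_c_unit[OF assms(2)]
    by (intro conv[unfolded convex_ext_def, rule_format]) auto
  moreover have "(1 - ?t) * x + ?t * y = p" using split_eq[OF assms(3,4)] by simp
  ultimately show "cr p \<le> (y - p) / (y - x) * cr x + ?t * cr y"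
    using c_eq[OF p] c_eq[OF assms(1)] c_eq[OF assms(2)] by simp
qed

text \<open>Continuation values net of the variable cost, which for the split of \<open>p\<close>
  into \<open>x\<close> and \<open>y\<close> is
  \<open>\<alpha> * cr x + (1 - \<alpha>) * cr y - cr p\<close>. The uninformative experiment is
  inserted separately, so that an endpoint, which cannot be split, has a value too. For interior
  \<open>p\<close>, the supremum minus \<open>cr p\<close> is the concave envelope of
  \<open>w - c\<close> at \<open>p\<close>.\<close>

definition "binary_values w p = insert (w p) {\<alpha> * (w x - cr x) + (1 - \<alpha>) * (w y - cr y) + cr p | x y \<alpha>.
   x \<in> dom_c \<and> y \<in> dom_c \<and> x < p \<and> p < y \<and> \<alpha> = (y - p) / (y - x)}"

lemma binary_values_mem:
  "x \<in> dom_c \<Longrightarrow> y \<in> dom_c \<Longrightarrow> x < p \<Longrightarrow> p < y \<Longrightarrow> \<alpha> = (y - p) / (y - x) \<Longrightarrow>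
   \<alpha> * (w x - cr x) + (1 - \<alpha>) * (w y - cr y) + cr p \<in> binary_values w p"
  unfolding binary_values_def by blast

lemma binary_values_cases:
  assumes "\<eta> \<in> binary_values w p"
  obtains "\<eta> = w p" | x y \<alpha> where "x \<in> dom_c" "y \<in> dom_c" "x < p" "p < y" "\<alpha> = (y - p) / (y - x)"
    "0 < \<alpha>" "\<alpha> < 1" "\<alpha> * x + (1 - \<alpha>) * y = p" "cr p \<le> \<alpha> * cr x + (1 - \<alpha>) * cr y"
    "\<eta> = \<alpha> * (w x - cr x) + (1 - \<alpha>) * (w y - cr y) + cr p"
proof -
  consider "\<eta> = w p" | x y \<alpha> where "x \<in> dom_c" "y \<in> dom_c" "x < p" "p < y" "\<alpha> = (y - p) / (y - x)"
    "\<eta> = \<alpha> * (w x - cr x) + (1 - \<alpha>) * (w y - cr y) + cr p"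
    using assms unfolding binary_values_def by blast
  then show thesis
  proof cases
    case (2 x y \<alpha>)
    have "0 < \<alpha>" "\<alpha> < 1" unfolding 2(5) using 2(3,4) by auto
    then show thesis using that(2)[of x y \<alpha>] cr_convex[of x y p] split_eq[of x p y] 2 by metis
  qed (rule that)
qed

text \<open>A splitting averages values of \<open>w\<close>, and convexity of \<open>cr\<close>
  makes its cost nonnegative.\<close>

lemma binary_values_le:
  assumes "\<And>q. q \<in> {0..1} \<Longrightarrow> w q \<le> K" "p \<in> {0..1}" "\<eta> \<in> binary_values w p"
  shows "\<eta> \<le> K"
  using assms(3)
proof (cases rule: binary_values_cases)
  case (2 x y \<alpha>)
  have "\<alpha> * w x + (1 - \<alpha>) * w y \<le> \<alpha> * K + (1 - \<alpha>) * K"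
    using 2 assms(1)[OF dom_c_unit] by (intro add_mono mult_left_mono) auto
  moreover have "\<alpha> * K + (1 - \<alpha>) * K = K" by (simp add: algebra_simps)
  moreover have "\<eta> = (\<alpha> * w x + (1 - \<alpha>) * w y) - (\<alpha> * cr x + (1 - \<alpha>) * cr y) + cr p"
    unfolding 2(10) by (simp only: algebra_simps)
  ultimately show ?thesis using 2(9) by linarith
qed (use assms in auto)

lemma binary_values_bdd: "(\<And>q. q \<in> {0..1} \<Longrightarrow> w q \<le> K) \<Longrightarrow> p \<in> {0..1} \<Longrightarrow> bdd_above (binary_values w p)"
  by (rule bdd_aboveI[where M=K]) (rule binary_values_le)

lemma binary_values_nonempty: "binary_values w p \<noteq> {}" by (simp add: binary_values_def)

text \<open>One-dimensional Caratheodory: the binary splittings around an interior belief already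
  force a supporting line of the concave envelope there.\<close>
lemma support_line:
  assumes w: "\<And>q. q \<in> {0..1} \<Longrightarrow> w q \<le> K" and p: "p \<in> {0<..<1}"
  obtains s where "\<And>q. q \<in> dom_c \<Longrightarrow> w q - cr q \<le> Sup (binary_values w p) - cr p + s * (q - p)"
proof -
  let ?f = "\<lambda>q. w q - cr q"
  define m where "m = Sup (binary_values w p) - cr p"
  have up: "\<eta> \<le> Sup (binary_values w p)" if "\<eta> \<in> binary_values w p" for \<eta>
    using binary_values_bdd[of w K p] w p that by (auto intro: cSup_upper)
  \<comment> \<open>The inequality for the split of \<open>p\<close> into \<open>x\<close> and
    \<open>y\<close>, rearranged: chords from the point \<open>(p, m)\<close> to the right have
    slopes no larger than chords to the left.\<close>
  have slope: "(?f y - m) / (y - p) \<le> (m - ?f x) / (p - x)" if "x \<in> dom_c" "y \<in> dom_c" "x < p" "p < y" for x y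
  proof -
    have "(y - p) / (y - x) * ?f x + (1 - (y - p) / (y - x)) * ?f y \<le> m"
      using up[OF binary_values_mem[OF that refl, of w]] unfolding m_def by simp
    moreover have "1 - (y - p) / (y - x) = (p - x) / (y - x)"
      using that by (simp add: field_simps)
    ultimately have "((y - p) * ?f x + (p - x) * ?f y) / (y - x) \<le> m"
      by (simp add: add_divide_distrib)
    then have "(y - p) * ?f x + (p - x) * ?f y \<le> m * (y - x)"
      using that by (simp add: pos_divide_le_eq)
    then have "(?f y - m) * (p - x) \<le> (m - ?f x) * (y - p)" by (simp add: algebra_simps)
    then show ?thesis using that by (simp add: divide_simps mult.commute)
  qed
  \<comment> \<open>The right slopes. They are bounded by any left slope, for instance the one at
    \<open>p / 2\<close>, so their supremum separates the two families and serves as the slope of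
    the line.\<close>
  define X where "X = (\<lambda>y. (?f y - m) / (y - p)) ` {y \<in> dom_c. p < y}"
  define s where "s = Sup X"
  have X: "X \<noteq> {}" "\<And>x. x \<in> dom_c \<Longrightarrow> x < p \<Longrightarrow> \<forall>z\<in>X. z \<le> (m - ?f x) / (p - x)"
    using p interior_dom_c[of "(p + 1) / 2"] slope unfolding X_def by (auto intro!: exI[of _ "(p + 1) / 2"])
  have "bdd_above X" using X(2)[of "p / 2"] p interior_dom_c[of "p / 2"] unfolding bdd_above_def by auto
  show thesis
  proof (rule that[of s], fold m_def)
    fix q assume q: "q \<in> dom_c"
    consider "q = p" | "p < q" | "q < p" by linarith
    then show "?f q \<le> m + s * (q - p)"
    proof cases
      case 1
      then show ?thesis using up[of "w p"] by (simp add: m_def binary_values_def)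
    next
      case 2
      then have "(?f q - m) / (q - p) \<le> s"
        unfolding s_def using q \<open>bdd_above X\<close> by (intro cSup_upper) (auto simp: X_def)
      then show ?thesis using 2 by (simp add: pos_divide_le_eq)
    next
      case 3
      then have "s \<le> (m - ?f q) / (p - q)"
        unfolding s_def using q X by (intro cSup_least) auto
      then show ?thesis using 3 by (simp add: pos_le_divide_eq algebra_simps)
    qed
  qed
qed

text \<open>A subgradient of \<open>cr\<close>, obtained as the supporting line for
  \<open>w = 0\<close>: by convexity no splitting of the zero function has a positive value.\<close>

lemma tangent_line:
  assumes p: "p \<in> {0<..<1}"
  obtains s where "\<And>q. q \<in> dom_c \<Longrightarrow> cr p + s * (q - p) \<le> cr q"
proof -
  obtain s where s: "\<And>q. q \<in> dom_c \<Longrightarrow> 0 - cr q \<le> Sup (binary_values (\<lambda>_. 0) p) - cr p + s * (q - p)"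
    using support_line[of "\<lambda>_. 0" 0 p] p by auto
  have "Sup (binary_values (\<lambda>_. 0) p) \<le> 0"
    using binary_values_le[of "\<lambda>_. 0" 0 p] p by (intro cSup_least binary_values_nonempty) auto
  then show thesis using s by (intro that[of "- s"]) force
qed

text \<open>At each interior point the envelope lies below an affine function that it touches there,
  hence it is concave, hence continuous on the open interval. Since \<open>cr\<close> is continuous
  there as well, adding it back is harmless. The function \<open>w\<close> itself may be wildly
  discontinuous.\<close>

lemma Sup_binary_values_continuous:
  assumes w: "\<And>q. q \<in> {0..1} \<Longrightarrow> w q \<le> K"
  shows "continuous_on {0<..<1} (\<lambda>p. Sup (binary_values w p))"
proof -
  have "convex_on {0<..<1} (\<lambda>p. - (Sup (binary_values w p) - cr p))"
  proof (rule convex_onI)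
    fix t x y :: real
    assume t: "0 < t" "t < 1" and xy: "x \<in> {0<..<1}" "y \<in> {0<..<1}"
    define p where "p = (1 - t) * x + t * y"
    have "convex {0<..<(1::real)}" by simp
    then have p: "p \<in> {0<..<1}" unfolding p_def using convexD_alt[OF _ xy, of t] t by simp
    obtain s where s: "\<And>q. q \<in> dom_c \<Longrightarrow> w q - cr q \<le> Sup (binary_values w p) - cr p + s * (q - p)"
      using support_line[of w K p] w p by metis
    \<comment> \<open>The supporting line at \<open>p\<close> dominates the whole envelope and not
      only \<open>w - cr\<close>, because the value of a split of \<open>z\<close> averages to the
      value of the line at \<open>z\<close>.\<close>
    have *: "Sup (binary_values w z) - cr z \<le> Sup (binary_values w p) - cr p + s * (z - p)" if z: "z \<in> {0<..<1}" for z
    proof -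
      have "Sup (binary_values w z) \<le> Sup (binary_values w p) - cr p + s * (z - p) + cr z"
      proof (rule cSup_least[OF binary_values_nonempty])
        fix \<eta> assume "\<eta> \<in> binary_values w z"
        then show "\<eta> \<le> Sup (binary_values w p) - cr p + s * (z - p) + cr z"
        proof (cases rule: binary_values_cases)
          case 1
          then show ?thesis using s[OF interior_dom_c[OF z]] by simp
        next
          case (2 x y \<alpha>)
          have "\<alpha> * (w x - cr x) + (1 - \<alpha>) * (w y - cr y) \<le>
            \<alpha> * (Sup (binary_values w p) - cr p + s * (x - p)) + (1 - \<alpha>) * (Sup (binary_values w p) - cr p + s * (y - p))"
            using 2 s by (intro add_mono mult_left_mono) auto
          also have "\<dots> = Sup (binary_values w p) - cr p + s * ((\<alpha> * x + (1 - \<alpha>) * y) - p)"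
            by (simp add: algebra_simps)
          finally show ?thesis unfolding 2(8) 2(10) by simp
        qed
      qed
      then show ?thesis by simp
    qed
    have "(1 - t) * (Sup (binary_values w x) - cr x) + t * (Sup (binary_values w y) - cr y) \<le>
      (1 - t) * (Sup (binary_values w p) - cr p + s * (x - p)) + t * (Sup (binary_values w p) - cr p + s * (y - p))"
      using t xy by (intro add_mono mult_left_mono *) auto
    also have "\<dots> = Sup (binary_values w p) - cr p + s * (((1 - t) * x + t * y) - p)"
      by (simp add: algebra_simps)
    also have "\<dots> = Sup (binary_values w p) - cr p" by (simp add: p_def)
    finally show "- (Sup (binary_values w ((1 - t) *\<^sub>R x + t *\<^sub>R y)) - cr ((1 - t) *\<^sub>R x + t *\<^sub>R y)) 
      \<le> (1 - t) * - (Sup (binary_values w x) - cr x) + t * - (Sup (binary_values w y) - cr y)"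
      unfolding p_def by (simp add: algebra_simps)
  qed auto
  then have "continuous_on {0<..<1} (\<lambda>p. - (Sup (binary_values w p) - cr p))"
    by (intro convex_on_continuous) auto
  from continuous_on_diff[OF cr_continuous this] show ?thesis by simp
qed

section \<open>Bayes plausible distributions and their costs\<close>

lemma space_PostM [simp]: "space PostM = {0..1}"
  by (simp add: PostM_def space_restrict_space)

lemma ident_measurable_PostM [measurable]: "(\<lambda>q. q) \<in> borel_measurable PostM"
  unfolding PostM_def by (auto intro: measurable_restrict_space1)

lemma bayes_plausibleD:
  assumes "F \<in> bayes_plausible p"
  shows "prob_space F" "sets F = sets PostM" "space F = {0..1}" "(\<integral>q. q \<partial>F) = p"
    "borel_measurable F = borel_measurable PostM"
  using assms sets_eq_imp_space_eq[of F PostM] measurable_cong_sets[of F PostM borel borel] 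
  by (auto simp: bayes_plausible_def)

lemma bayes_plausible_integrable:
  fixes w :: "real \<Rightarrow> real"
  assumes "F \<in> bayes_plausible p" "w \<in> borel_measurable PostM" "\<And>q. q \<in> {0..1} \<Longrightarrow> \<bar>w q\<bar> \<le> K"
  shows "integrable F w"
proof -
  interpret prob_space F using bayes_plausibleD[OF assms(1)] by auto
  show ?thesis using assms bayes_plausibleD[OF assms(1)]
    by (intro integrable_const_bound[where B=K] AE_I2) auto
qed

lemma bayes_plausible_affine:
  assumes "F \<in> bayes_plausible p"
  shows "(\<integral>q. A + B * q \<partial>F) = A + B * p" "integrable F (\<lambda>q. A + B * q)"
proof -
  interpret prob_space F using bayes_plausibleD[OF assms(1)] by auto
  have *: "integrable F (\<lambda>q. q)"
    by (rule bayes_plausible_integrable[OF assms, where K=1]) auto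
  show "integrable F (\<lambda>q. A + B * q)"
    by (intro Bochner_Integration.integrable_add integrable_mult_right *) simp
  show "(\<integral>q. A + B * q \<partial>F) = A + B * p"
    by (subst Bochner_Integration.integral_add)
       (simp_all add: prob_space * bayes_plausibleD(4)[OF assms])
qed

text \<open>Links real integrals to costs that may be infinite. The function \<open>g\<close> can be
  negative, so it is first replaced by its positive part.\<close>

lemma integral_le_nn_integral:
  assumes "integrable M g" "AE x in M. ereal (g x) \<le> enn2ereal (f x)"
  shows "ereal (\<integral>x. g x \<partial>M) \<le> enn2ereal (\<integral>\<^sup>+x. f x \<partial>M)"
proof -
  have "ereal (\<integral>x. g x \<partial>M) \<le> ereal (\<integral>x. max 0 (g x) \<partial>M)"
    using assms(1) by (auto intro!: integral_mono)
  also have "\<dots> = enn2ereal (ennreal (\<integral>x. max 0 (g x) \<partial>M))"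
    by (subst enn2ereal_ennreal) (auto intro!: integral_nonneg_AE)
  also have "ennreal (\<integral>x. max 0 (g x) \<partial>M) = (\<integral>\<^sup>+x. ennreal (max 0 (g x)) \<partial>M)"
    using assms(1) by (subst nn_integral_eq_integral) auto
  also have "enn2ereal \<dots> \<le> enn2ereal (\<integral>\<^sup>+x. f x \<partial>M)"
    unfolding less_eq_ennreal.rep_eq[symmetric]
  proof (rule nn_integral_mono_AE, use assms(2) in eventually_elim)
    fix x assume "ereal (g x) \<le> enn2ereal (f x)"
    then show "ennreal (max 0 (g x)) \<le> f x"
      by (cases "0 \<le> g x") (simp add: less_eq_ennreal.rep_eq enn2ereal_ennreal, simp add: ennreal_neg)
  qed
  finally show ?thesis .
qed

text \<open>If \<open>w - c\<close> lies below a line with value \<open>m - cr p\<close> at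
  \<open>p\<close>, integrate: Bayes plausibility returns the value of the line at the mean
  \<open>p\<close>. Off \<open>dom_c\<close> the bound is trivial, since \<open>c\<close> is
  infinite there.\<close>

lemma cost_ge_affine:
  assumes F: "F \<in> bayes_plausible p" and p: "p \<in> dom_c" and [measurable]: "w \<in> borel_measurable PostM"
    and w: "\<And>q. q \<in> {0..1} \<Longrightarrow> \<bar>w q\<bar> \<le> K"
    and le: "\<And>q. q \<in> dom_c \<Longrightarrow> w q - cr q \<le> m - cr p + s * (q - p)"
  shows "ereal ((\<integral>q. w q \<partial>F) - m) \<le> ups_cost c F p"
proof -
  note D = bayes_plausibleD[OF F]
  interpret prob_space F by fact
  have i1: "integrable F w" by (rule bayes_plausible_integrable[OF F]) (use w in auto)
  note i2 = bayes_plausible_affine[OF F, of "m - cr p - s * p" s]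
  have "ereal (\<integral>q. w q - ((m - cr p - s * p) + s * q) \<partial>F) \<le> enn2ereal (\<integral>\<^sup>+ q. e2ennreal (c q) \<partial>F)"
  proof (rule integral_le_nn_integral[OF _ AE_I2])
    fix q assume "q \<in> space F"
    then have q: "q \<in> {0..1}" using D by auto
    show "ereal (w q - ((m - cr p - s * p) + s * q)) \<le> enn2ereal (e2ennreal (c q))"
    proof (cases "q \<in> dom_c")
      case True
      then show ?thesis using le[OF True] cr_nonneg[OF True] c_eq[OF True]
        by (simp add: enn2ereal_e2ennreal algebra_simps)
    next
      case False
      then have "c q = \<infinity>" using q by (auto simp: dom_c_def)
      then show ?thesis by (simp add: enn2ereal_e2ennreal)
    qed
  qed (use i1 i2 in auto)
  also have "(\<integral>q. w q - ((m - cr p - s * p) + s * q) \<partial>F) = (\<integral>q. w q \<partial>F) - m + cr p"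
    by (subst Bochner_Integration.integral_diff[OF i1 i2(2)], subst i2(1)) simp
  finally have *: "ereal ((\<integral>q. w q \<partial>F) - m + cr p) \<le> enn2ereal (\<integral>\<^sup>+ q. e2ennreal (c q) \<partial>F)" .
  show ?thesis
    unfolding ups_cost_def using c_eq[OF p] *
    by (cases "enn2ereal (\<integral>\<^sup>+ q. e2ennreal (c q) \<partial>F)") auto
qed

text \<open>A distribution on the unit interval whose mean is an endpoint must be the point mass
  there. Its cost vanishes, by the convention in \<open>ups_cost\<close> if \<open>c p\<close> is
  infinite.\<close>

lemma bayes_plausible_endpoint:
  assumes F: "F \<in> bayes_plausible p" and p: "p = 0 \<or> p = 1"
    and w: "(w :: real \<Rightarrow> real) \<in> borel_measurable PostM"
  shows "AE q in F. q = p" "(\<integral>q. w q \<partial>F) = w p" "ups_cost c F p = 0"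
proof -
  note D = bayes_plausibleD[OF F]
  interpret prob_space F by fact
  \<comment> \<open>The sign that makes \<open>B * q - B * p\<close> nonnegative on the unit
    interval; its integral is 0, so it vanishes almost everywhere.\<close>
  define B where "B = (if p = 0 then 1 else - 1 :: real)"
  have "(\<integral>q. B * q - B * p \<partial>F) = 0"
    using bayes_plausible_affine(1)[OF F, of "- B * p" B] by simp
  moreover have "integrable F (\<lambda>q. B * q - B * p)"
    using bayes_plausible_affine(2)[OF F, of "- B * p" B] by simp
  moreover have "AE q in F. 0 \<le> B * q - B * p"
    using p D(3) by (intro AE_I2) (auto simp: B_def)
  ultimately have "AE q in F. B * q - B * p = 0"
    using integral_nonneg_eq_0_iff_AE[of F "\<lambda>q. B * q - B * p"] by auto
  then show ae: "AE q in F. q = p" by eventually_elim (auto simp: B_def split: if_splits)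
  show "(\<integral>q. w q \<partial>F) = w p"
  proof -
    have "(\<integral>q. w q \<partial>F) = (\<integral>q. w p \<partial>F)"
      by (rule integral_cong_AE) (use w D(5) ae in \<open>auto elim!: eventually_mono\<close>)
    then show ?thesis by (simp add: prob_space)
  qed
  show "ups_cost c F p = 0"
  proof -
    have "(\<integral>\<^sup>+ q. e2ennreal (c q) \<partial>F) = (\<integral>\<^sup>+ q. e2ennreal (c p) \<partial>F)"
      by (rule nn_integral_cong_AE, use ae in eventually_elim) simp
    also have "\<dots> = e2ennreal (c p)" by (simp add: emeasure_space_1)
    finally show ?thesis unfolding ups_cost_def 
      using c_nonneg[of p] p by (cases "c p") (auto simp: enn2ereal_e2ennreal)
  qed
qed

text \<open>Jensen's inequality for an extended real-valued \<open>c\<close>, by integrating a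
  subgradient line; at the endpoints the distribution is a point mass.\<close>

lemma ups_cost_nonneg:
  assumes "F \<in> bayes_plausible p" "p \<in> {0..1}"
  shows "0 \<le> ups_cost c F p"
proof (cases "p = 0 \<or> p = 1")
  case True
  then show ?thesis using bayes_plausible_endpoint(3)[OF assms(1) True, of "\<lambda>_. 0"] by simp
next
  case False
  then have p: "p \<in> {0<..<1}" using assms by auto
  obtain s where s: "\<And>q. q \<in> dom_c \<Longrightarrow> cr p + s * (q - p) \<le> cr q" using tangent_line[OF p] by auto
  have "ereal ((\<integral>q. 0 \<partial>F) - 0) \<le> ups_cost c F p"
    by (rule cost_ge_affine[OF assms(1) interior_dom_c[OF p], where K=0 and s="- s"])
       (use s in \<open>force+\<close>)
  then show ?thesis by (simp add: zero_ereal_def)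
qed

text \<open>Integrating the supporting line at \<open>p\<close> bounds every experiment of finite
  cost by the binary ones. At an endpoint the point mass is all there is, and \<open>w p\<close> is
  a binary value.\<close>

lemma experiment_le_binary:
  assumes F: "F \<in> bayes_plausible p" and p: "p \<in> {0..1}" and w: "w \<in> borel_measurable PostM"
    "\<And>q. q \<in> {0..1} \<Longrightarrow> \<bar>w q\<bar> \<le> K"
    and C: "ups_cost c F p \<noteq> \<infinity>"
  shows "(\<integral>q. w q \<partial>F) - real_of_ereal (ups_cost c F p) \<le> Sup (binary_values w p)"
proof -
  have w': "\<And>q. q \<in> {0..1} \<Longrightarrow> w q \<le> K" using w(2) abs_le_D1 by blast
  show ?thesis
  proof (cases "p = 0 \<or> p = 1")
    case True
    have "w p \<le> Sup (binary_values w p)" using binary_values_bdd[OF w' p] by (auto intro: cSup_upper simp: binary_values_def)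
    then show ?thesis using bayes_plausible_endpoint[OF F True w(1)] by simp
  next
    case False
    then have p': "p \<in> {0<..<1}" using p by auto
    obtain s where s: "\<And>q. q \<in> dom_c \<Longrightarrow> w q - cr q \<le> Sup (binary_values w p) - cr p + s * (q - p)"
      using support_line[of w K p] w' p' by metis
    have "ereal ((\<integral>q. w q \<partial>F) - Sup (binary_values w p)) \<le> ups_cost c F p"
      by (rule cost_ge_affine[OF F interior_dom_c[OF p'] w(1) _ s]) (use w in auto)
    then show ?thesis using C ups_cost_nonneg[OF F p] by (cases "ups_cost c F p") auto
  qed
qed

text \<open>The posterior is \<open>x\<close> with probability \<alpha> and \<open>y\<close>
  otherwise; \<open>split_post p p 1\<close> is the uninformative experiment.\<close>

definition "split_post x y \<alpha> = distr (measure_pmf (bernoulli_pmf \<alpha>)) PostM (\<lambda>b. if b then x else y)"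

lemma split_post_measurable:
  "x \<in> {0..1} \<Longrightarrow> y \<in> {0..1} \<Longrightarrow> (\<lambda>b. if b then x else y) \<in> measurable (measure_pmf (bernoulli_pmf \<alpha>)) PostM"
  by (auto simp: measurable_def)

lemma integral_split_post:
  fixes w :: "real \<Rightarrow> real"
  assumes "x \<in> {0..1}" "y \<in> {0..1}" "\<alpha> \<in> {0..1}" "w \<in> borel_measurable PostM"
  shows "(\<integral>q. w q \<partial>split_post x y \<alpha>) = \<alpha> * w x + (1 - \<alpha>) * w y"
  unfolding split_post_def
  by (subst integral_distr[OF split_post_measurable]) (use assms in auto)

lemma split_post_plausible:
  assumes "x \<in> {0..1}" "y \<in> {0..1}" "\<alpha> \<in> {0..1}" "\<alpha> * x + (1 - \<alpha>) * y = p"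
  shows "split_post x y \<alpha> \<in> bayes_plausible p"
  using assms integral_split_post[OF assms(1-3), of "\<lambda>q. q"]
    measure_pmf.prob_space_distr[OF split_post_measurable, of x y \<alpha>]
  by (auto simp: bayes_plausible_def split_post_def)

text \<open>The cost integrand comes without a measurability assumption on \<open>c\<close>, so the
  change of variables is used only as an inequality: the integral is a supremum over simple
  functions below \<open>f\<close>, and these can be pulled back along \<open>g\<close>. Upper
  bounds on costs follow from it.\<close>

lemma nn_integral_distr_le:
  assumes "g \<in> measurable M N"
  shows "(\<integral>\<^sup>+x. f x \<partial>distr M N g) \<le> (\<integral>\<^sup>+x. f (g x) \<partial>M)"
proof -
  have "integral\<^sup>S (distr M N g) h \<le> (\<integral>\<^sup>+x. f (g x) \<partial>M)" if h: "simple_function (distr M N g) h" "h \<le> f" for h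
  proof -
    have "integral\<^sup>S (distr M N g) h = (\<integral>\<^sup>+x. h x \<partial>distr M N g)"
      using h(1) by (simp add: nn_integral_eq_simple_integral)
    also have "\<dots> = (\<integral>\<^sup>+x. h (g x) \<partial>M)"
      using borel_measurable_simple_function[OF h(1)] by (intro nn_integral_distr assms) simp
    also have "\<dots> \<le> (\<integral>\<^sup>+x. f (g x) \<partial>M)" using h(2) by (intro nn_integral_mono) (auto simp: le_fun_def)
    finally show ?thesis .
  qed
  then show ?thesis unfolding nn_integral_def[of "distr M N g"] by (auto intro!: SUP_least)
qed

lemma ups_cost_split_post:
  assumes "x \<in> dom_c" "y \<in> dom_c" "\<alpha> \<in> {0..1}" "p \<in> dom_c"
  shows "ups_cost c (split_post x y \<alpha>) p \<le> ereal (\<alpha> * cr x + (1 - \<alpha>) * cr y - cr p)"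
proof -
  note xy = assms(1,2)[THEN dom_c_unit]
  have "(\<integral>\<^sup>+q. e2ennreal (c q) \<partial>split_post x y \<alpha>) 
     \<le> (\<integral>\<^sup>+b. e2ennreal (c (if b then x else y)) \<partial>measure_pmf (bernoulli_pmf \<alpha>))"
    unfolding split_post_def by (rule nn_integral_distr_le[OF split_post_measurable[OF xy]])
  also have "\<dots> = ennreal (\<alpha> * cr x + (1 - \<alpha>) * cr y)"
    using assms c_eq[OF assms(1)] c_eq[OF assms(2)] cr_nonneg[OF assms(1)] cr_nonneg[OF assms(2)]
    by (simp add: ennreal_def[symmetric] e2ennreal_ereal mult.commute flip: ennreal_mult' ennreal_plus)
  finally have "enn2ereal (\<integral>\<^sup>+q. e2ennreal (c q) \<partial>split_post x y \<alpha>) \<le> ereal (\<alpha> * cr x + (1 - \<alpha>) * cr y)"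
    unfolding less_eq_ennreal.rep_eq
    by (subst (asm) enn2ereal_ennreal) (use assms cr_nonneg[OF assms(1)] cr_nonneg[OF assms(2)] in auto)
  then show ?thesis unfolding ups_cost_def using c_eq[OF assms(4)] 
    by (cases "enn2ereal (\<integral>\<^sup>+q. e2ennreal (c q) \<partial>split_post x y \<alpha>)") auto
qed

lemma ups_cost_split_post_diag:
  assumes "p \<in> {0..1}"
  shows "ups_cost c (split_post p p 1) p = 0"
proof (cases "c p = \<infinity>")
  case False
  then have p: "p \<in> dom_c" using assms by (simp add: dom_c_def)
  have "ups_cost c (split_post p p 1) p \<le> 0" using ups_cost_split_post[OF p p, of 1 p] p by (simp add: zero_ereal_def)
  moreover have "0 \<le> ups_cost c (split_post p p 1) p"
    by (rule ups_cost_nonneg[OF split_post_plausible]) (use assms in auto)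
  ultimately show ?thesis by (rule antisym)
qed (simp add: ups_cost_def)

section \<open>The Bellman operator\<close>

text \<open>A real-valued form of the payoff from waiting until \<tau> and then running
  \<open>F\<close>. It is meaningful only when the cost is finite, since
  \<open>real_of_ereal\<close> sends infinity to 0.\<close>

definition "bell w p \<tau> F = flow_until p \<tau> + exp (- r * \<tau>) * ((\<integral>q. w q \<partial>F) - real_of_ereal (ups_cost c F (dr p \<tau>)) - \<kappa>)"

abbreviation "brhs \<equiv> bellman_rhs u c \<kappa> r lam0 lam1"

text \<open>Removes extended real arithmetic from all later work with the operator. An experiment of
  infinite cost contributes minus infinity to the supremum and therefore imposes no
  condition.\<close>

lemma brhs_le_iff:
  assumes p: "p \<in> {0..1}"
  shows "brhs w p \<le> ereal z \<longleftrightarrow> 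
    (\<forall>\<tau>\<ge>0. \<forall>F\<in>bayes_plausible (dr p \<tau>). ups_cost c F (dr p \<tau>) \<noteq> \<infinity> \<longrightarrow> bell w p \<tau> F \<le> z)"
proof -
  have *: "ereal U' + ereal e * X \<le> ereal z \<longleftrightarrow> X \<le> ereal ((z - U') / e)" if "e > 0" for X U' e
    using that by (cases X) (auto simp: field_simps)
  have **: "ereal W - X - ereal \<kappa> \<le> ereal ((z - U') / e) \<longleftrightarrow> (X \<noteq> \<infinity> \<longrightarrow> U' + e * (W - real_of_ereal X - \<kappa>) \<le> z)"
    if "e > 0" "0 \<le> X" for X W U' e
    using that by (cases X) (auto simp: field_simps)
  have "brhs w p \<le> ereal z \<longleftrightarrow> (\<forall>\<tau>\<in>{0..}. \<forall>F\<in>bayes_plausible (dr p \<tau>).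
     ereal (\<integral>q. w q \<partial>F) - ups_cost c F (dr p \<tau>) - ereal \<kappa> \<le> ereal ((z - flow_until p \<tau>) / exp (- r * \<tau>)))"
    unfolding bellman_rhs_def SUP_le_iff flow_until_def[symmetric] by (subst *) (auto simp: SUP_le_iff)
  also have "\<dots> \<longleftrightarrow> (\<forall>\<tau>\<in>{0..}. \<forall>F\<in>bayes_plausible (dr p \<tau>). ups_cost c F (dr p \<tau>) \<noteq> \<infinity> \<longrightarrow> bell w p \<tau> F \<le> z)"
    unfolding bell_def
    by (intro ball_cong refl **) (auto intro!: ups_cost_nonneg drift_in[OF p])
  finally show ?thesis by auto
qed

section \<open>The operator restricted to binary experiments\<close>

definition "binary_payoffs w p = {flow_until p \<tau> + exp (- r * \<tau>) * (\<eta> - \<kappa>) | \<tau> \<eta>. 0 \<le> \<tau> \<and> \<eta> \<in> binary_values w (dr p \<tau>)}"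
definition "binary_bellman w p = Sup (binary_payoffs w p)"

lemma flow_until_le:
  obtains L where "\<And>p \<tau>. p \<in> {0..1} \<Longrightarrow> 0 \<le> \<tau> \<Longrightarrow> \<bar>flow_until p \<tau>\<bar> \<le> L"
proof -
  obtain K where K: "K > 0" "\<And>q. q \<in> {0..1} \<Longrightarrow> \<bar>vl q\<bar> \<le> K" using vl_bound by auto
  have "\<bar>flow_until p \<tau>\<bar> \<le> K + K" if *: "p \<in> {0..1}" "0 \<le> \<tau>" for p \<tau>
  proof -
    have "\<bar>exp (- r * \<tau>) * vl (dr p \<tau>)\<bar> \<le> 1 * K"
      unfolding abs_mult using K(2)[OF drift_in[OF *]] r * by (intro mult_mono) auto
    then show ?thesis unfolding flow_until_eq[OF *] using K(2)[OF *(1)] abs_triangle_ineq4[of "vl p" "exp (- r * \<tau>) * vl (dr p \<tau>)"] by linarith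
  qed
  then show thesis by (rule that)
qed

lemma binary_payoffs_bdd:
  assumes w: "\<And>q. q \<in> {0..1} \<Longrightarrow> w q \<le> K" and p: "p \<in> {0..1}"
  shows "bdd_above (binary_payoffs w p)"
proof -
  obtain L where L: "\<And>p \<tau>. p \<in> {0..1} \<Longrightarrow> 0 \<le> \<tau> \<Longrightarrow> \<bar>flow_until p \<tau>\<bar> \<le> L" using flow_until_le by auto
  show ?thesis
  proof (rule bdd_aboveI[where M="L + \<bar>K\<bar>"])
    fix z assume "z \<in> binary_payoffs w p"
    then obtain \<tau> \<eta> where z: "z = flow_until p \<tau> + exp (- r * \<tau>) * (\<eta> - \<kappa>)" "0 \<le> \<tau>" "\<eta> \<in> binary_values w (dr p \<tau>)"
      unfolding binary_payoffs_def by auto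
    have "\<eta> - \<kappa> \<le> \<bar>K\<bar>" using binary_values_le[OF w drift_in[OF p z(2)] z(3)] kappa by auto
    then have "exp (- r * \<tau>) * (\<eta> - \<kappa>) \<le> exp (- r * \<tau>) * \<bar>K\<bar>" by (rule mult_left_mono) simp
    also have "\<dots> \<le> 1 * \<bar>K\<bar>" using r z(2) by (intro mult_right_mono) auto
    finally show "z \<le> L + \<bar>K\<bar>" using L[OF p z(2)] z(1) by auto
  qed
qed

lemma binary_payoffs_mem: "0 \<le> \<tau> \<Longrightarrow> \<eta> \<in> binary_values w (dr p \<tau>) \<Longrightarrow> flow_until p \<tau> + exp (- r * \<tau>) * (\<eta> - \<kappa>) \<in> binary_payoffs w p"
  unfolding binary_payoffs_def by blast

lemma binary_payoffs_nonempty: "binary_payoffs w p \<noteq> {}"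
  using binary_payoffs_mem[of 0 "w p" w p] by (auto simp: binary_values_def)

lemma binary_bellman_upper:
  assumes "\<forall>q\<in>{0..1}. w q \<le> K" "p \<in> {0..1}" "0 \<le> \<tau>" "\<eta> \<in> binary_values w (dr p \<tau>)"
  shows "flow_until p \<tau> + exp (- r * \<tau>) * (\<eta> - \<kappa>) \<le> binary_bellman w p"
  unfolding binary_bellman_def by (rule cSup_upper[OF binary_payoffs_mem binary_payoffs_bdd]) (use assms in auto)

lemma binary_bellman_le_iff:
  assumes "\<forall>q\<in>{0..1}. w q \<le> K" "p \<in> {0..1}"
  shows "binary_bellman w p \<le> z \<longleftrightarrow> (\<forall>\<tau>\<ge>0. \<forall>\<eta>\<in>binary_values w (dr p \<tau>). flow_until p \<tau> + exp (- r * \<tau>) * (\<eta> - \<kappa>) \<le> z)"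
  unfolding binary_bellman_def by (subst cSup_le_iff[OF binary_payoffs_nonempty binary_payoffs_bdd]) (use assms in \<open>auto simp: binary_payoffs_def\<close>)

text \<open>The two sides have the same real upper bounds \<open>z\<close>. In one direction every
  experiment is beaten by the supremum of the binary values; in the other every binary value is
  attained by some \<open>split_post\<close>.\<close>

lemma brhs_eq_binary_bellman:
  assumes w: "w \<in> borel_measurable PostM" "\<forall>q\<in>{0..1}. \<bar>w q\<bar> \<le> K" and p: "p \<in> {0..1}"
  shows "brhs w p = ereal (binary_bellman w p)"
proof -
  have w': "\<forall>q\<in>{0..1}. w q \<le> K" using w(2) abs_le_D1 by blast
  have iff: "brhs w p \<le> ereal z \<longleftrightarrow> binary_bellman w p \<le> z" for z
  proof
    assume z: "binary_bellman w p \<le> z"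
    show "brhs w p \<le> ereal z" unfolding brhs_le_iff[OF p]
    proof (intro allI impI ballI)
      fix \<tau> F assume t: "0 \<le> \<tau>" and F: "F \<in> bayes_plausible (dr p \<tau>)" "ups_cost c F (dr p \<tau>) \<noteq> \<infinity>"
      have "(\<integral>q. w q \<partial>F) - real_of_ereal (ups_cost c F (dr p \<tau>)) \<le> Sup (binary_values w (dr p \<tau>))"
        by (rule experiment_le_binary[OF F(1) drift_in[OF p t] w(1) _ F(2), where K=K]) (use w(2) in auto)
      moreover have "Sup (binary_values w (dr p \<tau>)) \<le> (z - flow_until p \<tau>) / exp (- r * \<tau>) + \<kappa>"
      proof (rule cSup_least[OF binary_values_nonempty])
        fix \<eta> assume "\<eta> \<in> binary_values w (dr p \<tau>)"
        from binary_bellman_upper[of w K, OF w' p t this] z show "\<eta> \<le> (z - flow_until p \<tau>) / exp (- r * \<tau>) + \<kappa>"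
          by (simp add: field_simps)
      qed
      ultimately have "(\<integral>q. w q \<partial>F) - real_of_ereal (ups_cost c F (dr p \<tau>)) - \<kappa> \<le> (z - flow_until p \<tau>) / exp (- r * \<tau>)"
        by simp
      then show "bell w p \<tau> F \<le> z" unfolding bell_def by (simp add: pos_le_divide_eq mult.commute)
    qed
  next
    assume "brhs w p \<le> ereal z"
    note z = this[unfolded brhs_le_iff[OF p], rule_format]
    show "binary_bellman w p \<le> z"
    proof (rule binary_bellman_le_iff[of w K, OF w' p, THEN iffD2], intro allI impI ballI)
      fix \<tau> \<eta> assume t: "0 \<le> \<tau>" and "\<eta> \<in> binary_values w (dr p \<tau>)"
      note q = drift_in[OF p t]
      \<comment> \<open>An experiment whose net value is at least \<eta> certifies the bound for
        \<eta>; it remains to exhibit one for each kind of binary value.\<close>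
      have *: "flow_until p \<tau> + exp (- r * \<tau>) * (\<eta> - \<kappa>) \<le> z" if F: "F \<in> bayes_plausible (dr p \<tau>)" 
        and le: "ups_cost c F (dr p \<tau>) \<le> ereal ((\<integral>q. w q \<partial>F) - \<eta>)" for F
      proof -
        have "0 \<le> ups_cost c F (dr p \<tau>)" by (rule ups_cost_nonneg[OF F q])
        with le have "\<eta> - \<kappa> \<le> (\<integral>q. w q \<partial>F) - real_of_ereal (ups_cost c F (dr p \<tau>)) - \<kappa>"
            "ups_cost c F (dr p \<tau>) \<noteq> \<infinity>"
          by (cases "ups_cost c F (dr p \<tau>)"; auto)+
        moreover from this(1) have "exp (- r * \<tau>) * (\<eta> - \<kappa>) \<le> exp (- r * \<tau>) * ((\<integral>q. w q \<partial>F) - real_of_ereal (ups_cost c F (dr p \<tau>)) - \<kappa>)"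
          by (rule mult_left_mono) simp
        ultimately show ?thesis using z[OF t F] unfolding bell_def by linarith
      qed
      from \<open>\<eta> \<in> binary_values w (dr p \<tau>)\<close> show "flow_until p \<tau> + exp (- r * \<tau>) * (\<eta> - \<kappa>) \<le> z"
      proof (cases rule: binary_values_cases)
        case 1
        show ?thesis
        proof (rule *)
          show "split_post (dr p \<tau>) (dr p \<tau>) 1 \<in> bayes_plausible (dr p \<tau>)"
            using q by (intro split_post_plausible) auto
          show "ups_cost c (split_post (dr p \<tau>) (dr p \<tau>) 1) (dr p \<tau>) \<le> ereal ((\<integral>q. w q \<partial>split_post (dr p \<tau>) (dr p \<tau>) 1) - \<eta>)"
            using ups_cost_split_post_diag[OF q] integral_split_post[OF q q _ w(1), of 1] 1 by (simp add: zero_ereal_def)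
        qed
      next
        case (2 x y \<alpha>)
        note xy = 2(1,2)[THEN dom_c_unit]
        show ?thesis
        proof (rule *)
          show "split_post x y \<alpha> \<in> bayes_plausible (dr p \<tau>)"
            using 2 by (intro split_post_plausible xy) auto
          have "\<alpha> * cr x + (1 - \<alpha>) * cr y - cr (dr p \<tau>) = (\<integral>q. w q \<partial>split_post x y \<alpha>) - \<eta>"
            unfolding 2(10) using 2(6,7) by (subst integral_split_post[OF xy _ w(1)]) (auto simp: algebra_simps)
          moreover have "dr p \<tau> \<in> dom_c" using cr_convex(2)[OF 2(1-4)] .
          ultimately show "ups_cost c (split_post x y \<alpha>) (dr p \<tau>) \<le> ereal ((\<integral>q. w q \<partial>split_post x y \<alpha>) - \<eta>)"
            using ups_cost_split_post[OF 2(1,2), of \<alpha> "dr p \<tau>"] 2(6,7) by auto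
        qed
      qed
    qed
  qed
  show ?thesis
  proof (rule antisym)
    show "brhs w p \<le> ereal (binary_bellman w p)" unfolding iff ..
    show "ereal (binary_bellman w p) \<le> brhs w p" by (rule ereal_le_real) (simp add: iff)
  qed
qed

lemma Sup_binary_values_le_iff:
  assumes "\<forall>q\<in>{0..1}. w q \<le> K" "p \<in> {0..1}"
  shows "Sup (binary_values w p) \<le> z \<longleftrightarrow> (\<forall>\<eta>\<in>binary_values w p. \<eta> \<le> z)"
proof (rule cSup_le_iff[OF binary_values_nonempty])
  show "bdd_above (binary_values w p)" by (rule binary_values_bdd[where K=K]) (use assms in auto)
qed

text \<open>Takes the supremum over splittings first, for each \<tau> separately. The strict
  inequality turns the supremum over \<tau> into a union of superlevel sets.\<close>

lemma less_binary_bellman_iff: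
  assumes w: "\<forall>q\<in>{0..1}. w q \<le> K" and p: "p \<in> {0..1}"
  shows "z < binary_bellman w p \<longleftrightarrow> (\<exists>\<tau>\<ge>0. z < flow_until p \<tau> + exp (- r * \<tau>) * (Sup (binary_values w (dr p \<tau>)) - \<kappa>))"
proof -
  have "binary_bellman w p \<le> z \<longleftrightarrow> (\<forall>\<tau>\<ge>0. flow_until p \<tau> + exp (- r * \<tau>) * (Sup (binary_values w (dr p \<tau>)) - \<kappa>) \<le> z)"
  proof -
    have le: "flow_until p \<tau> + exp (- r * \<tau>) * (x - \<kappa>) \<le> z \<longleftrightarrow> x \<le> (z - flow_until p \<tau>) / exp (- r * \<tau>) + \<kappa>" for x \<tau>
      by (simp add: field_simps)
    show ?thesis unfolding binary_bellman_le_iff[OF w p] le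
      by (intro all_cong imp_cong refl) (auto simp: Sup_binary_values_le_iff[OF w drift_in[OF p]] simp del: atLeastAtMost_iff)
  qed
  then show ?thesis by (meson not_le)
qed

text \<open>For fixed \<tau> the payoff is continuous in the belief on the open interval, which the
  drift maps into itself. A strict superlevel set is therefore a union of open sets, where the union
  over uncountably many \<tau> does no harm, plus at most the two endpoints.\<close>

lemma binary_bellman_measurable:
  assumes w: "\<forall>q\<in>{0..1}. w q \<le> K"
  shows "binary_bellman w \<in> borel_measurable PostM"
  unfolding borel_measurable_iff_greater
proof
  fix z
  let ?g = "\<lambda>\<tau> p. flow_until p \<tau> + exp (- r * \<tau>) * (Sup (binary_values w (dr p \<tau>)) - \<kappa>)"
  have "continuous_on {0<..<1} (?g \<tau>)" if t: "0 \<le> \<tau>" for \<tau>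
  proof -
    have sub: "(\<lambda>p. dr p \<tau>) ` {0<..<1} \<subseteq> {0<..<1}" using drift_interior[OF _ t] by force
    have c1: "continuous_on {0<..<1} (\<lambda>p. dr p \<tau>)"
      using continuous_drift continuous_on_subset by blast
    have c2: "continuous_on {0<..<1} vl" using vl_continuous by (rule continuous_on_subset) auto
    have cS: "continuous_on {0<..<1} (\<lambda>p. Sup (binary_values w p))" 
      by (rule Sup_binary_values_continuous[where K=K]) (use w in auto)
    have "continuous_on {0<..<1} (\<lambda>p. vl p - exp (- r * \<tau>) * vl (dr p \<tau>) + exp (- r * \<tau>) * (Sup (binary_values w (dr p \<tau>)) - \<kappa>))"
      by (intro continuous_intros c2 continuous_on_compose2[OF c2 c1 sub] continuous_on_compose2[OF cS c1 sub])
    then show ?thesis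
      by (rule continuous_on_eq) (use flow_until_eq[OF _ t] in auto)
  qed
  then have op: "open (?g \<tau> -` {z<..} \<inter> {0<..<1})" if "0 \<le> \<tau>" for \<tau>
    using that continuous_on_open_vimage[of "{0<..<1}" "?g \<tau>"] by auto
  let ?V = "\<Union>\<tau>\<in>{0..}. (?g \<tau> -` {z<..} \<inter> {0<..<1})"
  have "{p \<in> {0..1}. z < binary_bellman w p} = ?V \<union> ({0, 1} \<inter> {p. z < binary_bellman w p})"
  proof (intro set_eqI iffI)
    fix p assume "p \<in> {p \<in> {0..1}. z < binary_bellman w p}"
    then have p: "p \<in> {0..1}" "z < binary_bellman w p" by auto
    then consider "p = 0" | "p = 1" | "p \<in> {0<..<1}" by fastforce
    then show "p \<in> ?V \<union> ({0, 1} \<inter> {p. z < binary_bellman w p})"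
      by cases (use p less_binary_bellman_iff[OF w p(1)] in auto)
  next
    fix p assume *: "p \<in> ?V \<union> ({0, 1} \<inter> {p. z < binary_bellman w p})"
    then have p: "p \<in> {0..1}" by auto
    then show "p \<in> {p \<in> {0..1}. z < binary_bellman w p}"
      using * less_binary_bellman_iff[OF w p] by auto
  qed
  moreover have "?V \<in> sets borel" using op by (intro borel_open open_UN) auto
  moreover have "finite ({0, 1} \<inter> {p. z < binary_bellman w p})" by simp
  then have "({0, 1} \<inter> {p. z < binary_bellman w p}) \<in> sets borel" by (intro borel_closed finite_imp_closed)
  ultimately have "{p \<in> {0..1}. z < binary_bellman w p} \<in> sets borel" by auto
  then show "{p \<in> space PostM. z < binary_bellman w p} \<in> sets PostM"
    unfolding space_PostM unfolding PostM_def by (subst sets_restrict_space_iff) auto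
qed

lemma binary_bellman_mono:
  assumes w: "\<forall>q\<in>{0..1}. w q \<le> z q" and z: "\<forall>q\<in>{0..1}. z q \<le> K" and p: "p \<in> {0..1}"
  shows "binary_bellman w p \<le> binary_bellman z p"
proof -
  have wK: "\<forall>q\<in>{0..1}. w q \<le> K" using w z by force
  show ?thesis
    unfolding binary_bellman_le_iff[OF wK p]
  proof (intro allI impI ballI)
    fix \<tau> \<eta> assume t: "0 \<le> \<tau>" and eta: "\<eta> \<in> binary_values w (dr p \<tau>)"
    have "\<exists>\<eta>'\<in>binary_values z (dr p \<tau>). \<eta> \<le> \<eta>'"
      using eta
    proof (cases rule: binary_values_cases)
      case 1
      then show ?thesis using w drift_in[OF p t] by (auto simp: binary_values_def)
    next
      case (2 x y \<alpha>)
      have "\<eta> \<le> \<alpha> * (z x - cr x) + (1 - \<alpha>) * (z y - cr y) + cr (dr p \<tau>)"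
        unfolding 2(10) using 2(6,7) w 2(1,2)[THEN dom_c_unit] by (intro add_mono mult_left_mono) auto
      then show ?thesis using binary_values_mem[OF 2(1-5)] by blast
    qed
    then obtain \<eta>' where \<eta>': "\<eta>' \<in> binary_values z (dr p \<tau>)" "\<eta> \<le> \<eta>'" by blast
    have "flow_until p \<tau> + exp (- r * \<tau>) * (\<eta> - \<kappa>) \<le> flow_until p \<tau> + exp (- r * \<tau>) * (\<eta>' - \<kappa>)"
      using \<eta>'(2) by (intro add_left_mono mult_left_mono) auto
    also have "\<dots> \<le> binary_bellman z p" by (rule binary_bellman_upper[OF z p t \<eta>'(1)])
    finally show "flow_until p \<tau> + exp (- r * \<tau>) * (\<eta> - \<kappa>) \<le> binary_bellman z p" .
  qed
qed

section \<open>Supersolutions, the least fixed point and comparison\<close>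

lemma exp_decay: "((\<lambda>t. exp (- r * t)) \<longlongrightarrow> 0) at_top"
proof -
  have "filterlim (\<lambda>t. r * t) at_top at_top"
    using r by (intro filterlim_tendsto_pos_mult_at_top[OF tendsto_const]) (auto simp: filterlim_ident)
  then have "filterlim (\<lambda>t. - r * t) at_bot at_top"
    by (simp add: filterlim_uminus_at_bot)
  then show ?thesis by (rule filterlim_compose[OF exp_at_bot])
qed

text \<open>Waiting until \<tau> and then running the uninformative experiment loses at most a
  discounted constant compared with never acquiring; let \<tau> tend to infinity.\<close>

lemma vl_le_binary_bellman:
  assumes w: "\<forall>q\<in>{0..1}. \<bar>w q\<bar> \<le> K" and p: "p \<in> {0..1}"
  shows "vl p \<le> binary_bellman w p"
proof -
  obtain L where L: "L > 0" "\<And>q. q \<in> {0..1} \<Longrightarrow> \<bar>vl q\<bar> \<le> L" using vl_bound by auto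
  have wK: "\<forall>q\<in>{0..1}. w q \<le> K" using w by (auto simp: abs_le_iff)
  have "vl p - exp (- r * \<tau>) * (L + K + \<kappa>) \<le> binary_bellman w p" if t: "0 \<le> \<tau>" for \<tau>
  proof -
    note q = drift_in[OF p t]
    have "vl (dr p \<tau>) \<le> L" "- K \<le> w (dr p \<tau>)" 
      using L(2)[OF q] w[rule_format, OF q] by auto
    then have "exp (- r * \<tau>) * (vl (dr p \<tau>) - w (dr p \<tau>) + \<kappa>) \<le> exp (- r * \<tau>) * (L + K + \<kappa>)"
      by (intro mult_left_mono) auto
    moreover have "flow_until p \<tau> + exp (- r * \<tau>) * (w (dr p \<tau>) - \<kappa>) \<le> binary_bellman w p"
      by (rule binary_bellman_upper[OF wK p t]) (simp add: binary_values_def)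
    ultimately show ?thesis unfolding flow_until_eq[OF p t] by (simp add: algebra_simps)
  qed
  then have "\<forall>\<^sub>F \<tau> in at_top. vl p - exp (- r * \<tau>) * (L + K + \<kappa>) \<le> binary_bellman w p"
    by (rule eventually_mono[OF eventually_ge_at_top[of 0]])
  moreover have "((\<lambda>\<tau>. vl p - exp (- r * \<tau>) * (L + K + \<kappa>)) \<longlongrightarrow> vl p - 0 * (L + K + \<kappa>)) at_top"
    by (intro tendsto_intros exp_decay)
  ultimately have "vl p - 0 * (L + K + \<kappa>) \<le> binary_bellman w p"
    by (intro tendsto_upperbound) auto
  then show ?thesis by simp
qed

text \<open>No measurability is demanded, so that \<open>v_fin\<close> can be shown to be a
  member.\<close>

definition "super_sols = {z. \<forall>p\<in>{0..1}. vl p \<le> z p \<and> z p \<le> vh p \<and> binary_bellman z p \<le> z p}"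

lemma vh_bound: obtains K where "K > 0" "\<forall>q\<in>{0..1}. \<bar>vh q\<bar> \<le> K"
proof -
  obtain A B where AB: "\<And>p. vh p = A + B * p" using vh_affine by metis
  have "\<bar>vh q\<bar> \<le> \<bar>A\<bar> + \<bar>B\<bar>" if "q \<in> {0..1}" for q
    unfolding AB using abs_triangle_ineq[of A "B * q"] mult_left_le[of "\<bar>q\<bar>" "\<bar>B\<bar>"] that by (auto simp: abs_mult)
  then show thesis by (intro that[of "\<bar>A\<bar> + \<bar>B\<bar> + 1"]) force+
qed

lemma between_bound: obtains K where "K > 0" "\<And>w. \<forall>p\<in>{0..1}. vl p \<le> w p \<and> w p \<le> vh p \<Longrightarrow> \<forall>q\<in>{0..1}. \<bar>w q\<bar> \<le> K"
proof -
  obtain K where K: "K > 0" "\<And>q. q \<in> {0..1} \<Longrightarrow> \<bar>vl q\<bar> \<le> K" using vl_bound by auto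
  obtain L where L: "L > 0" "\<forall>q\<in>{0..1}. \<bar>vh q\<bar> \<le> L" using vh_bound by auto
  show thesis
  proof (rule that[of "K + L"])
    fix w assume w: "\<forall>p\<in>{0..1}. vl p \<le> w p \<and> w p \<le> vh p"
    show "\<forall>q\<in>{0..1}. \<bar>w q\<bar> \<le> K + L"
    proof
      fix q :: real assume q: "q \<in> {0..1}"
      show "\<bar>w q\<bar> \<le> K + L" using K(1) L(1) K(2)[OF q] L(2)[rule_format, OF q] w[rule_format, OF q] by auto
    qed
  qed (use K L in auto)
qed

text \<open>The Knaster-Tarski argument for the pointwise infimum: monotonicity makes the infimum a
  supersolution and its image another one, so the infimum also lies below its image. The bound
  \<open>vl\<close> keeps the real infimum well-defined, and \<open>vl_le_binary_bellman\<close>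
  keeps the image above \<open>vl\<close>. The given \<open>z0\<close> only makes the set
  nonempty.\<close>

lemma least_super_sol:
  assumes "z0 \<in> super_sols"
  obtains w where "w \<in> super_sols" "\<forall>p\<in>{0..1}. binary_bellman w p = w p" "\<And>z p. z \<in> super_sols \<Longrightarrow> p \<in> {0..1} \<Longrightarrow> w p \<le> z p"
proof -
  obtain K where K: "\<And>w. \<forall>p\<in>{0..1}. vl p \<le> w p \<and> w p \<le> vh p \<Longrightarrow> \<forall>q\<in>{0..1}. \<bar>w q\<bar> \<le> K" using between_bound by metis
  then have K': "\<And>w. \<forall>p\<in>{0..1}. vl p \<le> w p \<and> w p \<le> vh p \<Longrightarrow> \<forall>q\<in>{0..1}. w q \<le> K"
    by (meson abs_le_D1)
  define w where "w p = (INF z\<in>super_sols. z p)" for p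
  have bdd: "bdd_below ((\<lambda>z. z p) ` super_sols)" if "p \<in> {0..1}" for p
    using that by (intro bdd_belowI[where m="vl p"]) (auto simp: super_sols_def)
  have le: "w p \<le> z p" if "z \<in> super_sols" "p \<in> {0..1}" for z p
    unfolding w_def by (rule cINF_lower[OF bdd]) (use that in auto)
  have btw: "\<forall>p\<in>{0..1}. vl p \<le> w p \<and> w p \<le> vh p"
  proof
    fix p :: real assume p: "p \<in> {0..1}"
    have "w p \<le> vh p" using le[OF assms p] assms p by (force simp: super_sols_def)
    moreover have "vl p \<le> w p" unfolding w_def
      by (rule cINF_greatest) (use assms p in \<open>auto simp: super_sols_def\<close>)
    ultimately show "vl p \<le> w p \<and> w p \<le> vh p" by simp
  qed
  have Bw: "binary_bellman w p \<le> w p" if p: "p \<in> {0..1}" for p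
    unfolding w_def
  proof (rule cINF_greatest)
    fix z assume z: "z \<in> super_sols"
    have "binary_bellman w p \<le> binary_bellman z p" by (rule binary_bellman_mono[where K=K]) (use le z p K' in \<open>auto simp: super_sols_def\<close>)
    also have "\<dots> \<le> z p" using z p by (auto simp: super_sols_def)
    finally show "binary_bellman (\<lambda>p. INF z\<in>super_sols. z p) p \<le> z p" unfolding w_def .
  qed (use assms in auto)
  have "binary_bellman w \<in> super_sols"
    unfolding super_sols_def
  proof (intro CollectI ballI conjI)
    fix p :: real assume p: "p \<in> {0..1}"
    show "vl p \<le> binary_bellman w p" by (rule vl_le_binary_bellman[OF K[OF btw] p])
    show "binary_bellman w p \<le> vh p" using Bw[OF p] btw p by force
    show "binary_bellman (binary_bellman w) p \<le> binary_bellman w p" by (rule binary_bellman_mono[OF _ K'[OF btw] p]) (use Bw in auto)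
  qed
  then have eq: "\<forall>p\<in>{0..1}. binary_bellman w p = w p" using le Bw by (meson antisym)
  show thesis
  proof (rule that[of w])
    show "w \<in> super_sols" using btw Bw unfolding super_sols_def by blast
    show "\<forall>p\<in>{0..1}. binary_bellman w p = w p" by (rule eq)
    show "w p \<le> z p" if "z \<in> super_sols" "p \<in> {0..1}" for z p using le that .
  qed
qed

text \<open>Needed for two values of \<open>k\<close>. With \<open>k = 0\<close> it shows that
  \<open>vh\<close> is a supersolution. With \<open>k = \<kappa>\<close> the discounted term
  cancels, which leaves \<open>vh + \<kappa>\<close> a slack of exactly \<kappa>, uniformly in
  \<tau> although the discount factor can be arbitrarily small.\<close>

lemma bell_vh:
  assumes p: "p \<in> {0..1}" and t: "0 \<le> \<tau>" and F: "F \<in> bayes_plausible (dr p \<tau>)"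
  shows "bell (\<lambda>q. vh q + k) p \<tau> F \<le> vh p + exp (- r * \<tau>) * (k - \<kappa>)"
proof -
  obtain A B where AB: "\<And>p. vh p = A + B * p" using vh_affine by metis
  have "(\<integral>q. vh q + k \<partial>F) = vh (dr p \<tau>) + k"
    using bayes_plausible_affine(1)[OF F, of "A + k" B] unfolding AB by (simp add: algebra_simps)
  moreover have "0 \<le> real_of_ereal (ups_cost c F (dr p \<tau>))"
    using ups_cost_nonneg[OF F drift_in[OF p t]] by (rule real_of_ereal_pos)
  ultimately have "bell (\<lambda>q. vh q + k) p \<tau> F \<le> flow_until p \<tau> + exp (- r * \<tau>) * (vh (dr p \<tau>) + k - \<kappa>)"
    unfolding bell_def by (intro add_left_mono mult_left_mono) auto
  also have "\<dots> \<le> vh p + exp (- r * \<tau>) * (k - \<kappa>)"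
    using vh_split[OF p t] by (simp add: algebra_simps)
  finally show ?thesis .
qed

lemma vh_measurable: "vh \<in> borel_measurable PostM"
proof -
  obtain A B where AB: "\<And>p. vh p = A + B * p" using vh_affine by metis
  show ?thesis unfolding AB by measurable
qed

text \<open>The operator is convex and \<open>vh + \<kappa>\<close> is a strict supersolution, with slack \<open>\<kappa>\<close>. Hence a bound
  \<open>w1 \<le> (1 - \<mu>) w2 + \<mu> (vh + \<kappa>)\<close> improves by a fixed factor in \<open>\<mu>\<close> when the operator is applied.\<close>
lemma comparison:
  assumes w1: "w1 \<in> borel_measurable PostM" "\<forall>q\<in>{0..1}. \<bar>w1 q\<bar> \<le> K" "\<forall>q\<in>{0..1}. w1 q \<le> vh q"
    and w2: "w2 \<in> borel_measurable PostM" "\<forall>q\<in>{0..1}. \<bar>w2 q\<bar> \<le> K"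
    and b1: "\<forall>q\<in>{0..1}. ereal (w1 q) \<le> brhs w1 q" and b2: "\<forall>q\<in>{0..1}. brhs w2 q \<le> ereal (w2 q)"
    and p: "p \<in> {0..1}"
  shows "w1 p \<le> w2 p"
proof -
  define z where "z q = vh q + \<kappa>" for q
  obtain L where L: "L > 0" "\<forall>q\<in>{0..1}. \<bar>vh q\<bar> \<le> L" using vh_bound by auto
  \<comment> \<open>A bound for \<open>z - w2\<close> that exceeds \<kappa>, so that the factor
    \<theta> below lies in \<open>{0..<1}\<close>.\<close>
  define M where "M = L + \<kappa> + \<bar>K\<bar>"
  have M: "\<kappa> < M" "M > 0" "\<And>q. q \<in> {0..1} \<Longrightarrow> z q - w2 q \<le> M"
    using L kappa w2(2) unfolding M_def z_def by (force simp: abs_le_iff)+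
  \<comment> \<open>As \<open>z - w2 \<le> M\<close>, the slack \<kappa> is at least the fraction
    \<open>\<kappa> / M\<close> of \<open>z - w2\<close>; hence
    \<open>z - \<kappa> \<le> \<theta> * z + (1 - \<theta>) * w2\<close>, and one application of the
    operator replaces \<mu> by \<open>\<theta> * \<mu>\<close>.\<close>
  define \<theta> where "\<theta> = 1 - \<kappa> / M"
  have \<theta>: "0 \<le> \<theta>" "\<theta> < 1" unfolding \<theta>_def using M kappa by auto
  have step: "w1 q \<le> (1 - \<mu>) * w2 q + \<mu> * (z q - \<kappa>)"
    if \<mu>: "0 \<le> \<mu>" "\<mu> \<le> 1" and ih: "\<forall>q\<in>{0..1}. w1 q \<le> (1 - \<mu>) * w2 q + \<mu> * z q" and q: "q \<in> {0..1}" for \<mu> q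
  proof -
    have "brhs w1 q \<le> ereal ((1 - \<mu>) * w2 q + \<mu> * (z q - \<kappa>))"
      unfolding brhs_le_iff[OF q]
    proof (intro allI impI ballI)
      fix \<tau> F assume t: "0 \<le> \<tau>" and F: "F \<in> bayes_plausible (dr q \<tau>)" "ups_cost c F (dr q \<tau>) \<noteq> \<infinity>"
      have i: "integrable F w1" "integrable F w2" "integrable F z"
        by (rule bayes_plausible_integrable[OF F(1), where K=K]; use w1 w2 in simp)+
           (rule bayes_plausible_integrable[OF F(1), where K="L + \<kappa>"]; use L kappa vh_measurable in \<open>force simp: z_def[abs_def] abs_le_iff\<close>)
      have "(\<integral>x. w1 x \<partial>F) \<le> (\<integral>x. (1 - \<mu>) * w2 x + \<mu> * z x \<partial>F)"
        by (rule integral_mono) (use i ih bayes_plausibleD(3)[OF F(1)] in auto)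
      also have "\<dots> = (1 - \<mu>) * (\<integral>x. w2 x \<partial>F) + \<mu> * (\<integral>x. z x \<partial>F)" using i by simp
      finally have le: "(\<integral>x. w1 x \<partial>F) \<le> \<dots>" .
      define C where "C = real_of_ereal (ups_cost c F (dr q \<tau>)) + \<kappa>"
      have "bell w1 q \<tau> F \<le> flow_until q \<tau> + exp (- r * \<tau>) * ((1 - \<mu>) * (\<integral>x. w2 x \<partial>F) + \<mu> * (\<integral>x. z x \<partial>F) - C)"
        unfolding bell_def C_def using le by (intro add_left_mono mult_left_mono) auto
      \<comment> \<open>For fixed \<tau> and \<open>F\<close> the payoff is affine in the
        continuation function: flow and cost are split with the weights \<open>1 - \<mu>\<close> and
        \<mu>.\<close>
      also have "\<dots> = (1 - \<mu>) * bell w2 q \<tau> F + \<mu> * bell z q \<tau> F"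
        unfolding bell_def C_def by (simp add: algebra_simps)
      also have "\<dots> \<le> (1 - \<mu>) * w2 q + \<mu> * (z q - \<kappa>)"
      proof (intro add_mono mult_left_mono)
        show "bell w2 q \<tau> F \<le> w2 q"
          using b2[rule_format, OF q] F t unfolding brhs_le_iff[OF q] by auto
        show "bell z q \<tau> F \<le> z q - \<kappa>"
          using bell_vh[OF q t F(1), of \<kappa>] unfolding z_def[abs_def] by simp
      qed (use \<mu> in auto)
      finally show "bell w1 q \<tau> F \<le> (1 - \<mu>) * w2 q + \<mu> * (z q - \<kappa>)" .
    qed
    with b1 q have "ereal (w1 q) \<le> ereal ((1 - \<mu>) * w2 q + \<mu> * (z q - \<kappa>))" using order_trans by blast
    then show ?thesis by simp
  qed
  have bound: "\<forall>q\<in>{0..1}. w1 q \<le> (1 - \<theta> ^ n) * w2 q + \<theta> ^ n * z q" for n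
  proof (induction n)
    case 0
    then show ?case using w1(3) kappa by (force simp: z_def)
  next
    case (Suc n)
    show ?case
    proof
      fix q :: real assume q: "q \<in> {0..1}"
      have \<mu>: "0 \<le> \<theta> ^ n" "\<theta> ^ n \<le> 1" using \<theta> by (auto simp: power_le_one)
      have "\<kappa> / M * (z q - w2 q) \<le> \<kappa> / M * M"
        using M(3)[OF q] kappa M by (intro mult_left_mono) auto
      then have "0 \<le> \<theta> ^ n * (\<kappa> - \<kappa> / M * (z q - w2 q))" using \<mu> M by simp
      moreover have "(1 - \<theta> ^ Suc n) * w2 q + \<theta> ^ Suc n * z q = (1 - \<theta> ^ n) * w2 q + \<theta> ^ n * (z q - \<kappa>) + \<theta> ^ n * (\<kappa> - \<kappa> / M * (z q - w2 q))"
        unfolding power_Suc \<theta>_def[symmetric] by (simp add: \<theta>_def algebra_simps)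
      ultimately show "w1 q \<le> (1 - \<theta> ^ Suc n) * w2 q + \<theta> ^ Suc n * z q"
        using step[OF \<mu> Suc q] by linarith
    qed
  qed
  have "(\<lambda>n. (1 - \<theta> ^ n) * w2 p + \<theta> ^ n * z p) \<longlonglongrightarrow> (1 - 0) * w2 p + 0 * z p"
    using \<theta> by (intro tendsto_intros LIMSEQ_power_zero) auto
  then show ?thesis
    using bound p by (intro LIMSEQ_le_const[of _ "w2 p"]) auto
qed

section \<open>Flow payoffs along outcome paths\<close>

text \<open>The almost sure path conditions of \<open>policy\<close> as a predicate on single
  outcomes, so that all statements about paths are deterministic.\<close>

definition "good \<omega> \<longleftrightarrow> 0 \<le> T 0 \<omega> \<and> (\<forall>i. T i \<omega> < T (Suc i) \<omega>) \<and>
   filterlim (\<lambda>i. T i \<omega>) at_top sequentially \<and> (\<forall>i. Q i \<omega> \<in> {0..1})"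

text \<open>Forgets the first acquisition and resets the clock. With \<open>s = T 0 \<omega>\<close>
  the result is an outcome of the problem started at the first posterior; \<open>cons\<close> undoes
  this.\<close>

definition shift :: "real \<Rightarrow> outcome \<Rightarrow> outcome" where
  "shift s \<omega> = (\<lambda>j. (T (Suc j) \<omega> - s, Q (Suc j) \<omega>))"

definition cons :: "real \<Rightarrow> real \<Rightarrow> outcome \<Rightarrow> outcome" where
  "cons \<tau> q \<omega> = (\<lambda>i. case i of 0 \<Rightarrow> (\<tau>, q) | Suc j \<Rightarrow> (\<tau> + T j \<omega>, Q j \<omega>))"

lemma T_shift [simp]: "T j (shift s \<omega>) = T (Suc j) \<omega> - s" and Q_shift [simp]: "Q j (shift s \<omega>) = Q (Suc j) \<omega>"
  by (simp_all add: shift_def T_def Q_def)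

lemma T_cons [simp]: "T 0 (cons \<tau> q \<omega>) = \<tau>" "T (Suc j) (cons \<tau> q \<omega>) = \<tau> + T j \<omega>"
  and Q_cons [simp]: "Q 0 (cons \<tau> q \<omega>) = q" "Q (Suc j) (cons \<tau> q \<omega>) = Q j \<omega>"
  by (simp_all add: cons_def T_def Q_def)

lemma shift_cons [simp]: "shift \<tau> (cons \<tau> q \<omega>) = \<omega>"
  by (auto simp: shift_def T_def Q_def cons_def)

lemma Omega_measurable [measurable]:
  "T i \<in> borel_measurable Omega" "Q i \<in> borel_measurable Omega"
proof -
  have "(\<lambda>\<omega>. \<omega> i) \<in> measurable Omega (borel :: (real \<times> real) measure)"
    unfolding Omega_def by (rule measurable_component_singleton) simp
  then show "T i \<in> borel_measurable Omega" "Q i \<in> borel_measurable Omega"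
    unfolding T_def[abs_def] Q_def[abs_def]
    by (auto intro!: measurable_compose[where N="borel :: (real \<times> real) measure"] borel_measurable_continuous_onI continuous_intros)
qed

lemma space_Omega [simp]: "space Omega = UNIV"
  by (simp add: Omega_def space_PiM)

lemma good_T_mono: "good \<omega> \<Longrightarrow> i \<le> j \<Longrightarrow> T i \<omega> \<le> T j \<omega>"
  by (rule lift_Suc_mono_le[of "\<lambda>i. T i \<omega>"]) (auto simp: good_def intro: less_imp_le)

lemma good_T_nonneg: "good \<omega> \<Longrightarrow> 0 \<le> T i \<omega>"
  using good_T_mono[of \<omega> 0 i] by (auto simp: good_def)

lemma good_shift: "good \<omega> \<Longrightarrow> good (shift (T 0 \<omega>) \<omega>)"
proof -
  assume g: "good \<omega>"
  have "filterlim (\<lambda>i. T (Suc i) \<omega>) at_top sequentially"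
    using g unfolding good_def filterlim_sequentially_Suc[of "\<lambda>i. T i \<omega>"] by auto
  then have "filterlim (\<lambda>i. - T 0 \<omega> + T (Suc i) \<omega>) at_top sequentially"
    by (rule filterlim_tendsto_add_at_top[OF tendsto_const])
  then show ?thesis using g by (auto simp: good_def less_imp_le)
qed

lemma good_finite: "good \<omega> \<Longrightarrow> finite {i. T i \<omega> \<le> t}"
proof -
  assume "good \<omega>"
  then have "\<forall>\<^sub>F i in sequentially. t < T i \<omega>"
    unfolding good_def filterlim_at_top_dense by auto
  then obtain N where "\<And>i. i \<ge> N \<Longrightarrow> t < T i \<omega>" unfolding eventually_sequentially by auto
  then have "{i. T i \<omega> \<le> t} \<subseteq> {..<N}" by (force simp: not_less[symmetric])
  then show ?thesis using finite_subset by blast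
qed

abbreviation "bpath \<equiv> belief_path lam0 lam1"

text \<open>After the second acquisition, the index of the latest acquisition is one larger on the
  original path than on the shifted one. Between the first two acquisitions the shifted path has not
  acquired yet and merely drifts from \<open>Q 0 \<omega>\<close>.\<close>

lemma bpath_shift:
  assumes g: "good \<omega>" and t: "T 0 \<omega> \<le> t"
  shows "bpath p \<omega> t = bpath (Q 0 \<omega>) (shift (T 0 \<omega>) \<omega>) (t - T 0 \<omega>)"
proof (cases "t < T 1 \<omega>")
  case True
  have "{i. T i \<omega> \<le> t} = {0}"
  proof (intro set_eqI iffI)
    fix i assume "i \<in> {i. T i \<omega> \<le> t}"
    then have "T i \<omega> < T 1 \<omega>" using True by auto
    then have "\<not> 1 \<le> i" using good_T_mono[OF g, of 1 i] by auto
    then show "i \<in> {0}" by auto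
  qed (use t in auto)
  then show ?thesis using True t by (simp add: belief_path_def)
next
  case False
  let ?J = "{j. T (Suc j) \<omega> \<le> t}"
  have eq: "{i. T i \<omega> \<le> t} = insert 0 (Suc ` ?J)"
    using t by (auto simp: image_iff) (metis not0_implies_Suc)
  have fin: "finite ?J" using good_finite[OF g, of t] eq by (metis finite_imageD finite_insert inj_Suc)
  have "0 \<in> ?J" using False by auto
  then have ne: "?J \<noteq> {}" by blast
  have "Max {i. T i \<omega> \<le> t} = Suc (Max ?J)"
    unfolding eq using fin ne by (subst Max_insert) (auto simp: mono_Max_commute[OF mono_Suc, symmetric])
  then show ?thesis using False t by (simp add: belief_path_def Let_def algebra_simps)
qed

lemma bpath_in:
  assumes g: "good \<omega>" and p: "p \<in> {0..1}" and t: "0 \<le> t"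
  shows "bpath p \<omega> t \<in> {0..1}"
proof (cases "t < T 0 \<omega>")
  case True
  then show ?thesis using drift_in[OF p t] by (simp add: belief_path_def)
next
  case False
  let ?J = "{i. T i \<omega> \<le> t}"
  have "0 \<in> ?J" using False by auto
  then have "Max ?J \<in> ?J" using good_finite[OF g] by (intro Max_in) auto
  then show ?thesis using False g drift_in[of "Q (Max ?J) \<omega>" "t - T (Max ?J) \<omega>"] 
    by (auto simp: belief_path_def Let_def good_def)
qed

lemma bpath_measurable [measurable]:
  "(\<lambda>(\<omega>, t). bpath p \<omega> t) \<in> borel_measurable (Omega \<Otimes>\<^sub>M borel)"
proof -
  let ?N = "Omega \<Otimes>\<^sub>M (borel :: real measure)"
  define m where "m x = Max {i. T i (fst x) \<le> snd x}" for x :: "outcome \<times> real"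
  have TQ [measurable]: "(\<lambda>x. T i (fst x)) \<in> borel_measurable ?N" "(\<lambda>x. Q i (fst x)) \<in> borel_measurable ?N" for i
    by (rule measurable_compose[OF measurable_fst Omega_measurable(1)] measurable_compose[OF measurable_fst Omega_measurable(2)])+
  have m [measurable]: "m \<in> measurable ?N (count_space UNIV)"
    unfolding m_def[abs_def] by (rule measurable_Max_nat) measurable
  have [measurable]: "(\<lambda>x. Q (m x) (fst x)) \<in> borel_measurable ?N" "(\<lambda>x. T (m x) (fst x)) \<in> borel_measurable ?N"
    by (rule measurable_compose_countable[OF TQ(2) m] measurable_compose_countable[OF TQ(1) m])+
  have "(\<lambda>x. if snd x < T 0 (fst x) then dr p (snd x) else dr (Q (m x) (fst x)) (snd x - T (m x) (fst x))) \<in> borel_measurable ?N"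
    by measurable
  then show ?thesis unfolding belief_path_def Let_def case_prod_beta m_def .
qed

lemma bpath_measurable_time [measurable]: "(\<lambda>t. bpath p \<omega> t) \<in> borel_measurable borel"
  using measurable_compose[OF measurable_Pair1' bpath_measurable, of \<omega> p] by simp

abbreviation "flow \<equiv> flow_payoff u r lam0 lam1"

lemma flow_eq: "flow p \<omega> = disc (\<lambda>t. u (bpath p \<omega> t))"
  by (simp add: flow_payoff_def disc_def)

lemma flow_measurable [measurable]: "flow p \<in> borel_measurable Omega"
proof -
  have [measurable]: "(\<lambda>x. u (bpath p (fst x) (snd x))) \<in> borel_measurable (Omega \<Otimes>\<^sub>M lborel)"
    using measurable_compose[OF bpath_measurable u_meas] by (simp add: case_prod_beta cong: measurable_cong_sets)
  show ?thesis unfolding flow_payoff_def[abs_def] set_lebesgue_integral_def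
    by (rule lborel.borel_measurable_lebesgue_integral) (unfold case_prod_beta, measurable)
qed

lemma flow_bound:
  obtains K where "K > 0" "\<And>p \<omega>. good \<omega> \<Longrightarrow> p \<in> {0..1} \<Longrightarrow> \<bar>flow p \<omega>\<bar> \<le> K"
proof -
  obtain K where K: "K > 0" "\<And>q. q \<in> {0..1} \<Longrightarrow> \<bar>u q\<bar> \<le> K" using u_bound by auto
  have "\<bar>flow p \<omega>\<bar> \<le> K * disc (\<lambda>_. 1)" if "good \<omega>" "p \<in> {0..1}" for p \<omega>
    unfolding flow_eq by (rule disc_bound) (use K bpath_in[OF that] in auto)
  moreover have "0 \<le> K * disc (\<lambda>_. 1)" using K disc_1_nonneg by simp
  ultimately show thesis by (intro that[of "K * disc (\<lambda>_. 1) + 1"]) fastforce+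
qed

text \<open>Renewal at the first acquisition: the path drifts until then and restarts from the
  posterior.\<close>

lemma flow_shift:
  assumes g: "good \<omega>" and p: "p \<in> {0..1}"
  shows "flow p \<omega> = flow_until p (T 0 \<omega>) + exp (- r * T 0 \<omega>) * flow (Q 0 \<omega>) (shift (T 0 \<omega>) \<omega>)"
proof -
  obtain K where K: "K > 0" "\<And>q. q \<in> {0..1} \<Longrightarrow> \<bar>u q\<bar> \<le> K" using u_bound by auto
  let ?s = "T 0 \<omega>"
  have s: "0 \<le> ?s" using g by (simp add: good_def)
  have "flow p \<omega> = (LINT t:{0..?s}|lborel. exp (- r * t) * u (bpath p \<omega> t)) 
     + exp (- r * ?s) * disc (\<lambda>t. u (bpath p \<omega> (?s + t)))"
    unfolding flow_eq by (rule disc_split[OF _ _ s, where K=K]) (use K bpath_in[OF g p] in auto)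
  also have "(LINT t:{0..?s}|lborel. exp (- r * t) * u (bpath p \<omega> t)) = flow_until p ?s"
    unfolding flow_until_def
  proof (rule set_lebesgue_integral_cong_AE)
    \<comment> \<open>At \<open>t = ?s\<close> the path has jumped already, so it agrees with the
      drift only off this null set.\<close>
    have "AE t in lborel. t \<noteq> ?s" by (rule AE_lborel_singleton)
    then show "AE t\<in>{0..?s} in lborel. exp (- r * t) * u (bpath p \<omega> t) = exp (- r * t) * u (dr p t)"
      by eventually_elim (simp add: belief_path_def)
  qed auto
  also have "disc (\<lambda>t. u (bpath p \<omega> (?s + t))) = flow (Q 0 \<omega>) (shift ?s \<omega>)"
    unfolding flow_eq disc_def
    by (rule set_lebesgue_integral_cong) (use bpath_shift[OF g] in auto)
  finally show ?thesis .
qed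

section \<open>Decomposing the flow into waiting periods\<close>

definition pre :: "real \<Rightarrow> nat \<Rightarrow> outcome \<Rightarrow> real" where
  "pre p = pre_belief lam0 lam1 p"

text \<open>Belief and time at the beginning of the waiting period that ends with acquisition
  \<open>i\<close>: right after acquisition \<open>i - 1\<close>, or at time 0. This absorbs the
  case distinction of \<open>pre_belief\<close>.\<close>

definition start :: "real \<Rightarrow> nat \<Rightarrow> outcome \<Rightarrow> real" where
  "start p i \<omega> = (case i of 0 \<Rightarrow> p | Suc j \<Rightarrow> Q j \<omega>)"
definition start_time :: "nat \<Rightarrow> outcome \<Rightarrow> real" where
  "start_time i \<omega> = (case i of 0 \<Rightarrow> 0 | Suc j \<Rightarrow> T j \<omega>)"

lemma pre_eq: "pre p i \<omega> = dr (start p i \<omega>) (T i \<omega> - start_time i \<omega>)"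
  by (cases i) (simp_all add: pre_def pre_belief_def start_def start_time_def)

lemma start_in: "good \<omega> \<Longrightarrow> p \<in> {0..1} \<Longrightarrow> start p i \<omega> \<in> {0..1}"
  by (cases i) (auto simp: start_def good_def)

lemma start_time_le: "good \<omega> \<Longrightarrow> start_time i \<omega> \<le> T i \<omega>"
  by (cases i) (auto simp: start_time_def good_def less_imp_le)

lemma pre_in: "good \<omega> \<Longrightarrow> p \<in> {0..1} \<Longrightarrow> pre p i \<omega> \<in> {0..1}"
  unfolding pre_eq using start_in start_time_le by (intro drift_in) auto

text \<open>The discounted flow earned while waiting for acquisition \<open>i\<close>, in the form
  given by \<open>flow_until_eq\<close>.\<close>

definition "piece p i \<omega> = exp (- r * start_time i \<omega>) * vl (start p i \<omega>) - exp (- r * T i \<omega>) * vl (pre p i \<omega>)"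

lemma start_shift: "start (Q 0 \<omega>) i (shift s \<omega>) = start p (Suc i) \<omega>"
  by (cases i) (auto simp: start_def)

lemma pre_shift: "pre (Q 0 \<omega>) i (shift (T 0 \<omega>) \<omega>) = pre p (Suc i) \<omega>"
  unfolding pre_eq start_shift[of \<omega> i "T 0 \<omega>" p] by (cases i) (auto simp: start_time_def)

lemma start_time_shift: "start_time i (shift (T 0 \<omega>) \<omega>) = start_time (Suc i) \<omega> - T 0 \<omega>"
  by (cases i) (auto simp: start_time_def)

lemma piece_shift: "piece p (Suc i) \<omega> = exp (- r * T 0 \<omega>) * piece (Q 0 \<omega>) i (shift (T 0 \<omega>) \<omega>)"
proof -
  have e: "exp (- r * x) = exp (- r * T 0 \<omega>) * exp (- r * (x - T 0 \<omega>))" for x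
    by (simp add: algebra_simps flip: exp_add)
  show ?thesis
    unfolding piece_def start_shift[of \<omega> i _ p] pre_shift[of \<omega> i p] start_time_shift T_shift
    by (subst e[of "start_time (Suc i) \<omega>"], subst e[of "T (Suc i) \<omega>"]) (simp add: algebra_simps)
qed

text \<open>The first \<open>n + 1\<close> pieces exhaust the flow up to
  \<open>T n \<omega>\<close>. What remains is the discounted flow of a restarted path, bounded by
  \<open>K\<close>. The induction peels off the first acquisition.\<close>

lemma flow_pieces:
  assumes K: "\<And>p \<omega>. good \<omega> \<Longrightarrow> p \<in> {0..1} \<Longrightarrow> \<bar>flow p \<omega>\<bar> \<le> K"
    and g: "good \<omega>" and p: "p \<in> {0..1}"
  shows "\<bar>flow p \<omega> - (\<Sum>i\<le>n. piece p i \<omega>)\<bar> \<le> exp (- r * T n \<omega>) * K"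
  using g p
proof (induction n arbitrary: p \<omega>)
  case (0 p \<omega>)
  note q = 0(1)[unfolded good_def]
  have "flow p \<omega> - piece p 0 \<omega> = exp (- r * T 0 \<omega>) * flow (Q 0 \<omega>) (shift (T 0 \<omega>) \<omega>)"
    using flow_shift[OF 0] q flow_until_eq[OF 0(2), of "T 0 \<omega>"]
    by (simp add: piece_def start_def start_time_def pre_def pre_belief_def)
  also have "\<bar>\<dots>\<bar> \<le> exp (- r * T 0 \<omega>) * K"
    unfolding abs_mult abs_exp_cancel using q K[OF good_shift[OF 0(1)]] by (intro mult_left_mono) auto
  finally show ?case by simp
next
  case (Suc n p \<omega>)
  note q = Suc(2)[unfolded good_def]
  let ?w = "shift (T 0 \<omega>) \<omega>"
  have "flow p \<omega> - piece p 0 \<omega> = exp (- r * T 0 \<omega>) * flow (Q 0 \<omega>) ?w"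
    using flow_shift[OF Suc(2,3)] q flow_until_eq[OF Suc(3), of "T 0 \<omega>"]
    by (simp add: piece_def start_def start_time_def pre_def pre_belief_def)
  then have "flow p \<omega> - (\<Sum>i\<le>Suc n. piece p i \<omega>) 
     = exp (- r * T 0 \<omega>) * (flow (Q 0 \<omega>) ?w - (\<Sum>i\<le>n. piece (Q 0 \<omega>) i ?w))"
    unfolding sum.atMost_Suc_shift piece_shift by (simp add: sum_distrib_left algebra_simps)
  also have "\<bar>\<dots>\<bar> \<le> exp (- r * T 0 \<omega>) * (exp (- r * T n ?w) * K)"
    unfolding abs_mult abs_exp_cancel
    by (intro mult_left_mono Suc.IH good_shift[OF Suc(2)]) (use q in auto)
  also have "\<dots> = exp (- r * T (Suc n) \<omega>) * K"
    unfolding mult.assoc[symmetric] by (simp add: algebra_simps flip: exp_add)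
  finally show ?case .
qed

section \<open>Supersolutions dominate all policies\<close>

lemma info_map_measurable:
  "(\<lambda>\<omega>. (restrict \<omega> {..<i}, T i \<omega>)) \<in> measurable Omega (PiM {..<i} (\<lambda>_. borel) \<Otimes>\<^sub>M borel)"
proof (rule measurable_Pair)
  show "(\<lambda>\<omega>. restrict \<omega> {..<i}) \<in> measurable Omega (PiM {..<i} (\<lambda>_. borel))"
    unfolding Omega_def by (rule measurable_restrict_subset) simp
qed simp

lemma info_map_measurable':
  "(\<lambda>\<omega>. (restrict \<omega> {..<i}, T i \<omega>)) \<in> measurable (info_alg i) (PiM {..<i} (\<lambda>_. borel) \<Otimes>\<^sub>M borel)"
  unfolding info_alg_def
  by (rule measurable_vimage_algebra1) (use measurable_space[OF info_map_measurable] in auto)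

lemma space_info_alg [simp]: "space (info_alg i) = UNIV"
  by (simp add: info_alg_def)

lemma info_alg_subset: "(\<lambda>\<omega>. \<omega>) \<in> measurable Omega (info_alg i)"
  unfolding info_alg_def by (rule measurable_vimage_algebra2) (use info_map_measurable in auto)

lemma T_info_measurable: "T i \<in> borel_measurable (info_alg i)"
  using measurable_compose[OF info_map_measurable' measurable_snd] by simp

text \<open>Posteriors lie in the unit interval only almost surely, whereas functions measurable on
  \<open>PostM\<close> have to be evaluated in its space; clipping is a total measurable retraction
  onto it.\<close>

definition clip :: "real \<Rightarrow> real" where "clip q = max 0 (min 1 q)"

lemma clip_id: "q \<in> {0..1} \<Longrightarrow> clip q = q"
  by (auto simp: clip_def)

lemma clip_measurable: "clip \<in> measurable borel PostM"
  unfolding PostM_def clip_def[abs_def]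
  by (rule measurable_restrict_space2) auto

section \<open>Posteriors as draws from the chosen kernels\<close>

lemma policyD:
  assumes "policy lam0 lam1 p M F"
  shows "prob_space M" "sets M = sets Omega" "AE \<omega> in M. good \<omega>"
    "F i \<in> measurable (info_alg i) (subprob_algebra PostM)"
    "F i \<in> measurable M (subprob_algebra PostM)"
    "AE \<omega> in M. \<forall>i. F i \<omega> \<in> bayes_plausible (pre p i \<omega>)"
    "A \<in> sets (info_alg i) \<Longrightarrow> B \<in> sets PostM \<Longrightarrow>
      measure M (A \<inter> {\<omega>\<in>space M. Q i \<omega> \<in> B}) = (\<integral>\<omega>. indicator A \<omega> * measure (F i \<omega>) B \<partial>M)"
proof -
  show s: "sets M = sets Omega" and F: "F i \<in> measurable (info_alg i) (subprob_algebra PostM)" for i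
    using assms by (auto simp: policy_def)
  show "F i \<in> measurable M (subprob_algebra PostM)"
    using measurable_compose[OF info_alg_subset F] measurable_cong_sets[OF s refl, of "subprob_algebra PostM"] by auto
qed (use assms in \<open>auto simp: policy_def good_def pre_def\<close>)

lemma kernel_indicator:
  assumes pol: "policy lam0 lam1 p M F" and A: "A \<in> sets (info_alg i)" and B: "B \<in> sets PostM"
  shows "(\<integral>\<^sup>+\<omega>. indicator A \<omega> * indicator B (clip (Q i \<omega>)) \<partial>M) = (\<integral>\<^sup>+\<omega>. indicator A \<omega> * emeasure (F i \<omega>) B \<partial>M)"
proof -
  note D = policyD[OF pol]
  interpret prob_space M by fact
  have [measurable_cong]: "sets M = sets Omega" by fact
  have sp: "space M = UNIV" using sets_eq_imp_space_eq[OF D(2)] by simp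
  have A' [measurable]: "A \<in> sets Omega"
    using measurable_sets[OF info_alg_subset A] by simp
  have B': "B \<in> sets borel" "B \<subseteq> {0..1}" using B unfolding PostM_def by (subst (asm) sets_restrict_space_iff; auto)+
  have [measurable]: "B \<in> sets borel" by fact
  have sub: "subprob_space (F i \<omega>)" for \<omega>
    using measurable_space[OF D(4), of \<omega>] by (simp add: space_subprob_algebra)
  have Fm [measurable]: "(\<lambda>\<omega>. measure (F i \<omega>) B) \<in> borel_measurable M"
    by (rule measurable_compose[OF D(5) measurable_measure_subprob_algebra[OF B]])
  have "(\<integral>\<^sup>+\<omega>. indicator A \<omega> * indicator B (clip (Q i \<omega>)) \<partial>M) = (\<integral>\<^sup>+\<omega>. indicator (A \<inter> {\<omega>\<in>space M. Q i \<omega> \<in> B}) \<omega> \<partial>M)"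
    by (rule nn_integral_cong_AE, use D(3) in eventually_elim) (auto simp: good_def clip_id sp indicator_def)
  also have "\<dots> = emeasure M (A \<inter> {\<omega>\<in>space M. Q i \<omega> \<in> B})"
    by (rule nn_integral_indicator) measurable
  also have "\<dots> = ennreal (\<integral>\<omega>. indicator A \<omega> * measure (F i \<omega>) B \<partial>M)"
    unfolding emeasure_eq_measure D(7)[OF A B] ..
  also have "\<dots> = (\<integral>\<^sup>+\<omega>. ennreal (indicator A \<omega> * measure (F i \<omega>) B) \<partial>M)"
    by (rule nn_integral_eq_integral[symmetric])
       (auto intro!: integrable_const_bound[where B=1] simp: indicator_def subprob_space.subprob_measure_le_1[OF sub])
  also have "\<dots> = (\<integral>\<^sup>+\<omega>. indicator A \<omega> * emeasure (F i \<omega>) B \<partial>M)"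
    by (intro nn_integral_cong)
       (simp add: indicator_def finite_measure.emeasure_eq_measure[OF subprob_space.axioms(1)[OF sub]])
  finally show ?thesis .
qed

text \<open>The definition of a policy states the conditional law only for products of events. It is
  extended first to nonnegative functions \<open>g\<close> of the information, and then to
  nonnegative functions \<open>f\<close> of the posterior.\<close>

lemma kernel_nn:
  fixes f :: "real \<Rightarrow> ennreal"
  assumes pol: "policy lam0 lam1 p M F" and g: "g \<in> borel_measurable (info_alg i)" and f: "f \<in> borel_measurable PostM"
  shows "(\<integral>\<^sup>+\<omega>. g \<omega> * f (clip (Q i \<omega>)) \<partial>M) = (\<integral>\<^sup>+\<omega>. g \<omega> * (\<integral>\<^sup>+q. f q \<partial>F i \<omega>) \<partial>M)"
proof -
  note D = policyD[OF pol]
  interpret prob_space M by fact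
  have ms [measurable_cong]: "sets M = sets Omega" by fact
  have sp: "space M = UNIV" using sets_eq_imp_space_eq[OF D(2)] by simp
  have id: "(\<lambda>\<omega>. \<omega>) \<in> measurable M (info_alg i)" 
    using info_alg_subset measurable_cong_sets[OF ms refl] by blast
  have g' [measurable]: "g \<in> borel_measurable M" using measurable_compose[OF id g] .
  have Qc [measurable]: "(\<lambda>\<omega>. clip (Q i \<omega>)) \<in> measurable M PostM"
    by (rule measurable_compose[OF _ clip_measurable]) measurable
  have F' [measurable]: "F i \<in> measurable M (subprob_algebra PostM)" by (rule D(5))
  have g_eq: "(\<integral>\<^sup>+\<omega>. indicator B (clip (Q i \<omega>)) * g \<omega> \<partial>M) = (\<integral>\<^sup>+\<omega>. emeasure (F i \<omega>) B * g \<omega> \<partial>M)" if B: "B \<in> sets PostM" for B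
  proof -
    have [measurable]: "(\<lambda>\<omega>. emeasure (F i \<omega>) B) \<in> borel_measurable M" "(\<lambda>\<omega>. indicator B (clip (Q i \<omega>)) :: ennreal) \<in> borel_measurable M"
      using measurable_compose[OF D(5) measurable_emeasure_subprob_algebra[OF B]] 
        measurable_compose[OF Qc borel_measurable_indicator[OF B]] by auto
    \<comment> \<open>For fixed \<open>B\<close> both sides are integrals of \<open>g\<close>
      against a measure on \<open>info_alg i\<close>, and \<open>kernel_indicator\<close> says that
      these two measures agree on every event.\<close>
    let ?N1 = "distr (density M (\<lambda>\<omega>. indicator B (clip (Q i \<omega>)))) (info_alg i) (\<lambda>\<omega>. \<omega>)"
    let ?N2 = "distr (density M (\<lambda>\<omega>. emeasure (F i \<omega>) B)) (info_alg i) (\<lambda>\<omega>. \<omega>)"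
    have id': "(\<lambda>\<omega>. \<omega>) \<in> measurable (density M h) (info_alg i)" for h using id by simp
    have "?N1 = ?N2"
    proof (rule measure_eqI)
      fix A assume "A \<in> sets ?N1"
      then have A: "A \<in> sets (info_alg i)" by simp
      then have A': "A \<in> sets M" using measurable_sets[OF id A] sp by simp
      show "emeasure ?N1 A = emeasure ?N2 A"
        using kernel_indicator[OF pol A B] A A' sp
        by (simp add: emeasure_distr[OF id'] emeasure_density mult.commute)
    qed simp
    then have "(\<integral>\<^sup>+\<omega>. g \<omega> \<partial>?N1) = (\<integral>\<^sup>+\<omega>. g \<omega> \<partial>?N2)" by simp
    then show ?thesis
      using g by (simp add: nn_integral_distr[OF id'] nn_integral_density)
  qed
  let ?D = "density M g"
  have Qc': "(\<lambda>\<omega>. clip (Q i \<omega>)) \<in> measurable ?D PostM" and F'': "F i \<in> measurable ?D (subprob_algebra PostM)"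
    using Qc F' by simp_all
  \<comment> \<open>Under the measure reweighted by \<open>g\<close>, the posterior is distributed
    as the mixture of the kernels \<open>F i\<close>; the claim integrates \<open>f\<close> against
    both descriptions.\<close>
  have "distr ?D PostM (\<lambda>\<omega>. clip (Q i \<omega>)) = ?D \<bind> F i"
  proof (rule measure_eqI)
    show s: "sets (distr ?D PostM (\<lambda>\<omega>. clip (Q i \<omega>))) = sets (?D \<bind> F i)"
      by (simp, rule sets_bind[OF sets_kernel[OF F''], symmetric]) (auto simp: sp)
    fix B assume "B \<in> sets (distr ?D PostM (\<lambda>\<omega>. clip (Q i \<omega>)))"
    then have B [measurable]: "B \<in> sets PostM" by simp
    have "emeasure (distr ?D PostM (\<lambda>\<omega>. clip (Q i \<omega>))) B = (\<integral>\<^sup>+x. indicator B x \<partial>distr ?D PostM (\<lambda>\<omega>. clip (Q i \<omega>)))"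
      by simp
    also have "\<dots> = (\<integral>\<^sup>+\<omega>. indicator B (clip (Q i \<omega>)) \<partial>?D)" by (rule nn_integral_distr[OF Qc']) simp
    also have "\<dots> = (\<integral>\<^sup>+\<omega>. indicator B (clip (Q i \<omega>)) * g \<omega> \<partial>M)"
      by (subst nn_integral_density) (auto simp: mult.commute)
    also have "\<dots> = (\<integral>\<^sup>+\<omega>. emeasure (F i \<omega>) B \<partial>?D)"
      unfolding g_eq[OF B] using measurable_compose[OF D(5) measurable_emeasure_subprob_algebra[OF B]]
      by (subst nn_integral_density) (auto simp: mult.commute)
    also have "\<dots> = emeasure (?D \<bind> F i) B"
      by (rule emeasure_bind[OF _ F'' B, symmetric]) (simp add: sp)
    finally show "emeasure (distr ?D PostM (\<lambda>\<omega>. clip (Q i \<omega>))) B = emeasure (?D \<bind> F i) B" .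
  qed
  then have "(\<integral>\<^sup>+x. f x \<partial>distr ?D PostM (\<lambda>\<omega>. clip (Q i \<omega>))) = (\<integral>\<^sup>+x. f x \<partial>(?D \<bind> F i))" by simp
  also have "\<dots> = (\<integral>\<^sup>+\<omega>. (\<integral>\<^sup>+q. f q \<partial>F i \<omega>) \<partial>?D)" by (rule nn_integral_bind[OF f F''])
  also have "\<dots> = (\<integral>\<^sup>+\<omega>. g \<omega> * (\<integral>\<^sup>+q. f q \<partial>F i \<omega>) \<partial>M)"
    using measurable_compose[OF D(5) nn_integral_measurable_subprob_algebra[OF f]]
    by (subst nn_integral_density) auto
  also have "(\<integral>\<^sup>+x. f x \<partial>distr ?D PostM (\<lambda>\<omega>. clip (Q i \<omega>))) = (\<integral>\<^sup>+\<omega>. g \<omega> * f (clip (Q i \<omega>)) \<partial>M)"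
    using measurable_compose[OF Qc f] f by (subst nn_integral_distr[OF Qc']) (auto simp: nn_integral_density)
  finally show ?thesis .
qed

text \<open>The tower property for bounded real \<open>f\<close>: adding \<open>K\<close> makes the
  integrand nonnegative, and the added term is integrable and cancels at the end.\<close>

lemma kernel_real:
  assumes pol: "policy lam0 lam1 p M F" and f: "f \<in> borel_measurable borel" and fK: "\<forall>q\<in>{0..1}. \<bar>f q\<bar> \<le> K"
  shows "(\<integral>\<omega>. exp (- r * T i \<omega>) * f (Q i \<omega>) \<partial>M) = (\<integral>\<omega>. exp (- r * T i \<omega>) * (\<integral>q. f q \<partial>F i \<omega>) \<partial>M)"
    "integrable M (\<lambda>\<omega>. exp (- r * T i \<omega>) * f (Q i \<omega>))"
    "integrable M (\<lambda>\<omega>. exp (- r * T i \<omega>) * (\<integral>q. f q \<partial>F i \<omega>))"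
proof -
  note D = policyD[OF pol]
  interpret prob_space M by fact
  have ms [measurable_cong]: "sets M = sets Omega" by fact
  have [measurable]: "f \<in> borel_measurable borel" by fact
  have fP [measurable]: "f \<in> borel_measurable PostM" unfolding PostM_def using f by (rule measurable_restrict_space1)
  have [measurable]: "F i \<in> measurable M (subprob_algebra PostM)" by (rule D(5))
  let ?e = "\<lambda>\<omega>. exp (- r * T i \<omega>)"
  let ?I = "\<lambda>\<omega>. (\<integral>q. f q \<partial>F i \<omega>)"
  have [measurable]: "?I \<in> borel_measurable M"
    by (rule measurable_compose[OF D(5) integral_measurable_subprob_algebra[OF fP]])
  have e1: "?e \<omega> \<le> 1" if "good \<omega>" for \<omega> using good_T_nonneg[OF that, of i] r by simp
  have Ib: "\<bar>\<integral>q. f q \<partial>G\<bar> \<le> K" "(\<integral>\<^sup>+q. ennreal (f q + K) \<partial>G) = ennreal ((\<integral>q. f q \<partial>G) + K)" if G: "G \<in> bayes_plausible q'" for G q'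
  proof -
    interpret G: prob_space G using bayes_plausibleD(1)[OF G] .
    have i: "integrable G f" by (rule bayes_plausible_integrable[OF G fP, where K=K]) (use fK in auto)
    show "\<bar>\<integral>q. f q \<partial>G\<bar> \<le> K"
    proof (rule abs_leI)
      show "(\<integral>q. f q \<partial>G) \<le> K"
        by (rule G.integral_le_const[OF i]) (use fK bayes_plausibleD(3)[OF G] in \<open>auto simp: abs_le_iff\<close>)
      show "- (\<integral>q. f q \<partial>G) \<le> K"
      proof -
        have "AE q in G. - K \<le> f q"
        proof (rule AE_I2)
          fix q assume "q \<in> space G"
          then have "\<bar>f q\<bar> \<le> K" using fK bayes_plausibleD(3)[OF G] by blast
          then show "- K \<le> f q" by linarith
        qed
        then show ?thesis using G.integral_ge_const[OF i, of "- K"] by simp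
      qed
    qed
    have "(\<integral>\<^sup>+q. ennreal (f q + K) \<partial>G) = ennreal (\<integral>q. f q + K \<partial>G)"
    proof (rule nn_integral_eq_integral)
      show "AE q in G. 0 \<le> f q + K"
      proof (rule AE_I2)
        fix q assume "q \<in> space G"
        then have "\<bar>f q\<bar> \<le> K" using fK bayes_plausibleD(3)[OF G] by blast
        then show "0 \<le> f q + K" by linarith
      qed
    qed (use i in simp)
    also have "(\<integral>q. f q + K \<partial>G) = (\<integral>q. f q \<partial>G) + K" using i by (simp add: G.prob_space)
    finally show "(\<integral>\<^sup>+q. ennreal (f q + K) \<partial>G) = ennreal ((\<integral>q. f q \<partial>G) + K)" .
  qed
  have ie: "integrable M (\<lambda>\<omega>. ?e \<omega> * X \<omega>)" if [measurable]: "X \<in> borel_measurable M" and "AE \<omega> in M. \<bar>X \<omega>\<bar> \<le> K" for X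
  proof (rule integrable_const_bound[where B=K])
    show "AE \<omega> in M. norm (?e \<omega> * X \<omega>) \<le> K"
      using D(3) that(2)
    proof eventually_elim
      fix \<omega> assume "good \<omega>" "\<bar>X \<omega>\<bar> \<le> K"
      then have "?e \<omega> * \<bar>X \<omega>\<bar> \<le> 1 * K" using e1 by (intro mult_mono) auto
      then show "norm (?e \<omega> * X \<omega>) \<le> K" by (simp add: abs_mult)
    qed
  qed measurable
  have aeQ: "AE \<omega> in M. \<bar>f (Q i \<omega>)\<bar> \<le> K"
    using D(3) by eventually_elim (use fK in \<open>auto simp: good_def\<close>)
  have aeI: "AE \<omega> in M. \<bar>?I \<omega>\<bar> \<le> K"
    using D(6) by eventually_elim (use Ib(1) in blast)
  show i1: "integrable M (\<lambda>\<omega>. ?e \<omega> * f (Q i \<omega>))" by (rule ie[OF _ aeQ]) measurable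
  show i2: "integrable M (\<lambda>\<omega>. ?e \<omega> * ?I \<omega>)" by (rule ie[OF _ aeI]) measurable
  have iK: "integrable M (\<lambda>\<omega>. ?e \<omega> * K)"
    by (rule ie, simp, use aeQ in eventually_elim) auto
  have "(\<integral>\<^sup>+\<omega>. ennreal (?e \<omega>) * ennreal (f (clip (Q i \<omega>)) + K) \<partial>M) = (\<integral>\<^sup>+\<omega>. ennreal (?e \<omega>) * (\<integral>\<^sup>+q. ennreal (f q + K) \<partial>F i \<omega>) \<partial>M)"
    by (rule kernel_nn[OF pol, where f="\<lambda>q. ennreal (f q + K)"]) (use T_info_measurable[of i] in measurable)
  also have "(\<integral>\<^sup>+\<omega>. ennreal (?e \<omega>) * (\<integral>\<^sup>+q. ennreal (f q + K) \<partial>F i \<omega>) \<partial>M) = (\<integral>\<^sup>+\<omega>. ennreal (?e \<omega> * ?I \<omega> + ?e \<omega> * K) \<partial>M)"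
  proof (rule nn_integral_cong_AE, use D(6) aeI in eventually_elim)
    fix \<omega> assume "\<forall>i. F i \<omega> \<in> bayes_plausible (pre p i \<omega>)" "\<bar>?I \<omega>\<bar> \<le> K"
    then show "ennreal (?e \<omega>) * (\<integral>\<^sup>+q. ennreal (f q + K) \<partial>F i \<omega>) = ennreal (?e \<omega> * ?I \<omega> + ?e \<omega> * K)"
      using Ib(2)[of "F i \<omega>" "pre p i \<omega>"] by (simp add: ennreal_mult' distrib_left[symmetric])
  qed
  also have "\<dots> = ennreal (\<integral>\<omega>. ?e \<omega> * ?I \<omega> + ?e \<omega> * K \<partial>M)"
    by (rule nn_integral_eq_integral[OF Bochner_Integration.integrable_add[OF i2 iK]], use aeI in eventually_elim)
       (auto simp: distrib_left[symmetric])
  also have "(\<integral>\<^sup>+\<omega>. ennreal (?e \<omega>) * ennreal (f (clip (Q i \<omega>)) + K) \<partial>M) = (\<integral>\<^sup>+\<omega>. ennreal (?e \<omega> * f (Q i \<omega>) + ?e \<omega> * K) \<partial>M)"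
    by (rule nn_integral_cong_AE, use D(3) in eventually_elim)
       (auto simp: ennreal_mult' distrib_left[symmetric] clip_id good_def)
  also have "\<dots> = ennreal (\<integral>\<omega>. ?e \<omega> * f (Q i \<omega>) + ?e \<omega> * K \<partial>M)"
    by (rule nn_integral_eq_integral[OF Bochner_Integration.integrable_add[OF i1 iK]], use aeQ in eventually_elim)
       (auto simp: distrib_left[symmetric])
  finally have "(\<integral>\<omega>. ?e \<omega> * f (Q i \<omega>) + ?e \<omega> * K \<partial>M) = (\<integral>\<omega>. ?e \<omega> * ?I \<omega> + ?e \<omega> * K \<partial>M)"
  proof (rule ennreal_inj[THEN iffD1, rotated -1])
    show "0 \<le> (\<integral>\<omega>. ?e \<omega> * f (Q i \<omega>) + ?e \<omega> * K \<partial>M)"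
      by (rule integral_nonneg_AE, use aeQ in eventually_elim) (auto simp: distrib_left[symmetric])
    show "0 \<le> (\<integral>\<omega>. ?e \<omega> * ?I \<omega> + ?e \<omega> * K \<partial>M)"
      by (rule integral_nonneg_AE, use aeI in eventually_elim) (auto simp: distrib_left[symmetric])
  qed
  then show "(\<integral>\<omega>. ?e \<omega> * f (Q i \<omega>) \<partial>M) = (\<integral>\<omega>. ?e \<omega> * ?I \<omega> \<partial>M)"
    unfolding Bochner_Integration.integral_add[OF i1 iK] Bochner_Integration.integral_add[OF i2 iK] by simp
qed

lemma vl_measurable [measurable]: "vl \<in> borel_measurable borel"
proof -
  have [measurable]: "(\<lambda>x. u (dr (fst x) (snd x))) \<in> borel_measurable (borel \<Otimes>\<^sub>M lborel)"
    using measurable_compose[OF drift_measurable u_meas] by (simp add: case_prod_beta cong: measurable_cong_sets)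
  show ?thesis unfolding vl_def[abs_def] disc_def set_lebesgue_integral_def
    by (rule lborel.borel_measurable_lebesgue_integral) (unfold case_prod_beta, measurable)
qed

section \<open>Verification: a supersolution bounds every payoff\<close>

lemma brhs_cong:
  assumes "\<forall>q\<in>{0..1}. w q = w' q"
  shows "brhs w p = brhs w' p"
  unfolding bellman_rhs_def
proof (intro SUP_cong refl arg_cong2[where f="(+)"] arg_cong2[where f="(*)"] arg_cong2[where f="(-)"])
  fix \<tau> F assume "F \<in> bayes_plausible (dr p \<tau>)"
  from bayes_plausibleD(3)[OF this] assms show "ereal (\<integral>q. w q \<partial>F) = ereal (\<integral>q. w' q \<partial>F)"
    by (auto intro!: Bochner_Integration.integral_cong)
qed

abbreviation "payoff' \<equiv> payoff u c \<kappa> r lam0 lam1"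

text \<open>On each path, the supersolution inequality bounds by the cost of stage \<open>i\<close>
  what the stage adds to flow plus continuation value. In expectation the continuation values
  telescope, and the remainders after \<open>n\<close> acquisitions are discounted away because
  acquisition times diverge. The function \<open>w\<close> is Borel on the whole line, because it is
  evaluated at posteriors that lie in the unit interval only almost surely.\<close>

lemma verification_borel:
  assumes w: "w \<in> borel_measurable borel" "\<forall>q\<in>{0..1}. \<bar>w q\<bar> \<le> K" "\<forall>q\<in>{0..1}. brhs w q \<le> ereal (w q)"
    and p: "p \<in> {0..1}" and pol: "policy lam0 lam1 p M F"
  shows "payoff' p M F \<le> ereal (w p)"
proof -
  note D = policyD[OF pol]
  interpret prob_space M by fact
  have ms [measurable_cong]: "sets M = sets Omega" by fact
  have [measurable]: "w \<in> borel_measurable borel" by fact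
  obtain Kf where Kf: "Kf > 0" "\<And>p \<omega>. good \<omega> \<Longrightarrow> p \<in> {0..1} \<Longrightarrow> \<bar>flow p \<omega>\<bar> \<le> Kf" using flow_bound by metis
  obtain Kl where Kl: "Kl > 0" "\<And>q. q \<in> {0..1} \<Longrightarrow> \<bar>vl q\<bar> \<le> Kl" using vl_bound by metis
  have [measurable]: "start p i \<in> borel_measurable Omega" "start_time i \<in> borel_measurable Omega" for i
    unfolding start_def[abs_def] start_time_def[abs_def] by (cases i; simp)+
  have [measurable]: "pre p i \<in> borel_measurable Omega" for i
    unfolding pre_eq[abs_def] by measurable
  have [measurable]: "piece p i \<in> borel_measurable Omega" for i
    unfolding piece_def[abs_def] by measurable
  define cost where "cost i \<omega> = ennreal (exp (- r * T i \<omega>)) * e2ennreal (ups_cost c (F i \<omega>) (pre p i \<omega>) + ereal \<kappa>)" for i \<omega>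
  \<comment> \<open>Gain of stage \<open>i\<close> before costs: its flow, plus the expected
    continuation value after the acquisition, minus the continuation value at its beginning.\<close>
  define h where "h i \<omega> = piece p i \<omega> + exp (- r * T i \<omega>) * (\<integral>q. w q \<partial>F i \<omega>) - exp (- r * start_time i \<omega>) * w (start p i \<omega>)" for i \<omega>
  have st0: "good \<omega> \<Longrightarrow> 0 \<le> start_time i \<omega>" for i \<omega>
    by (cases i) (auto simp: start_time_def good_T_nonneg)
  have h_le: "ereal (h i \<omega>) \<le> enn2ereal (cost i \<omega>)"
    if g: "good \<omega>" and F: "F i \<omega> \<in> bayes_plausible (pre p i \<omega>)" for i \<omega>
  proof -
    let ?s = "start p i \<omega>" and ?t = "T i \<omega> - start_time i \<omega>" and ?C = "ups_cost c (F i \<omega>) (pre p i \<omega>)"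
    have t: "0 \<le> ?t" using start_time_le[OF g, of i] by simp
    have s: "?s \<in> {0..1}" by (rule start_in[OF g p])
    have C0: "0 \<le> ?C" by (rule ups_cost_nonneg[OF F pre_in[OF g p]])
    show ?thesis
    proof (cases "?C = \<infinity>")
      case True
      then have "cost i \<omega> = top" unfolding cost_def by (simp add: ennreal_mult_eq_top_iff)
      then show ?thesis by (simp add: top_ereal_def)
    next
      case False
      then obtain C where C: "?C = ereal C" "0 \<le> C" using C0 by (cases ?C) auto
      have "bell w ?s ?t (F i \<omega>) \<le> w ?s"
        using w(3)[rule_format, OF s] unfolding brhs_le_iff[OF s] using t F False unfolding pre_eq by blast
      then have "flow_until ?s ?t + exp (- r * ?t) * ((\<integral>q. w q \<partial>F i \<omega>) - C - \<kappa>) \<le> w ?s"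
        unfolding bell_def pre_eq[symmetric] C(1) by simp
      then have "exp (- r * start_time i \<omega>) * (flow_until ?s ?t + exp (- r * ?t) * ((\<integral>q. w q \<partial>F i \<omega>) - C - \<kappa>)) \<le> exp (- r * start_time i \<omega>) * w ?s"
        by (rule mult_left_mono) simp
      moreover have e: "exp (- r * start_time i \<omega>) * exp (- r * ?t) = exp (- r * T i \<omega>)"
        by (simp add: algebra_simps flip: exp_add)
      have "exp (- r * start_time i \<omega>) * (flow_until ?s ?t + exp (- r * ?t) * ((\<integral>q. w q \<partial>F i \<omega>) - C - \<kappa>)) 
        = piece p i \<omega> + exp (- r * T i \<omega>) * ((\<integral>q. w q \<partial>F i \<omega>) - C - \<kappa>)"
        unfolding flow_until_eq[OF s t] piece_def pre_eq e[symmetric] by (simp only: algebra_simps)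
      ultimately have "h i \<omega> \<le> exp (- r * T i \<omega>) * (C + \<kappa>)"
        unfolding h_def by (simp add: algebra_simps)
      moreover have "cost i \<omega> = ennreal (exp (- r * T i \<omega>) * (C + \<kappa>))"
        unfolding cost_def C(1) using C(2) kappa by (simp add: e2ennreal_ereal ennreal_mult' flip: ennreal_mult)
      ultimately show ?thesis using C(2) kappa by (simp add: enn2ereal_ennreal)
    qed
  qed
  have bounded_int: "integrable M X" if "X \<in> borel_measurable M" "\<And>\<omega>. good \<omega> \<Longrightarrow> \<bar>X \<omega>\<bar> \<le> B" for X and B :: real
  proof (rule integrable_const_bound[OF _ that(1)])
    show "AE \<omega> in M. norm (X \<omega>) \<le> B" using D(3) by eventually_elim (simp add: that(2))
  qed
  have disc1: "\<bar>exp (- r * t) * x\<bar> \<le> L" if "0 \<le> t" "\<bar>x\<bar> \<le> L" for t x L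
  proof -
    have "exp (- r * t) * \<bar>x\<bar> \<le> 1 * L" using that r by (intro mult_mono) auto
    then show ?thesis by (simp add: abs_mult)
  qed
  have i_piece: "integrable M (piece p i)" for i
  proof (rule bounded_int[of _ "Kl + Kl"])
    fix \<omega> assume g: "good \<omega>"
    have "\<bar>exp (- r * start_time i \<omega>) * vl (start p i \<omega>)\<bar> \<le> Kl" "\<bar>exp (- r * T i \<omega>) * vl (pre p i \<omega>)\<bar> \<le> Kl"
      using disc1[OF st0[OF g] Kl(2)[OF start_in[OF g p]]] disc1[OF good_T_nonneg[OF g] Kl(2)[OF pre_in[OF g p]]] .
    then show "\<bar>piece p i \<omega>\<bar> \<le> Kl + Kl" unfolding piece_def by linarith
  qed measurable
  have i_start: "integrable M (\<lambda>\<omega>. exp (- r * start_time i \<omega>) * w (start p i \<omega>))" for i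
    by (rule bounded_int[of _ K]) (measurable, intro disc1 st0 w(2)[rule_format] start_in p)
  note k = kernel_real[OF pol w(1,2)]
  have i_h: "integrable M (h i)" for i
    unfolding h_def using i_piece i_start k(3) by (intro Bochner_Integration.integrable_diff Bochner_Integration.integrable_add)
  have cost_ge: "ereal (\<integral>\<omega>. h i \<omega> \<partial>M) \<le> enn2ereal (\<integral>\<^sup>+\<omega>. cost i \<omega> \<partial>M)" for i
  proof -
    have "AE \<omega> in M. ereal (h i \<omega>) \<le> enn2ereal (cost i \<omega>)"
      using D(3,6) by eventually_elim (use h_le in blast)
    with i_h show ?thesis by (rule integral_le_nn_integral)
  qed
  \<comment> \<open>The expected discount factor at acquisition \<open>n\<close>. It controls both
    remainders, the continuation value \<open>a n\<close> and the flow after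
    \<open>T n\<close>.\<close>
  define e where "e n = (\<integral>\<omega>. exp (- r * T n \<omega>) \<partial>M)" for n
  have i_e: "integrable M (\<lambda>\<omega>. exp (- r * T n \<omega>))" for n
    by (rule bounded_int[of _ 1]) (measurable, use good_T_nonneg r in auto)
  have e_lim: "e \<longlonglongrightarrow> 0"
  proof -
    have "(\<lambda>n. \<integral>\<omega>. exp (- r * T n \<omega>) \<partial>M) \<longlonglongrightarrow> (\<integral>\<omega>. 0 \<partial>M)"
    proof (rule integral_dominated_convergence[where w="\<lambda>_. 1"])
      show "AE \<omega> in M. (\<lambda>n. exp (- r * T n \<omega>)) \<longlonglongrightarrow> 0"
        using D(3) by eventually_elim (rule filterlim_compose[OF exp_decay], simp add: good_def)
      show "AE \<omega> in M. norm (exp (- r * T n \<omega>)) \<le> 1" for n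
        using D(3) by eventually_elim (use good_T_nonneg r in auto)
    qed auto
    then show ?thesis by (simp add: e_def[abs_def])
  qed
  define a where "a n = (\<integral>\<omega>. exp (- r * T n \<omega>) * w (Q n \<omega>) \<partial>M)" for n
  have a_le: "\<bar>a n\<bar> \<le> K * e n" for n
  proof -
    have "\<bar>a n\<bar> \<le> (\<integral>\<omega>. exp (- r * T n \<omega>) * K \<partial>M)"
      unfolding a_def
    proof (rule order_trans[OF integral_abs_bound integral_mono_AE])
      show "AE \<omega> in M. \<bar>exp (- r * T n \<omega>) * w (Q n \<omega>)\<bar> \<le> exp (- r * T n \<omega>) * K"
        using D(3) by eventually_elim (use w(2) in \<open>auto simp: abs_mult good_def\<close>)
    qed (use i_e k(2) in auto)
    then show ?thesis by (simp add: e_def mult.commute)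
  qed
  have i_flow: "integrable M (flow p)" by (rule bounded_int[of _ Kf]) (use Kf(2) p in auto)
  have sum_eq: "(\<Sum>i\<le>n. \<integral>\<omega>. h i \<omega> \<partial>M) = (\<integral>\<omega>. (\<Sum>i\<le>n. piece p i \<omega>) \<partial>M) + a n - w p" for n
  proof -
    have hh: "(\<integral>\<omega>. h i \<omega> \<partial>M) = (\<integral>\<omega>. piece p i \<omega> \<partial>M) + a i - (\<integral>\<omega>. exp (- r * start_time i \<omega>) * w (start p i \<omega>) \<partial>M)" for i
      unfolding h_def a_def k(1) using i_piece i_start k(3) by simp
    \<comment> \<open>Period \<open>i + 1\<close> starts at acquisition \<open>i\<close>, so only
      the last continuation value and the initial \<open>w p\<close> survive.\<close>
    have "(\<Sum>i\<le>n. a i - (\<integral>\<omega>. exp (- r * start_time i \<omega>) * w (start p i \<omega>) \<partial>M)) = a n - w p"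
      by (induction n) (simp_all add: start_def start_time_def a_def prob_space)
    then show ?thesis
      using i_piece by (simp add: hh add_diff_eq[symmetric] sum.distrib del: sum_subtractf)
  qed
  have flow_le: "(\<integral>\<omega>. flow p \<omega> \<partial>M) \<le> (\<integral>\<omega>. (\<Sum>i\<le>n. piece p i \<omega>) \<partial>M) + Kf * e n" for n
  proof -
    have "(\<integral>\<omega>. flow p \<omega> \<partial>M) \<le> (\<integral>\<omega>. (\<Sum>i\<le>n. piece p i \<omega>) + exp (- r * T n \<omega>) * Kf \<partial>M)"
    proof (rule integral_mono_AE)
      show "AE \<omega> in M. flow p \<omega> \<le> (\<Sum>i\<le>n. piece p i \<omega>) + exp (- r * T n \<omega>) * Kf"
        using D(3)
      proof eventually_elim
        fix \<omega> assume "good \<omega>"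
        from flow_pieces[OF Kf(2) this p, of n] show "flow p \<omega> \<le> (\<Sum>i\<le>n. piece p i \<omega>) + exp (- r * T n \<omega>) * Kf"
          by (simp add: abs_le_iff)
      qed
    qed (use i_flow i_piece i_e in auto)
    also have "\<dots> = (\<integral>\<omega>. (\<Sum>i\<le>n. piece p i \<omega>) \<partial>M) + Kf * e n"
      using i_piece i_e by (simp add: e_def mult.commute)
    finally show ?thesis .
  qed
  let ?tc = "total_cost c \<kappa> r lam0 lam1 p M F"
  have tc: "?tc = (\<Sum>i. \<integral>\<^sup>+\<omega>. cost i \<omega> \<partial>M)"
    by (simp add: total_cost_def cost_def pre_def)
  have partial: "ereal (\<Sum>i\<le>n. \<integral>\<omega>. h i \<omega> \<partial>M) \<le> enn2ereal ?tc" for n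
  proof -
    have "ereal (\<Sum>i\<le>n. \<integral>\<omega>. h i \<omega> \<partial>M) \<le> enn2ereal (\<Sum>i\<le>n. \<integral>\<^sup>+\<omega>. cost i \<omega> \<partial>M)"
    proof (induction n)
      case 0
      then show ?case using cost_ge[of 0] by simp
    next
      case (Suc n)
      then show ?case using add_mono[OF Suc cost_ge[of "Suc n"]] by (simp add: plus_ennreal.rep_eq)
    qed
    also have "\<dots> \<le> enn2ereal ?tc"
      unfolding less_eq_ennreal.rep_eq[symmetric] tc by (rule sum_le_suminf) auto
    finally show ?thesis .
  qed
  show ?thesis
  proof (cases "enn2ereal ?tc")
    case (real t)
    have "(\<integral>\<omega>. flow p \<omega> \<partial>M) - w p - t \<le> (K + Kf) * e n" for n
    proof -
      have "(\<Sum>i\<le>n. \<integral>\<omega>. h i \<omega> \<partial>M) \<le> t" using partial[of n] real by simp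
      then show ?thesis using sum_eq[of n] flow_le[of n] a_le[of n] by (simp add: algebra_simps abs_le_iff)
    qed
    moreover have "(\<lambda>n. (K + Kf) * e n) \<longlonglongrightarrow> (K + Kf) * 0" by (intro tendsto_intros e_lim)
    ultimately have "(\<integral>\<omega>. flow p \<omega> \<partial>M) - w p - t \<le> (K + Kf) * 0"
      by (intro LIMSEQ_le_const) auto
    then show ?thesis unfolding payoff_def real by simp
  next
    case PInf
    then show ?thesis unfolding payoff_def by simp
  next
    case MInf
    then show ?thesis using enn2ereal_nonneg[of ?tc] by simp
  qed
qed

text \<open>Composing \<open>w\<close> with \<open>clip\<close> extends it to a Borel function on
  the line without changing the operator, which sees only values on the unit interval.\<close>

lemma verification:
  assumes w: "w \<in> borel_measurable PostM" "\<forall>q\<in>{0..1}. \<bar>w q\<bar> \<le> K" "\<forall>q\<in>{0..1}. brhs w q \<le> ereal (w q)"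
    and p: "p \<in> {0..1}" and pol: "policy lam0 lam1 p M F"
  shows "payoff' p M F \<le> ereal (w p)"
proof -
  let ?w = "\<lambda>q. w (clip q)"
  have eq: "\<forall>q\<in>{0..1}. ?w q = w q" by (simp add: clip_id)
  have "payoff' p M F \<le> ereal (?w p)"
  proof (rule verification_borel[OF _ _ _ p pol])
    show "?w \<in> borel_measurable borel" by (rule measurable_compose[OF clip_measurable w(1)])
    show "\<forall>q\<in>{0..1}. \<bar>?w q\<bar> \<le> K" using w(2) eq by simp
    show "\<forall>q\<in>{0..1}. brhs ?w q \<le> ereal (?w q)" using w(3) eq brhs_cong[OF eq] by simp
  qed
  then show ?thesis using p by (simp add: clip_id)
qed

section \<open>Finitely supported policies\<close>

text \<open>Almost sure conditions become conditions at every point of a finite support. The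
  condition \<open>0 < T 0 \<omega>\<close> leaves room for an acquisition in front: after
  prepending one, times still increase strictly.\<close>

definition "finite_policy p \<mu> F \<longleftrightarrow> finite (set_pmf \<mu>) \<and>
   (\<forall>\<omega>\<in>set_pmf \<mu>. good \<omega> \<and> 0 < T 0 \<omega> \<and> (\<forall>i. F i \<omega> \<in> bayes_plausible (pre p i \<omega>))) \<and>
   (\<forall>i. F i \<in> measurable (info_alg i) (subprob_algebra PostM)) \<and>
   (\<forall>i. \<forall>A\<in>sets (info_alg i). \<forall>B\<in>sets PostM.
     (\<integral>\<^sup>+\<omega>. indicator A \<omega> * indicator B (Q i \<omega>) \<partial>measure_pmf \<mu>) = (\<integral>\<^sup>+\<omega>. indicator A \<omega> * emeasure (F i \<omega>) B \<partial>measure_pmf \<mu>))"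

text \<open>A pmf carries the power set as its sigma-algebra, whereas the law of a policy lives on
  the product sigma-algebra of \<open>Omega\<close>.\<close>

definition law :: "outcome pmf \<Rightarrow> outcome measure" where
  "law \<mu> = distr (measure_pmf \<mu>) Omega (\<lambda>\<omega>. \<omega>)"

lemma id_pmf_Omega: "(\<lambda>\<omega>. \<omega>) \<in> measurable (measure_pmf \<mu>) Omega"
  by (simp add: measurable_def)

lemma sets_law [measurable_cong, simp]: "sets (law \<mu>) = sets Omega"
  by (simp add: law_def)

lemma prob_space_law: "prob_space (law \<mu>)"
  unfolding law_def by (rule measure_pmf.prob_space_distr[OF id_pmf_Omega])

lemma singleton_Omega: "{\<omega>} \<in> sets Omega"
proof -
  have "{\<omega>} = PiE UNIV (\<lambda>i. {\<omega> i})" by (auto simp: PiE_def extensional_def)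
  also have "\<dots> \<in> sets Omega" unfolding Omega_def by (rule sets_PiM_I_countable) auto
  finally show ?thesis .
qed

text \<open>Singletons are measurable in a countable product, so the countable support is a
  measurable set of full measure.\<close>

lemma AE_law: assumes "\<And>\<omega>. \<omega> \<in> set_pmf \<mu> \<Longrightarrow> P \<omega>" shows "AE \<omega> in law \<mu>. P \<omega>"
proof -
  have "set_pmf \<mu> = (\<Union>\<omega>\<in>set_pmf \<mu>. {\<omega>})" by blast
  also have "\<dots> \<in> sets Omega"
    by (rule sets.countable_UN'[OF countable_set_pmf]) (use singleton_Omega in auto)
  finally have [measurable]: "set_pmf \<mu> \<in> sets Omega" .
  have "AE \<omega> in law \<mu>. \<omega> \<in> set_pmf \<mu>"
    unfolding law_def by (subst AE_distr_iff[OF id_pmf_Omega]) (auto simp: AE_measure_pmf)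
  then show ?thesis by eventually_elim (rule assms)
qed

lemma finite_policy_policy:
  assumes d: "finite_policy p \<mu> F"
  shows "policy lam0 lam1 p (law \<mu>) F"
  unfolding policy_def
proof (intro conjI allI ballI)
  show "prob_space (law \<mu>)" by (rule prob_space_law)
  show "AE \<omega> in law \<mu>. 0 \<le> T 0 \<omega> \<and> (\<forall>i. T i \<omega> < T (Suc i) \<omega>) \<and> filterlim (\<lambda>i. T i \<omega>) at_top sequentially \<and> (\<forall>i. Q i \<omega> \<in> {0..1})"
    by (rule AE_law) (use d in \<open>auto simp: finite_policy_def good_def\<close>)
  show "AE \<omega> in law \<mu>. \<forall>i. F i \<omega> \<in> bayes_plausible (pre_belief lam0 lam1 p i \<omega>)"
    by (rule AE_law) (use d in \<open>auto simp: finite_policy_def pre_def\<close>)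
  show Fm: "F i \<in> measurable (info_alg i) (subprob_algebra PostM)" for i using d by (simp add: finite_policy_def)
  fix i A B assume A: "A \<in> sets (info_alg i)" and B: "B \<in> sets PostM"
  have A' [measurable]: "A \<in> sets Omega"
    using measurable_sets[OF info_alg_subset A] by simp
  have [measurable]: "B \<in> sets borel" using B unfolding PostM_def by (subst (asm) sets_restrict_space_iff; auto)+
  have sub: "subprob_space (F i \<omega>)" for \<omega>
    using measurable_space[OF Fm, of \<omega>] by (simp add: space_subprob_algebra)
  have [measurable]: "(\<lambda>\<omega>. measure (F i \<omega>) B) \<in> borel_measurable Omega"
    by (rule measurable_compose[OF measurable_compose[OF info_alg_subset Fm] measurable_measure_subprob_algebra[OF B]])
  have "emeasure (law \<mu>) (A \<inter> {\<omega>\<in>space (law \<mu>). Q i \<omega> \<in> B}) = (\<integral>\<^sup>+\<omega>. indicator (A \<inter> {\<omega>\<in>space (law \<mu>). Q i \<omega> \<in> B}) \<omega> \<partial>law \<mu>)"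
    by (rule nn_integral_indicator[symmetric]) measurable
  also have "\<dots> = (\<integral>\<^sup>+\<omega>. indicator A \<omega> * indicator B (Q i \<omega>) \<partial>law \<mu>)"
    by (intro nn_integral_cong) (auto simp: indicator_def law_def)
  also have "\<dots> = (\<integral>\<^sup>+\<omega>. indicator A \<omega> * indicator B (Q i \<omega>) \<partial>measure_pmf \<mu>)"
    unfolding law_def by (rule nn_integral_distr[OF id_pmf_Omega]) measurable
  also have "\<dots> = (\<integral>\<^sup>+\<omega>. indicator A \<omega> * emeasure (F i \<omega>) B \<partial>measure_pmf \<mu>)"
    using d A B by (simp add: finite_policy_def)
  also have "\<dots> = (\<integral>\<^sup>+\<omega>. ennreal (indicator A \<omega> * measure (F i \<omega>) B) \<partial>measure_pmf \<mu>)"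
    by (intro nn_integral_cong)
       (simp add: indicator_def finite_measure.emeasure_eq_measure[OF subprob_space.axioms(1)[OF sub]])
  also have "\<dots> = (\<integral>\<^sup>+\<omega>. ennreal (indicator A \<omega> * measure (F i \<omega>) B) \<partial>law \<mu>)"
    unfolding law_def by (rule nn_integral_distr[OF id_pmf_Omega, symmetric]) measurable
  finally have E: "emeasure (law \<mu>) (A \<inter> {\<omega>\<in>space (law \<mu>). Q i \<omega> \<in> B}) = (\<integral>\<^sup>+\<omega>. ennreal (indicator A \<omega> * measure (F i \<omega>) B) \<partial>law \<mu>)" .
  have "(\<integral>\<omega>. indicator A \<omega> * measure (F i \<omega>) B \<partial>law \<mu>) = enn2real (\<integral>\<^sup>+\<omega>. ennreal (indicator A \<omega> * measure (F i \<omega>) B) \<partial>law \<mu>)"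
  proof (rule integral_eq_nn_integral)
    have "(\<lambda>\<omega>. indicator A \<omega> * measure (F i \<omega>) B) \<in> borel_measurable Omega" by measurable
    then show "(\<lambda>\<omega>. indicator A \<omega> * measure (F i \<omega>) B) \<in> borel_measurable (law \<mu>)"
      by (simp add: measurable_cong_sets[OF sets_law refl])
  qed simp
  then show "measure (law \<mu>) (A \<inter> {\<omega> \<in> space (law \<mu>). Q i \<omega> \<in> B}) = (\<integral>\<omega>. indicator A \<omega> * measure (F i \<omega>) B \<partial>law \<mu>)"
    unfolding measure_def[of "law \<mu>"] E ..
qed simp

section \<open>Costs and values of finitely supported policies\<close>

definition "stage_cost p F i \<omega> = ennreal (exp (- r * T i \<omega>)) * e2ennreal (ups_cost c (F i \<omega>) (pre p i \<omega>) + ereal \<kappa>)"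
definition "path_cost p F \<omega> = (\<Sum>i. stage_cost p F i \<omega>)"

text \<open>Passing from the pmf to its law on \<open>Omega\<close> enlarges no integral, by
  \<open>nn_integral_distr_le\<close>. An upper bound suffices, since finite policies are only used
  to bound the value from below.\<close>

lemma total_cost_law_le: "total_cost c \<kappa> r lam0 lam1 p (law \<mu>) F \<le> (\<integral>\<^sup>+\<omega>. path_cost p F \<omega> \<partial>measure_pmf \<mu>)"
proof -
  have "total_cost c \<kappa> r lam0 lam1 p (law \<mu>) F = (\<Sum>i. \<integral>\<^sup>+\<omega>. stage_cost p F i \<omega> \<partial>law \<mu>)"
    by (simp add: total_cost_def stage_cost_def pre_def)
  also have "\<dots> \<le> (\<Sum>i. \<integral>\<^sup>+\<omega>. stage_cost p F i \<omega> \<partial>measure_pmf \<mu>)"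
    unfolding law_def by (intro suminf_le nn_integral_distr_le[OF id_pmf_Omega]) auto
  also have "\<dots> = (\<integral>\<^sup>+\<omega>. path_cost p F \<omega> \<partial>measure_pmf \<mu>)"
    unfolding path_cost_def by (rule nn_integral_suminf[symmetric]) simp
  finally show ?thesis .
qed

text \<open>The number \<open>k\<close> is an upper bound for the expected cost and not the cost
  itself. Thus \<open>z\<close> is always real and costs have to be estimated from above
  only.\<close>

definition "finite_value p z \<longleftrightarrow> (\<exists>\<mu> F k. finite_policy p \<mu> F \<and> 0 \<le> k \<and> (\<integral>\<^sup>+\<omega>. path_cost p F \<omega> \<partial>measure_pmf \<mu>) \<le> ennreal k \<and>
    z = measure_pmf.expectation \<mu> (flow p) - k)"

lemma finite_value_le_payoff:
  assumes "finite_value p z"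
  obtains M F where "policy lam0 lam1 p M F" "ereal z \<le> payoff' p M F"
proof -
  obtain \<mu> F k where d: "finite_policy p \<mu> F" "0 \<le> k" "(\<integral>\<^sup>+\<omega>. path_cost p F \<omega> \<partial>measure_pmf \<mu>) \<le> ennreal k"
    "z = measure_pmf.expectation \<mu> (flow p) - k" using assms unfolding finite_value_def by blast
  let ?tc = "total_cost c \<kappa> r lam0 lam1 p (law \<mu>) F"
  have "?tc \<le> ennreal k" using total_cost_law_le[of p \<mu> F] d(3) by (rule order_trans)
  then have le: "enn2ereal ?tc \<le> ereal k" unfolding less_eq_ennreal.rep_eq using d(2) by (simp add: enn2ereal_ennreal)
  have "(\<integral>\<omega>. flow p \<omega> \<partial>law \<mu>) = measure_pmf.expectation \<mu> (flow p)"
    unfolding law_def by (rule integral_distr[OF id_pmf_Omega flow_measurable])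
  then have "ereal z \<le> payoff' p (law \<mu>) F"
    unfolding payoff_def using le d(4) enn2ereal_nonneg[of ?tc] by (cases "enn2ereal ?tc") auto
  then show thesis using that finite_policy_policy[OF d(1)] by blast
qed

lemma vh_super: "\<forall>q\<in>{0..1}. brhs vh q \<le> ereal (vh q)"
proof
  fix q :: real assume q: "q \<in> {0..1}"
  show "brhs vh q \<le> ereal (vh q)" unfolding brhs_le_iff[OF q]
  proof (intro allI impI ballI)
    fix \<tau> F assume t: "0 \<le> \<tau>" and F: "F \<in> bayes_plausible (dr q \<tau>)"
    have "0 \<le> exp (- r * \<tau>) * \<kappa>" using kappa by simp
    then show "bell vh q \<tau> F \<le> vh q" using bell_vh[OF q t F, of 0] by simp
  qed
qed

lemma payoff_le_vh: "p \<in> {0..1} \<Longrightarrow> policy lam0 lam1 p M F \<Longrightarrow> payoff' p M F \<le> ereal (vh p)"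
proof -
  obtain L where L: "L > 0" "\<forall>q\<in>{0..1}. \<bar>vh q\<bar> \<le> L" using vh_bound by auto
  show "p \<in> {0..1} \<Longrightarrow> policy lam0 lam1 p M F \<Longrightarrow> payoff' p M F \<le> ereal (vh p)"
    by (rule verification[OF vh_measurable L(2) vh_super])
qed

lemma finite_value_le_vh:
  assumes p: "p \<in> {0..1}" and z: "finite_value p z"
  shows "z \<le> vh p"
proof -
  obtain M F where "policy lam0 lam1 p M F" "ereal z \<le> payoff' p M F" using finite_value_le_payoff[OF z] by blast
  then have "ereal z \<le> ereal (vh p)" using payoff_le_vh[OF p] order_trans by blast
  then show ?thesis by simp
qed

lemma emeasure_split_post:
  assumes "x \<in> {0..1}" "y \<in> {0..1}" "\<alpha> \<in> {0..1}" and B: "B \<in> sets PostM"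
  shows "emeasure (split_post x y \<alpha>) B = ennreal \<alpha> * indicator B x + ennreal (1 - \<alpha>) * indicator B y"
proof -
  have "emeasure (split_post x y \<alpha>) B = (\<integral>\<^sup>+q. indicator B q \<partial>split_post x y \<alpha>)"
    using B by (simp add: split_post_def)
  also have "\<dots> = (\<integral>\<^sup>+b. indicator B (if b then x else y) \<partial>measure_pmf (bernoulli_pmf \<alpha>))"
    unfolding split_post_def by (rule nn_integral_distr[OF split_post_measurable]) (use assms in auto)
  also have "\<dots> = ennreal \<alpha> * indicator B x + ennreal (1 - \<alpha>) * indicator B y"
    using assms by (simp add: mult.commute)
  finally show ?thesis .
qed

lemma split_post_subprob: "x \<in> {0..1} \<Longrightarrow> y \<in> {0..1} \<Longrightarrow> split_post x y \<alpha> \<in> space (subprob_algebra PostM)"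
  using measure_pmf.prob_space_distr[OF split_post_measurable, of x y \<alpha>]
  by (auto simp: space_subprob_algebra split_post_def intro: prob_space_imp_subprob_space)

text \<open>Runs the uninformative experiment at the times \<open>L\<close>, \<open>2 * L\<close>
  and so on, because a policy must keep acquiring. Beliefs just drift, and the fixed costs form a
  geometric series that vanishes as \<open>L\<close> grows.\<close>

lemma finite_value_no_info:
  assumes p: "p \<in> {0..1}" and L: "L > 0"
  shows "finite_value p (vl p - \<kappa> * (exp (- r * L) / (1 - exp (- r * L))))"
proof -
  define s where "s i = real (Suc i) * L" for i
  define \<omega> :: outcome where "\<omega> = (\<lambda>i. (s i, dr p (s i)))"
  define F :: "nat \<Rightarrow> outcome \<Rightarrow> real measure" where "F i = (\<lambda>_. split_post (dr p (s i)) (dr p (s i)) 1)" for i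
  have s: "s i > 0" "s i < s (Suc i)" for i using L by (simp_all add: s_def)
  have TQ: "T i \<omega> = s i" "Q i \<omega> = dr p (s i)" for i by (simp_all add: T_def Q_def \<omega>_def)
  have qI: "dr p (s i) \<in> {0..1}" for i using drift_in[OF p] s(1)[of i] by simp
  have lim: "filterlim s at_top sequentially"
    unfolding s_def using L
    by (intro filterlim_at_top_mult_tendsto_pos[OF tendsto_const] filterlim_compose[OF filterlim_real_sequentially filterlim_Suc])
  have g: "good \<omega>"
    unfolding good_def TQ using s qI lim by (auto intro: less_imp_le)
  have pre: "pre p i \<omega> = dr p (s i)" for i
    unfolding pre_eq by (cases i) (auto simp: start_def start_time_def TQ drift_add)
  have d: "finite_policy p (return_pmf \<omega>) F"
    unfolding finite_policy_def
  proof (intro conjI allI ballI)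
    fix \<omega>' assume "\<omega>' \<in> set_pmf (return_pmf \<omega>)"
    then have [simp]: "\<omega>' = \<omega>" by simp
    show "good \<omega>'" "0 < T 0 \<omega>'" using g s TQ by auto
    show "F i \<omega>' \<in> bayes_plausible (pre p i \<omega>')" for i
      unfolding F_def using qI by (auto simp: pre intro!: split_post_plausible)
  next
    fix i show "F i \<in> info_alg i \<rightarrow>\<^sub>M subprob_algebra PostM"
      unfolding F_def by (intro measurable_const split_post_subprob qI)
    fix A B assume "A \<in> sets (info_alg i)" and B: "B \<in> sets PostM"
    show "(\<integral>\<^sup>+\<omega>'. indicator A \<omega>' * indicator B (Q i \<omega>') \<partial>measure_pmf (return_pmf \<omega>)) 
      = (\<integral>\<^sup>+\<omega>'. indicator A \<omega>' * emeasure (F i \<omega>') B \<partial>measure_pmf (return_pmf \<omega>))"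
      by (simp add: F_def emeasure_split_post[OF qI qI _ B] TQ)
  qed simp
  let ?e = "exp (- r * L)"
  have e: "0 < ?e" "?e < 1" using r L by auto
  have es: "exp (- r * s i) = ?e * ?e ^ i" for i
  proof -
    have "- r * s i = real (Suc i) * (- r * L)" by (simp add: s_def)
    then show ?thesis by (simp only: exp_of_nat_mult power_Suc)
  qed
  have sc: "stage_cost p F i \<omega> = ennreal (\<kappa> * (?e * ?e ^ i))" for i
    unfolding stage_cost_def pre TQ es F_def ups_cost_split_post_diag[OF qI]
  proof -
    have "e2ennreal (0 + ereal \<kappa>) = ennreal \<kappa>" by (simp add: e2ennreal_ereal)
    moreover have "ennreal (?e * ?e ^ i) * ennreal \<kappa> = ennreal ((?e * ?e ^ i) * \<kappa>)"
      using kappa e by (intro ennreal_mult[symmetric]) auto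
    ultimately show "ennreal (?e * ?e ^ i) * e2ennreal (0 + ereal \<kappa>) = ennreal (\<kappa> * (?e * ?e ^ i))"
      by (simp only: mult.commute)
  qed
  have sm: "(\<lambda>i. \<kappa> * (?e * ?e ^ i)) sums (\<kappa> * (?e * (1 / (1 - ?e))))"
    by (rule sums_mult[OF sums_mult[OF geometric_sums]]) (use e in simp)
  have pc: "path_cost p F \<omega> = ennreal (\<kappa> * (?e / (1 - ?e)))"
  proof -
    have "path_cost p F \<omega> = ennreal (\<Sum>i. \<kappa> * (?e * ?e ^ i))"
      unfolding path_cost_def sc by (rule suminf_ennreal2) (use kappa e sums_summable[OF sm] in simp_all)
    then show ?thesis unfolding sums_unique[OF sm, symmetric] by simp
  qed
  have "bpath p \<omega> t = dr p t" if "0 \<le> t" for t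
    by (simp add: belief_path_def Let_def TQ drift_add)
  then have fl: "flow p \<omega> = vl p"
    unfolding flow_eq vl_def disc_def by (intro set_lebesgue_integral_cong) auto
  show ?thesis
    unfolding finite_value_def
    by (rule exI[of _ "return_pmf \<omega>"], rule exI[of _ F], rule exI[of _ "\<kappa> * (?e / (1 - ?e))"])
       (use d pc fl kappa e in simp)
qed

section \<open>Prepending an acquisition to finite policies\<close>

lemma info_coord_measurable:
  assumes "j < i"
  shows "T j \<in> borel_measurable (info_alg i)" "Q j \<in> borel_measurable (info_alg i)"
proof -
  have "(\<lambda>\<omega>. restrict \<omega> {..<i} j) \<in> measurable (info_alg i) (borel :: (real \<times> real) measure)"
    using measurable_compose[OF measurable_compose[OF info_map_measurable' measurable_fst] measurable_component_singleton, of j i] assms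
    by simp
  then have *: "(\<lambda>\<omega>. \<omega> j) \<in> measurable (info_alg i) (borel :: (real \<times> real) measure)" using assms by simp
  show "T j \<in> borel_measurable (info_alg i)" "Q j \<in> borel_measurable (info_alg i)"
    unfolding T_def[abs_def] Q_def[abs_def]
    by (rule measurable_compose[OF *], auto intro!: borel_measurable_continuous_onI continuous_intros)+
qed

lemma Pair_borel: "f \<in> borel_measurable M \<Longrightarrow> g \<in> borel_measurable M \<Longrightarrow> (\<lambda>\<omega>. (f \<omega>, g \<omega>)) \<in> measurable M (borel :: (real \<times> real) measure)"
  by (rule borel_measurable_Pair)

text \<open>What is known just before acquisition \<open>i\<close> of the continuation is known just
  before acquisition \<open>i + 1\<close> of the whole outcome. This makes continuation kernels
  adapted; \<open>cons_info\<close> is the counterpart that pulls events back to the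
  continuation.\<close>

lemma shift_info: "shift \<tau> \<in> measurable (info_alg (Suc i)) (info_alg i)"
  unfolding info_alg_def[of i]
proof (rule measurable_vimage_algebra2)
  show "(\<lambda>\<omega>. (restrict (shift \<tau> \<omega>) {..<i}, T i (shift \<tau> \<omega>))) \<in> info_alg (Suc i) \<rightarrow>\<^sub>M Pi\<^sub>M {..<i} (\<lambda>_. borel) \<Otimes>\<^sub>M borel"
  proof (rule measurable_Pair)
    show "(\<lambda>\<omega>. restrict (shift \<tau> \<omega>) {..<i}) \<in> info_alg (Suc i) \<rightarrow>\<^sub>M Pi\<^sub>M {..<i} (\<lambda>_. borel)"
      unfolding shift_def
      by (rule measurable_restrict, rule Pair_borel) (auto intro!: borel_measurable_diff info_coord_measurable)
    show "(\<lambda>\<omega>. T i (shift \<tau> \<omega>)) \<in> borel_measurable (info_alg (Suc i))"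
      unfolding T_shift using T_info_measurable[of "Suc i"] by simp
  qed
qed simp

lemma cons_info: "cons \<tau> q \<in> measurable (info_alg i) (info_alg (Suc i))"
  unfolding info_alg_def[of "Suc i"]
proof (rule measurable_vimage_algebra2)
  show "(\<lambda>\<omega>. (restrict (cons \<tau> q \<omega>) {..<Suc i}, T (Suc i) (cons \<tau> q \<omega>))) \<in> info_alg i \<rightarrow>\<^sub>M Pi\<^sub>M {..<Suc i} (\<lambda>_. borel) \<Otimes>\<^sub>M borel"
  proof (rule measurable_Pair)
    have "(\<lambda>\<omega>. cons \<tau> q \<omega> j) \<in> measurable (info_alg i) borel" if "j < Suc i" for j
      using that unfolding cons_def by (cases j) (auto intro!: Pair_borel borel_measurable_add info_coord_measurable)
    then show "(\<lambda>\<omega>. restrict (cons \<tau> q \<omega>) {..<Suc i}) \<in> info_alg i \<rightarrow>\<^sub>M Pi\<^sub>M {..<Suc i} (\<lambda>_. borel)"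
      by (intro measurable_restrict) auto
    show "(\<lambda>\<omega>. T (Suc i) (cons \<tau> q \<omega>)) \<in> borel_measurable (info_alg i)"
      unfolding T_cons using T_info_measurable[of i] by simp
  qed
qed simp

text \<open>Before the first acquisition only its time is known, and that is \<tau> on both
  outcomes.\<close>

lemma info_alg_0_cons:
  assumes "A \<in> sets (info_alg 0)"
  shows "cons \<tau> q \<omega> \<in> A \<longleftrightarrow> cons \<tau> q' \<omega>' \<in> A"
proof -
  have "(\<lambda>\<omega>. (restrict \<omega> {..<0}, T 0 \<omega>)) \<in> space Omega \<rightarrow> space (Pi\<^sub>M {..<0} (\<lambda>_. borel :: (real \<times> real) measure) \<Otimes>\<^sub>M borel)"
    using measurable_space[OF info_map_measurable[of 0]] by auto
  from sets_vimage_algebra2[OF this] assms obtain A' where "A = (\<lambda>\<omega>. (restrict \<omega> {..<0}, T 0 \<omega>)) -` A' \<inter> space Omega"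
    unfolding info_alg_def by auto
  then show ?thesis by (simp add: restrict_def)
qed

lemma good_cons:
  assumes "good \<omega>" "0 < T 0 \<omega>" "0 \<le> \<tau>" "q \<in> {0..1}"
  shows "good (cons \<tau> q \<omega>)"
  unfolding good_def
proof (intro conjI allI)
  have "filterlim (\<lambda>i. \<tau> + T i \<omega>) at_top sequentially"
    using assms(1) by (intro filterlim_tendsto_add_at_top[OF tendsto_const]) (simp add: good_def)
  then have "filterlim (\<lambda>i. T (Suc i) (cons \<tau> q \<omega>)) at_top sequentially" by simp
  then show "filterlim (\<lambda>i. T i (cons \<tau> q \<omega>)) at_top sequentially"
    by (rule filterlim_sequentially_Suc[THEN iffD1])
  show "T i (cons \<tau> q \<omega>) < T (Suc i) (cons \<tau> q \<omega>)" for i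
    using assms by (cases i) (auto simp: good_def)
  show "Q i (cons \<tau> q \<omega>) \<in> {0..1}" for i
    using assms by (cases i) (auto simp: good_def)
qed (use assms in simp)

lemma pre_cons: "pre p 0 (cons \<tau> q \<omega>) = dr p \<tau>" "pre p (Suc i) (cons \<tau> q \<omega>) = pre q i \<omega>"
  using pre_shift[of "cons \<tau> q \<omega>" i p] by (simp_all add: pre_eq start_def start_time_def)

text \<open>Wait until \<tau>, split into \<open>x\<close> and \<open>y\<close>, and follow a given
  finite policy from the realized posterior. The branch is read off from \<open>Q 0\<close>, which
  keeps the kernels adapted. Flow and cost of the continuation are those of the chosen policy,
  discounted by \<tau>.\<close>

lemma finite_value_split:
  assumes p: "p \<in> {0..1}" and t: "0 < \<tau>" and xy: "x \<in> {0..1}" "y \<in> {0..1}" and al: "\<alpha> \<in> {0..1}"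
    and mean: "\<alpha> * x + (1 - \<alpha>) * y = dr p \<tau>" and C: "0 \<le> C" "ups_cost c (split_post x y \<alpha>) (dr p \<tau>) \<le> ereal C"
    and z: "finite_value x (z x)" "finite_value y (z y)"
  shows "finite_value p (flow_until p \<tau> + exp (- r * \<tau>) * (\<alpha> * z x + (1 - \<alpha>) * z y - C - \<kappa>))"
proof -
  \<comment> \<open>Policies are chosen per posterior and not per branch: for \<open>x = y\<close>
    the observed posterior does not reveal the branch, and both must continue alike.\<close>
  have "\<forall>q\<in>{x, y}. \<exists>w. case w of (\<mu>, G, k) \<Rightarrow> finite_policy q \<mu> G \<and> 0 \<le> k \<and> (\<integral>\<^sup>+\<omega>. path_cost q G \<omega> \<partial>measure_pmf \<mu>) \<le> ennreal k \<and>
    z q = measure_pmf.expectation \<mu> (flow q) - k"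
    using z unfolding finite_value_def by auto
  from bchoice[OF this] obtain W where W: "\<forall>q\<in>{x, y}. case W q of (\<mu>, G, k) \<Rightarrow> finite_policy q \<mu> G \<and> 0 \<le> k \<and> (\<integral>\<^sup>+\<omega>. path_cost q G \<omega> \<partial>measure_pmf \<mu>) \<le> ennreal k \<and>
    z q = measure_pmf.expectation \<mu> (flow q) - k" by blast
  define m where "m q = fst (W q)" for q
  define G where "G q = fst (snd (W q))" for q
  define k where "k q = snd (snd (W q))" for q
  have mGk: "finite_policy q (m q) (G q)" "0 \<le> k q" "(\<integral>\<^sup>+\<omega>. path_cost q (G q) \<omega> \<partial>measure_pmf (m q)) \<le> ennreal (k q)"
    "z q = measure_pmf.expectation (m q) (flow q) - k q" if "q \<in> {x, y}" for q
    using W[rule_format, OF that] by (auto simp: m_def G_def k_def case_prod_beta)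
  define \<mu> where "\<mu> = bind_pmf (bernoulli_pmf \<alpha>) (\<lambda>b. let q = if b then x else y in map_pmf (cons \<tau> q) (m q))"
  define F where "F i = (case i of 0 \<Rightarrow> (\<lambda>_. split_post x y \<alpha>) 
    | Suc j \<Rightarrow> (\<lambda>\<omega>. if Q 0 \<omega> = x then G x j (shift \<tau> \<omega>) else G y j (shift \<tau> \<omega>)))" for i
  have F0: "F 0 \<omega> = split_post x y \<alpha>" for \<omega> by (simp add: F_def)
  have FS: "F (Suc i) (cons \<tau> q \<omega>) = G q i \<omega>" if "q \<in> {x, y}" for i q \<omega>
    using that by (auto simp: F_def)
  have nn: "(\<integral>\<^sup>+\<omega>. f \<omega> \<partial>measure_pmf \<mu>) = ennreal \<alpha> * (\<integral>\<^sup>+\<omega>. f (cons \<tau> x \<omega>) \<partial>measure_pmf (m x)) 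
      + ennreal (1 - \<alpha>) * (\<integral>\<^sup>+\<omega>. f (cons \<tau> y \<omega>) \<partial>measure_pmf (m y))" for f
    unfolding \<mu>_def using al by (simp add: mult.commute Let_def)
  have fin: "finite (set_pmf (m q))" if "q \<in> {x, y}" for q using mGk(1)[OF that] by (simp add: finite_policy_def)
  have supp: "\<exists>q\<in>{x, y}. \<exists>\<omega>'\<in>set_pmf (m q). \<omega> = cons \<tau> q \<omega>'" if "\<omega> \<in> set_pmf \<mu>" for \<omega>
    using that unfolding \<mu>_def by (auto simp: Let_def split: if_splits)
  have xyI: "q \<in> {0..1}" if "q \<in> {x, y}" for q using xy that by auto
  have good': "good (cons \<tau> q \<omega>)" if "q \<in> {x, y}" "\<omega> \<in> set_pmf (m q)" for q \<omega>
    using mGk(1)[OF that(1)] that(2) t xyI[OF that(1)] by (intro good_cons) (auto simp: finite_policy_def)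
  have d: "finite_policy p \<mu> F"
    unfolding finite_policy_def
  proof (intro conjI allI ballI)
    show "finite (set_pmf \<mu>)" unfolding \<mu>_def using fin by (auto simp: Let_def)
  next
    fix \<omega> assume "\<omega> \<in> set_pmf \<mu>"
    then obtain q \<omega>' where q: "q \<in> {x, y}" "\<omega>' \<in> set_pmf (m q)" "\<omega> = cons \<tau> q \<omega>'" using supp by blast
    show "good \<omega>" "0 < T 0 \<omega>" using good'[OF q(1,2)] q(3) t by auto
    show "F i \<omega> \<in> bayes_plausible (pre p i \<omega>)" for i
    proof (cases i)
      case 0
      then show ?thesis using split_post_plausible[OF xy al mean] by (simp add: F0 q(3) pre_cons)
    next
      case (Suc j)
      then show ?thesis using mGk(1)[OF q(1)] q(2) by (simp add: FS[OF q(1)] q(3) pre_cons finite_policy_def)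
    qed
  next
    fix i
    show "F i \<in> info_alg i \<rightarrow>\<^sub>M subprob_algebra PostM"
    proof (cases i)
      case 0
      then show ?thesis by (simp add: F_def split_post_subprob[OF xy])
    next
      case (Suc j)
      have G: "(\<lambda>\<omega>. G q j (shift \<tau> \<omega>)) \<in> info_alg (Suc j) \<rightarrow>\<^sub>M subprob_algebra PostM" if "q \<in> {x, y}" for q
        using mGk(1)[OF that] by (intro measurable_compose[OF shift_info]) (simp add: finite_policy_def)
      have Q: "Q 0 \<in> borel_measurable (info_alg (Suc j))" by (rule info_coord_measurable) simp
      have "Q 0 -` {x} \<inter> space (info_alg (Suc j)) \<in> sets (info_alg (Suc j))" by (rule measurable_sets[OF Q]) simp
      then have "{\<omega>. Q 0 \<omega> = x} \<in> sets (info_alg (Suc j))" by (simp add: vimage_def)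
      show ?thesis unfolding Suc F_def nat.case
        by (rule measurable_If) (use G \<open>{\<omega>. Q 0 \<omega> = x} \<in> sets (info_alg (Suc j))\<close> in auto)
    qed
    fix A B assume A: "A \<in> sets (info_alg i)" and B: "B \<in> sets PostM"
    show "(\<integral>\<^sup>+\<omega>. indicator A \<omega> * indicator B (Q i \<omega>) \<partial>measure_pmf \<mu>) = (\<integral>\<^sup>+\<omega>. indicator A \<omega> * emeasure (F i \<omega>) B \<partial>measure_pmf \<mu>)"
    proof (cases i)
      case 0
      define I :: ennreal where "I = indicator A (cons \<tau> x (\<lambda>_. (0, 0)))"
      have I: "indicator A (cons \<tau> q \<omega>) = I" for q \<omega>
        unfolding I_def using info_alg_0_cons[of A \<tau> q \<omega> x "\<lambda>_. (0, 0)"] A 0 by (simp add: indicator_def)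
      have one: "ennreal \<alpha> + ennreal (1 - \<alpha>) = 1"
        using al by (simp flip: ennreal_plus)
      \<comment> \<open>Here \<open>a1\<close> and \<open>a2\<close> are the branch weights and
        \<open>I\<close> is the common value of the indicator on both branches. As the weights sum
        to 1, averaging the first kernel, which is the same on both branches, returns it.\<close>
      have alg: "a1 * (I * bx) + a2 * (I * by') = a1 * (I * (a1 * bx + a2 * by')) + a2 * (I * (a1 * bx + a2 * by'))"
        if "a1 + a2 = 1" for a1 a2 bx by' :: ennreal
      proof -
        have "a1 * (I * (a1 * bx + a2 * by')) + a2 * (I * (a1 * bx + a2 * by')) = (a1 + a2) * (I * (a1 * bx + a2 * by'))"
          by (rule distrib_right[symmetric])
        then show ?thesis using that by (simp add: distrib_left mult.left_commute)
      qed
      have const: "(\<integral>\<^sup>+\<omega>. v \<partial>measure_pmf M) = v" for v and M :: "outcome pmf"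
        by (simp add: measure_pmf.emeasure_space_1)
      show ?thesis unfolding 0 nn F0 I Q_cons emeasure_split_post[OF xy al B] const
        by (rule alg[OF one])
    next
      case (Suc j)
      have "(\<integral>\<^sup>+\<omega>. indicator A (cons \<tau> q \<omega>) * indicator B (Q j \<omega>) \<partial>measure_pmf (m q)) 
        = (\<integral>\<^sup>+\<omega>. indicator A (cons \<tau> q \<omega>) * emeasure (G q j \<omega>) B \<partial>measure_pmf (m q))" if q: "q \<in> {x, y}" for q
      proof -
        have "cons \<tau> q -` A \<inter> space (info_alg j) \<in> sets (info_alg j)"
          using measurable_sets[OF cons_info] A Suc by blast
        then have "cons \<tau> q -` A \<in> sets (info_alg j)" by simp
        then have "(\<integral>\<^sup>+\<omega>. indicator (cons \<tau> q -` A) \<omega> * indicator B (Q j \<omega>) \<partial>measure_pmf (m q)) 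
          = (\<integral>\<^sup>+\<omega>. indicator (cons \<tau> q -` A) \<omega> * emeasure (G q j \<omega>) B \<partial>measure_pmf (m q))"
          using mGk(1)[OF q] B unfolding finite_policy_def by blast
        then show ?thesis by (simp add: indicator_def)
      qed
      then show ?thesis unfolding Suc nn Q_cons by (simp add: FS)
    qed
  qed
  let ?e = "exp (- r * \<tau>)"
  have pc: "path_cost p F (cons \<tau> q \<omega>) \<le> ennreal (?e * (C + \<kappa>)) + ennreal ?e * path_cost q (G q) \<omega>" if q: "q \<in> {x, y}" for q \<omega>
  proof -
    have head: "path_cost p F (cons \<tau> q \<omega>) = (\<Sum>i. stage_cost p F (Suc i) (cons \<tau> q \<omega>)) + stage_cost p F 0 (cons \<tau> q \<omega>)"
      unfolding path_cost_def using suminf_offset[of "\<lambda>i. stage_cost p F i (cons \<tau> q \<omega>)" 1] by simp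
    have tail: "stage_cost p F (Suc i) (cons \<tau> q \<omega>) = ennreal ?e * stage_cost q (G q) i \<omega>" for i
    proof -
      have "ennreal (exp (- r * (\<tau> + T i \<omega>))) = ennreal ?e * ennreal (exp (- r * T i \<omega>))"
        by (simp only: distrib_left exp_add ennreal_mult' exp_ge_zero)
      then show ?thesis unfolding stage_cost_def FS[OF q] pre_cons T_cons by (simp only: mult.assoc)
    qed
    have "(\<Sum>i. ennreal ?e * stage_cost q (G q) i \<omega>) = ennreal ?e * path_cost q (G q) \<omega>"
      unfolding path_cost_def by simp
    moreover have "stage_cost p F 0 (cons \<tau> q \<omega>) \<le> ennreal (?e * (C + \<kappa>))"
    proof -
      have "ups_cost c (split_post x y \<alpha>) (dr p \<tau>) + ereal \<kappa> \<le> ereal (C + \<kappa>)"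
        using add_right_mono[OF C(2), of "ereal \<kappa>"] by simp
      then have "e2ennreal (ups_cost c (split_post x y \<alpha>) (dr p \<tau>) + ereal \<kappa>) \<le> ennreal (C + \<kappa>)"
        using e2ennreal_mono by (fastforce simp: e2ennreal_ereal)
      then show ?thesis unfolding stage_cost_def F0 pre_cons T_cons
        using C(1) kappa by (simp add: ennreal_mult' mult_left_mono)
    qed
    ultimately show ?thesis unfolding head tail by (simp add: add.commute add_left_mono)
  qed
  define K where "K = ?e * (C + \<kappa>) + ?e * (\<alpha> * k x + (1 - \<alpha>) * k y)"
  have K0: "0 \<le> ?e * (C + \<kappa>)" using C(1) kappa by simp
  have cost: "(\<integral>\<^sup>+\<omega>. path_cost p F \<omega> \<partial>measure_pmf \<mu>) \<le> ennreal K"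
  proof -
    have q: "(\<integral>\<^sup>+\<omega>. path_cost p F (cons \<tau> q \<omega>) \<partial>measure_pmf (m q)) \<le> ennreal (?e * (C + \<kappa>) + ?e * k q)" if q: "q \<in> {x, y}" for q
    proof -
      have "(\<integral>\<^sup>+\<omega>. path_cost p F (cons \<tau> q \<omega>) \<partial>measure_pmf (m q)) \<le> (\<integral>\<^sup>+\<omega>. ennreal (?e * (C + \<kappa>)) + ennreal ?e * path_cost q (G q) \<omega> \<partial>measure_pmf (m q))"
        by (intro nn_integral_mono pc q)
      also have "\<dots> = ennreal (?e * (C + \<kappa>)) + ennreal ?e * (\<integral>\<^sup>+\<omega>. path_cost q (G q) \<omega> \<partial>measure_pmf (m q))"
        by (simp add: nn_integral_add nn_integral_cmult measure_pmf.emeasure_space_1)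
      also have "\<dots> \<le> ennreal (?e * (C + \<kappa>)) + ennreal ?e * ennreal (k q)"
        using mGk(3)[OF q] by (intro add_left_mono mult_left_mono) auto
      also have "\<dots> = ennreal (?e * (C + \<kappa>) + ?e * k q)"
        using K0 mGk(2)[OF q] by (simp add: ennreal_mult')
      finally show ?thesis .
    qed
    have "(\<integral>\<^sup>+\<omega>. path_cost p F \<omega> \<partial>measure_pmf \<mu>) \<le> ennreal \<alpha> * ennreal (?e * (C + \<kappa>) + ?e * k x) + ennreal (1 - \<alpha>) * ennreal (?e * (C + \<kappa>) + ?e * k y)"
      unfolding nn by (intro add_mono mult_left_mono q) auto
    also have "\<dots> = ennreal (\<alpha> * (?e * (C + \<kappa>) + ?e * k x) + (1 - \<alpha>) * (?e * (C + \<kappa>) + ?e * k y))"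
      using al K0 mGk(2)[of x] mGk(2)[of y] by (subst ennreal_plus) (auto simp: ennreal_mult')
    also have "\<alpha> * (?e * (C + \<kappa>) + ?e * k x) + (1 - \<alpha>) * (?e * (C + \<kappa>) + ?e * k y) = K"
      unfolding K_def by (simp only: algebra_simps)
    finally show ?thesis .
  qed
  have flow_cons: "measure_pmf.expectation (m q) (\<lambda>\<omega>. flow p (cons \<tau> q \<omega>)) = flow_until p \<tau> + ?e * measure_pmf.expectation (m q) (flow q)"
    if q: "q \<in> {x, y}" for q
  proof -
    have int: "integrable (measure_pmf (m q)) f" for f :: "outcome \<Rightarrow> real"
      by (rule integrable_measure_pmf_finite[OF fin[OF q]])
    have "measure_pmf.expectation (m q) (\<lambda>\<omega>. flow p (cons \<tau> q \<omega>)) = measure_pmf.expectation (m q) (\<lambda>\<omega>. flow_until p \<tau> + ?e * flow q \<omega>)"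
      using flow_shift[OF good'[OF q] p] by (intro integral_cong_AE) (auto intro!: AE_pmfI)
    then show ?thesis by (simp add: int)
  qed
  have "measure_pmf.expectation \<mu> (flow p) = \<alpha> * measure_pmf.expectation (m x) (\<lambda>\<omega>. flow p (cons \<tau> x \<omega>)) 
     + (1 - \<alpha>) * measure_pmf.expectation (m y) (\<lambda>\<omega>. flow p (cons \<tau> y \<omega>))"
    unfolding \<mu>_def
    by (subst pmf_expectation_bind[of UNIV]) (use al fin in \<open>auto simp: Let_def UNIV_bool\<close>)
  then have "measure_pmf.expectation \<mu> (flow p) - K = flow_until p \<tau> + ?e * (\<alpha> * z x + (1 - \<alpha>) * z y - C - \<kappa>)"
    unfolding flow_cons[of x, simplified] flow_cons[of y, simplified] mGk(4)[of x, simplified] mGk(4)[of y, simplified] K_def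
    by (simp add: algebra_simps)
  moreover have "0 \<le> K" unfolding K_def using K0 al mGk(2)[of x] mGk(2)[of y] by simp
  ultimately show ?thesis unfolding finite_value_def using d cost by metis
qed

section \<open>The value function\<close>

definition "v_fin p = Sup {z. finite_value p z}"

lemma finite_value_bdd: "p \<in> {0..1} \<Longrightarrow> bdd_above {z. finite_value p z}"
  by (rule bdd_aboveI[where M="vh p"]) (simp add: finite_value_le_vh)

lemma finite_value_nonempty: "p \<in> {0..1} \<Longrightarrow> {z. finite_value p z} \<noteq> {}"
  using finite_value_no_info[of p 1] by auto

lemma finite_value_le_v_fin: "p \<in> {0..1} \<Longrightarrow> finite_value p z \<Longrightarrow> z \<le> v_fin p"
  unfolding v_fin_def using finite_value_bdd by (intro cSup_upper) auto

lemma v_fin_le_vh: "p \<in> {0..1} \<Longrightarrow> v_fin p \<le> vh p"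
  unfolding v_fin_def using finite_value_nonempty finite_value_le_vh by (intro cSup_least) auto

lemma vl_le_v_fin:
  assumes p: "p \<in> {0..1}"
  shows "vl p \<le> v_fin p"
proof -
  have "\<forall>\<^sub>F L in at_top. vl p - \<kappa> * (exp (- r * L) / (1 - exp (- r * L))) \<le> v_fin p"
    by (rule eventually_mono[OF eventually_gt_at_top[of 0]]) (rule finite_value_le_v_fin[OF p finite_value_no_info[OF p]])
  moreover have "((\<lambda>L. vl p - \<kappa> * (exp (- r * L) / (1 - exp (- r * L)))) \<longlongrightarrow> vl p - \<kappa> * (0 / (1 - 0))) at_top"
    by (intro tendsto_intros exp_decay) simp
  ultimately have "vl p - \<kappa> * (0 / (1 - 0)) \<le> v_fin p"
    by (intro tendsto_upperbound) auto
  then show ?thesis by simp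
qed

text \<open>Near-optimal finite policies at \<open>x\<close> and \<open>y\<close> are plugged into
  \<open>finite_value_split\<close>; an error \<epsilon> on both branches stays at most \<epsilon>
  after averaging and discounting.\<close>

lemma v_fin_split:
  assumes p: "p \<in> {0..1}" and t: "0 < \<tau>" and xy: "x \<in> {0..1}" "y \<in> {0..1}" and al: "\<alpha> \<in> {0..1}"
    and mean: "\<alpha> * x + (1 - \<alpha>) * y = dr p \<tau>" and C: "0 \<le> C" "ups_cost c (split_post x y \<alpha>) (dr p \<tau>) \<le> ereal C"
  shows "flow_until p \<tau> + exp (- r * \<tau>) * (\<alpha> * v_fin x + (1 - \<alpha>) * v_fin y - C - \<kappa>) \<le> v_fin p"
proof (rule field_le_epsilon)
  fix \<epsilon> :: real assume e: "0 < \<epsilon>"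
  have "\<exists>z. finite_value q z \<and> v_fin q - \<epsilon> < z" if q: "q \<in> {0..1}" for q
    using less_cSup_iff[OF finite_value_nonempty[OF q] finite_value_bdd[OF q], of "v_fin q - \<epsilon>"] e unfolding v_fin_def[symmetric] by auto
  then obtain z where z: "\<And>q. q \<in> {0..1} \<Longrightarrow> finite_value q (z q)" "\<And>q. q \<in> {0..1} \<Longrightarrow> v_fin q - \<epsilon> < z q" by metis
  have "flow_until p \<tau> + exp (- r * \<tau>) * (\<alpha> * z x + (1 - \<alpha>) * z y - C - \<kappa>) \<le> v_fin p"
    by (rule finite_value_le_v_fin[OF p finite_value_split[OF p t xy al mean C]]) (use z xy in auto)
  moreover have "exp (- r * \<tau>) * (\<alpha> * v_fin x + (1 - \<alpha>) * v_fin y - C - \<kappa>) - \<epsilon> \<le> exp (- r * \<tau>) * (\<alpha> * z x + (1 - \<alpha>) * z y - C - \<kappa>)"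
  proof -
    have "\<alpha> * (v_fin x - \<epsilon>) + (1 - \<alpha>) * (v_fin y - \<epsilon>) \<le> \<alpha> * z x + (1 - \<alpha>) * z y"
      using z(2)[OF xy(1)] z(2)[OF xy(2)] al by (intro add_mono mult_left_mono) auto
    then have "\<alpha> * v_fin x + (1 - \<alpha>) * v_fin y - C - \<kappa> - \<epsilon> \<le> \<alpha> * z x + (1 - \<alpha>) * z y - C - \<kappa>"
      by (simp add: algebra_simps)
    then have "exp (- r * \<tau>) * (\<alpha> * v_fin x + (1 - \<alpha>) * v_fin y - C - \<kappa> - \<epsilon>) \<le> exp (- r * \<tau>) * (\<alpha> * z x + (1 - \<alpha>) * z y - C - \<kappa>)"
      by (rule mult_left_mono) simp
    moreover have "exp (- r * \<tau>) * \<epsilon> \<le> 1 * \<epsilon>" using e r t by (intro mult_right_mono) auto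
    ultimately show ?thesis by (simp add: algebra_simps)
  qed
  ultimately show "flow_until p \<tau> + exp (- r * \<tau>) * (\<alpha> * v_fin x + (1 - \<alpha>) * v_fin y - C - \<kappa>) \<le> v_fin p + \<epsilon>" by linarith
qed

lemma v_fin_delayed:
  assumes p: "p \<in> {0..1}" and t: "0 < \<tau>" and eta: "\<eta> \<in> binary_values v_fin (dr p \<tau>)"
  shows "flow_until p \<tau> + exp (- r * \<tau>) * (\<eta> - \<kappa>) \<le> v_fin p"
proof -
  have q: "dr p \<tau> \<in> {0..1}" using drift_in[OF p] t by simp
  from eta show ?thesis
  proof (cases rule: binary_values_cases)
    case 1
    \<comment> \<open>The uninformative experiment is the split of the belief into itself.\<close>
    then show ?thesis
      using v_fin_split[OF p t q q, of 1 0] ups_cost_split_post_diag[OF q] by (simp add: zero_ereal_def)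
  next
    case (2 x y \<alpha>)
    have "flow_until p \<tau> + exp (- r * \<tau>) * (\<alpha> * v_fin x + (1 - \<alpha>) * v_fin y - (\<alpha> * cr x + (1 - \<alpha>) * cr y - cr (dr p \<tau>)) - \<kappa>) \<le> v_fin p"
    proof (rule v_fin_split[OF p t 2(1,2)[THEN dom_c_unit] _ 2(8)])
      show "ups_cost c (split_post x y \<alpha>) (dr p \<tau>) \<le> ereal (\<alpha> * cr x + (1 - \<alpha>) * cr y - cr (dr p \<tau>))"
        by (rule ups_cost_split_post[OF 2(1,2) _ cr_convex(2)[OF 2(1-4)]]) (use 2(6,7) in auto)
    qed (use 2(6,7,9) in auto)
    moreover have "\<eta> = \<alpha> * v_fin x + (1 - \<alpha>) * v_fin y - (\<alpha> * cr x + (1 - \<alpha>) * cr y - cr (dr p \<tau>))"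
      unfolding 2(10) by (simp only: algebra_simps)
    ultimately show ?thesis by simp
  qed
qed

text \<open>Policies have strictly increasing acquisition times, so an immediate acquisition after another
  one is only approximated, by the same splitting carried out after a vanishing delay.\<close>
lemma v_fin_immediate:
  assumes p: "p \<in> {0..1}" and eta: "\<eta> \<in> binary_values v_fin p"
  shows "\<eta> - \<kappa> \<le> v_fin p"
  using eta
proof (cases rule: binary_values_cases)
  case 1
  then show ?thesis using kappa by simp
next
  case (2 x y \<alpha>)
  \<comment> \<open>A belief that can be split lies in the open interval, where \<open>cr\<close>
    and \<open>vl\<close> are continuous.\<close>
  have p': "p \<in> {0<..<1}" using 2(1-4) dom_c_unit[OF 2(1)] dom_c_unit[OF 2(2)] by auto
  \<comment> \<open>The posteriors \<open>x\<close> and \<open>y\<close> stay fixed while the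
    weights are recomputed for the drifted belief, so the delayed split remains Bayes plausible and
    its payoff converges as the delay vanishes.\<close>
  define f where "f \<tau> = flow_until p \<tau> + exp (- r * \<tau>) * (((y - dr p \<tau>) / (y - x)) * (v_fin x - cr x) 
     + (1 - (y - dr p \<tau>) / (y - x)) * (v_fin y - cr y) + cr (dr p \<tau>) - \<kappa>)" for \<tau>
  have drl: "(dr p \<longlongrightarrow> p) (at_right 0)"
  proof -
    have "((\<lambda>t. dr p t) \<longlongrightarrow> dr p 0) (at_right 0)"
      unfolding drift_def by (intro tendsto_intros)
    then show ?thesis by simp
  qed
  have expl: "((\<lambda>\<tau>. exp (- r * \<tau>)) \<longlongrightarrow> 1) (at_right 0)"
  proof -
    have "((\<lambda>\<tau>. exp (- r * \<tau>)) \<longlongrightarrow> exp (- r * 0)) (at_right 0)" by (intro tendsto_intros)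
    then show ?thesis by simp
  qed
  have "isCont vl p"
    using continuous_on_interior[OF vl_continuous, of p] p' by simp
  then have vll: "((\<lambda>\<tau>. vl (dr p \<tau>)) \<longlongrightarrow> vl p) (at_right 0)" using drl by (rule isCont_tendsto_compose)
  have "isCont cr p"
    using cr_continuous p' by (simp add: continuous_on_eq_continuous_at)
  then have crl: "((\<lambda>\<tau>. cr (dr p \<tau>)) \<longlongrightarrow> cr p) (at_right 0)" using drl by (rule isCont_tendsto_compose)
  have ev0: "\<forall>\<^sub>F \<tau> in at_right 0. 0 < (\<tau>::real)" by (rule eventually_at_right_less)
  have "((\<lambda>\<tau>. vl p - exp (- r * \<tau>) * vl (dr p \<tau>)) \<longlongrightarrow> vl p - 1 * vl p) (at_right 0)"
    by (intro tendsto_intros expl vll)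
  moreover have "\<forall>\<^sub>F \<tau> in at_right 0. vl p - exp (- r * \<tau>) * vl (dr p \<tau>) = flow_until p \<tau>"
    using ev0 by eventually_elim (simp add: flow_until_eq[OF p])
  ultimately have Ul: "(flow_until p \<longlongrightarrow> vl p - 1 * vl p) (at_right 0)" by (rule Lim_transform_eventually)
  have "(f \<longlongrightarrow> (vl p - 1 * vl p) + 1 * (((y - p) / (y - x)) * (v_fin x - cr x) + (1 - (y - p) / (y - x)) * (v_fin y - cr y) + cr p - \<kappa>)) (at_right 0)"
    unfolding f_def using 2(3,4) by (intro tendsto_intros Ul expl drl crl) auto
  then have "(f \<longlongrightarrow> \<eta> - \<kappa>) (at_right 0)" unfolding 2(10) 2(5) by simp
  moreover have "\<forall>\<^sub>F \<tau> in at_right 0. f \<tau> \<le> v_fin p"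
    using ev0 order_tendstoD(1)[OF drl 2(3)] order_tendstoD(2)[OF drl 2(4)]
  proof eventually_elim
    fix \<tau> assume t: "0 < \<tau>" "x < dr p \<tau>" "dr p \<tau> < y"
    show "f \<tau> \<le> v_fin p" unfolding f_def
      by (rule v_fin_delayed[OF p t(1)]) (rule binary_values_mem[OF 2(1,2) t(2,3) refl])
  qed
  ultimately show ?thesis by (intro tendsto_upperbound) auto
qed

lemma v_fin_super: "v_fin \<in> super_sols"
proof -
  obtain K where "\<And>w. \<forall>p\<in>{0..1}. vl p \<le> w p \<and> w p \<le> vh p \<Longrightarrow> \<forall>q\<in>{0..1}. \<bar>w q\<bar> \<le> K" using between_bound by metis
  then have "\<forall>q\<in>{0..1}. \<bar>v_fin q\<bar> \<le> K" using vl_le_v_fin v_fin_le_vh by blast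
  then have K: "\<forall>q\<in>{0..1}. v_fin q \<le> K" by (meson abs_le_D1)
  have "binary_bellman v_fin p \<le> v_fin p" if p: "p \<in> {0..1}" for p
    unfolding binary_bellman_le_iff[OF K p]
  proof (intro allI impI ballI)
    fix \<tau> \<eta> assume t: "0 \<le> \<tau>" and eta: "\<eta> \<in> binary_values v_fin (dr p \<tau>)"
    show "flow_until p \<tau> + exp (- r * \<tau>) * (\<eta> - \<kappa>) \<le> v_fin p"
    proof (cases "\<tau> = 0")
      case True
      then show ?thesis using v_fin_immediate[OF p] eta flow_until_eq[OF p, of 0] by simp
    next
      case False
      then show ?thesis using v_fin_delayed[OF p _ eta] t by simp
    qed
  qed
  then show ?thesis using vl_le_v_fin v_fin_le_vh by (auto simp: super_sols_def simp del: atLeastAtMost_iff)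
qed

section \<open>The value function as the least supersolution\<close>

abbreviation "V \<equiv> value_fn u c \<kappa> r lam0 lam1"

lemma V_characterization:
  obtains w where "w \<in> borel_measurable PostM" "\<forall>p\<in>{0..1}. vl p \<le> w p \<and> w p \<le> vh p"
    "\<forall>p\<in>{0..1}. V p = ereal (w p)" "\<forall>p\<in>{0..1}. brhs w p = ereal (w p)"
proof -
  obtain w where w: "w \<in> super_sols" "\<forall>p\<in>{0..1}. binary_bellman w p = w p" "\<And>z p. z \<in> super_sols \<Longrightarrow> p \<in> {0..1} \<Longrightarrow> w p \<le> z p"
    using least_super_sol[OF v_fin_super] by metis
  have btw: "\<forall>p\<in>{0..1}. vl p \<le> w p \<and> w p \<le> vh p" using w(1) by (auto simp: super_sols_def)
  obtain K where "\<And>w. \<forall>p\<in>{0..1}. vl p \<le> w p \<and> w p \<le> vh p \<Longrightarrow> \<forall>q\<in>{0..1}. \<bar>w q\<bar> \<le> K" using between_bound by metis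
  then have K: "\<forall>q\<in>{0..1}. \<bar>w q\<bar> \<le> K" using btw by blast
  then have "\<forall>q\<in>{0..1}. w q \<le> K" by (meson abs_le_D1)
  from binary_bellman_measurable[OF this] have wm: "w \<in> borel_measurable PostM"
    using w(2) by (subst measurable_cong[where g="binary_bellman w"]) auto
  have br: "\<forall>p\<in>{0..1}. brhs w p = ereal (w p)"
    using brhs_eq_binary_bellman[OF wm K] w(2) by simp
  have "V p = ereal (w p)" if p: "p \<in> {0..1}" for p
  proof (rule antisym)
    show le: "V p \<le> ereal (w p)"
      unfolding value_fn_def using br by (intro SUP_least) (auto intro!: verification[OF wm K _ p])
    have ge: "ereal z \<le> V p" if z: "finite_value p z" for z
    proof -
      obtain M F where MF: "policy lam0 lam1 p M F" "ereal z \<le> payoff' p M F" using finite_value_le_payoff[OF z] by blast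
      have "payoff' p (fst (M, F)) (snd (M, F)) \<le> V p"
        unfolding value_fn_def by (rule SUP_upper) (use MF in auto)
      then show ?thesis using MF(2) by auto
    qed
    \<comment> \<open>\<open>V p\<close> is real, being caught between one finite value and
      \<open>w p\<close>.\<close>
    obtain v where v: "V p = ereal v"
      using le ge finite_value_no_info[OF p, of 1] by (cases "V p") auto
    have "v_fin p \<le> v" unfolding v_fin_def
      by (rule cSup_least[OF finite_value_nonempty[OF p]]) (use ge v in auto)
    then show "ereal (w p) \<le> V p" using w(3)[OF v_fin_super p] v by simp
  qed
  then show thesis using that[OF wm btw _ br] by blast
qed

lemma fixed_point_unique:
  assumes "w1 \<in> borel_measurable PostM" "\<forall>p\<in>{0..1}. vl p \<le> w1 p \<and> w1 p \<le> vh p" "\<forall>p\<in>{0..1}. brhs w1 p = ereal (w1 p)"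
    and "w2 \<in> borel_measurable PostM" "\<forall>p\<in>{0..1}. vl p \<le> w2 p \<and> w2 p \<le> vh p" "\<forall>p\<in>{0..1}. brhs w2 p = ereal (w2 p)"
    and "p \<in> {0..1}"
  shows "w1 p = w2 p"
proof -
  obtain K where K: "\<And>w. \<forall>p\<in>{0..1}. vl p \<le> w p \<and> w p \<le> vh p \<Longrightarrow> \<forall>q\<in>{0..1}. \<bar>w q\<bar> \<le> K" using between_bound by metis
  show ?thesis
    by (rule antisym; rule comparison[where K=K]) (use assms K in auto)
qed

end

section \<open>From the decision problem to the locale\<close>

lemma exp_util_bdd:
  assumes "\<exists>a\<in>A. \<forall>b\<in>A. exp_util ut b p \<le> exp_util ut a p"
  shows "bdd_above ((\<lambda>a. exp_util ut a p) ` A)"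
  using assms by (auto intro: bdd_aboveI2)

text \<open>Continuity is given on the unit interval only, while the locale asks for measurability
  on the whole line. Where it is over a bounded set, the supremum of affine functions is at most
  \<open>z\<close> exactly on the closed set \<open>S z\<close>.\<close>

lemma indirect_u_measurable:
  assumes "A \<noteq> {}"
  shows "indirect_u A ut \<in> borel_measurable borel"
proof -
  define S where "S z = {p. \<forall>a\<in>A. exp_util ut a p \<le> z}" for z
  have cl: "closed (S z)" for z
  proof -
    have "S z = (\<Inter>a\<in>A. {p. exp_util ut a p \<le> z})" by (auto simp: S_def)
    then show ?thesis unfolding exp_util_def by (auto intro!: closed_INT closed_Collect_le continuous_intros)
  qed
  have bdd: "bdd_above ((\<lambda>a. exp_util ut a p) ` A) \<longleftrightarrow> (\<exists>n. p \<in> S (real n))" for p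
  proof
    assume "bdd_above ((\<lambda>a. exp_util ut a p) ` A)"
    then obtain M where "\<forall>a\<in>A. exp_util ut a p \<le> M" unfolding bdd_above_def by auto
    moreover obtain n where "M \<le> real n" using real_arch_simple by blast
    ultimately have "p \<in> S (real n)" unfolding S_def using order_trans by blast
    then show "\<exists>n. p \<in> S (real n)" ..
  qed (auto simp: S_def bdd_above_def)
  \<comment> \<open>Outside the unit interval the supremum may be over an unbounded set, where it has one fixed junk value.\<close>
  define k where "k = (LEAST z::real. False)"
  have junk: "indirect_u A ut p = k" if "\<not> bdd_above ((\<lambda>a. exp_util ut a p) ` A)" for p
  proof -
    have "(\<lambda>z. \<forall>x\<in>(\<lambda>a. exp_util ut a p) ` A. x \<le> z) = (\<lambda>z. False)"
      using that unfolding bdd_above_def by (intro ext) blast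
    then show ?thesis unfolding indirect_u_def Sup_real_def k_def by simp
  qed
  have le: "indirect_u A ut p \<le> z \<longleftrightarrow> p \<in> S z" if "bdd_above ((\<lambda>a. exp_util ut a p) ` A)" for p z
    unfolding indirect_u_def S_def using cSUP_le_iff[OF assms that] by auto
  have [measurable]: "S z \<in> sets borel" for z using cl by (rule borel_closed)
  have "{p. indirect_u A ut p \<le> z} = S z \<union> (if k \<le> z then - (\<Union>n. S (real n)) else {})" for z
  proof (intro set_eqI)
    fix p
    show "p \<in> {p. indirect_u A ut p \<le> z} \<longleftrightarrow> p \<in> S z \<union> (if k \<le> z then - (\<Union>n. S (real n)) else {})"
    proof (cases "bdd_above ((\<lambda>a. exp_util ut a p) ` A)")
      case True
      then show ?thesis using le[OF True] bdd[of p] by auto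
    next
      case False
      then have "p \<notin> S z" unfolding S_def bdd_above_def by auto
      then show ?thesis using junk[OF False] bdd[of p] False by auto
    qed
  qed
  then show ?thesis unfolding borel_measurable_iff_le by auto
qed

theorem theorem1:
  fixes A :: "'a set" and ut :: "'a \<Rightarrow> bool \<Rightarrow> real"
    and c :: "real \<Rightarrow> ereal" and lam0 lam1 r \<kappa> :: real
  assumes "lam0 > 0" and "lam1 > 0" and "r > 0" and "\<kappa> > 0"
    and "A \<noteq> {}"
    and "\<forall>p\<in>{0..1}. \<exists>a\<in>A. \<forall>b\<in>A. exp_util ut b p \<le> exp_util ut a p"
    and "continuous_on {0..1} (indirect_u A ut)"
    and "admissible_c c"
  shows "(\<forall>p\<in>{0..1}. \<bar>value_fn (indirect_u A ut) c \<kappa> r lam0 lam1 p\<bar> \<noteq> \<infinity>)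
    \<and> (\<lambda>p. real_of_ereal (value_fn (indirect_u A ut) c \<kappa> r lam0 lam1 p)) \<in> CandV A ut r lam0 lam1
    \<and> (\<forall>p\<in>{0..1}. value_fn (indirect_u A ut) c \<kappa> r lam0 lam1 p
          = bellman_rhs (indirect_u A ut) c \<kappa> r lam0 lam1
              (\<lambda>q. real_of_ereal (value_fn (indirect_u A ut) c \<kappa> r lam0 lam1 q)) p)
    \<and> (\<forall>w\<in>CandV A ut r lam0 lam1.
          (\<forall>p\<in>{0..1}. ereal (w p) = bellman_rhs (indirect_u A ut) c \<kappa> r lam0 lam1 w p) \<longrightarrow>
          (\<forall>p\<in>{0..1}. w p = real_of_ereal (value_fn (indirect_u A ut) c \<kappa> r lam0 lam1 p)))"
proof -
  \<comment> \<open>The line through the best payoffs under a known state: \<open>a\<close> for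
    state \<open>False\<close> and \<open>a + b\<close> for state \<open>True\<close>.\<close>
  define a where "a = (SUP a\<in>A. ut a False)"
  define b where "b = (SUP a\<in>A. ut a True) - a"
  have bdd: "bdd_above ((\<lambda>a. ut a False) ` A)" "bdd_above ((\<lambda>a. ut a True) ` A)"
    using exp_util_bdd[OF assms(6)[rule_format, of 0]] exp_util_bdd[OF assms(6)[rule_format, of 1]]
    by (simp_all add: exp_util_def)
  have pu: "perfect_u A ut q = a + b * q" for q
    by (simp add: perfect_u_def a_def b_def algebra_simps)
  have u_le: "indirect_u A ut q \<le> a + b * q" if q: "q \<in> {0..1}" for q
  proof -
    have "exp_util ut x q \<le> perfect_u A ut q" if "x \<in> A" for x
      unfolding exp_util_def perfect_u_def using q that bdd
      by (intro add_mono mult_left_mono cSUP_upper) auto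
    then show ?thesis unfolding indirect_u_def pu[symmetric] by (rule cSUP_least[OF assms(5)])
  qed
  interpret info_acquisition lam0 lam1 r \<kappa> a b "indirect_u A ut" c
    by unfold_locales (use assms u_le indirect_u_measurable[OF assms(5)] in auto)
  have vl: "v_low A ut r lam0 lam1 p = vl p" and vh: "v_high A ut r lam0 lam1 p = vh p" for p
    by (simp_all add: v_low_def v_high_def vl_def vh_def disc_def pu)
  obtain w where w: "w \<in> borel_measurable PostM" "\<forall>p\<in>{0..1}. vl p \<le> w p \<and> w p \<le> vh p"
    "\<forall>p\<in>{0..1}. V p = ereal (w p)" "\<forall>p\<in>{0..1}. brhs w p = ereal (w p)"
    using V_characterization by blast
  obtain K where "\<And>w. \<forall>p\<in>{0..1}. vl p \<le> w p \<and> w p \<le> vh p \<Longrightarrow> \<forall>q\<in>{0..1}. \<bar>w q\<bar> \<le> K" using between_bound by metis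
  then have K: "\<forall>q\<in>{0..1}. \<bar>w q\<bar> \<le> K" using w(2) by blast
  let ?v = "\<lambda>p. real_of_ereal (V p)"
  have v: "\<forall>p\<in>{0..1}. ?v p = w p" using w(3) by simp
  have "?v \<in> borel_measurable PostM"
    using w(1) v by (subst measurable_cong[where g=w]) auto
  moreover have "bounded (?v ` {0..1})"
    using K v unfolding bounded_iff by (intro exI[of _ K]) auto
  ultimately have cand: "?v \<in> CandV A ut r lam0 lam1"
    using w(2) v unfolding CandV_def vl vh by (simp del: atLeastAtMost_iff)
  moreover have "\<forall>p\<in>{0..1}. V p = brhs ?v p"
    using w(3,4) brhs_cong[OF v] by simp
  moreover have "\<forall>z\<in>CandV A ut r lam0 lam1. (\<forall>p\<in>{0..1}. ereal (z p) = brhs z p) \<longrightarrow> (\<forall>p\<in>{0..1}. z p = ?v p)"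
  proof (intro ballI impI)
    fix z p assume z: "z \<in> CandV A ut r lam0 lam1" "\<forall>p\<in>{0..1}. ereal (z p) = brhs z p" and p: "p \<in> {0..1::real}"
    have "z p = w p"
      by (rule fixed_point_unique[OF _ _ _ w(1,2,4) p]) (use z in \<open>simp_all add: CandV_def vl vh\<close>)
    then show "z p = ?v p" using v p by simp
  qed
  moreover have "\<forall>p\<in>{0..1}. \<bar>V p\<bar> \<noteq> \<infinity>" using w(3) by simp
  ultimately show ?thesis by (intro conjI)
qed

end
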